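(* Let $(F_n)_{n\in\mathbb N}$ be a sequence of finite-dimensional Banach spaces that is dense, with respect to the Banach–Mazur distance, in the family of all finite-dimensional Banach spaces. If $H$ is any closed subspace of $c_0$ such that $H^*=\ell_1(F_n)$, then there are continuous bilinear forms on $H^\perp\subseteq\ell_1$ (that is, maps $H^\perp\times H^\perp\to\mathbb K$) that cannot be extended to continuous bilinear forms on $\ell_1$.
   Context: $\mathbb K$ is the scalar field. $\ell_1(F_n)$ is the Banach space of sequences $(f_n)_n$ with $f_n\in F_n$ and $\|(f_n)\|=\sum_n\|f_n\|<\infty$. The identity $H^*=\ell_1(F_n)$ is understood up to isomorphism of Banach spaces. Under $c_0^*=\ell_1$, $H^\perp=\{x\in\ell_1:\langle x,h\rangle=0\text{ for all }h\in H\}$. Density means: for every finite-dimensional Banach space $E$ and every $\varepsilon>0$ there is $n$ such that $\dim F_n=\dim E$ and the Banach–Mazur distance satisfies $d(E,F_n)\le 1+\varepsilon$. *)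

theory Defs
  imports "HOL-Analysis.Analysis" "HOL-Library.Function_Algebras"
begin

(* The members of this class are, up to isometric isomorphism, exactly the fields of
   real and of complex numbers with their usual absolute values. *)
class real_or_complex = real_normed_field +
  assumes real_or_complex:
    "(\<forall>x. \<exists>a. x = a *\<^sub>R 1) \<or>
     (\<exists>i. i * i = - 1 \<and>
       (\<forall>x. \<exists>a b. x = a *\<^sub>R 1 + b *\<^sub>R i \<and> norm x = sqrt (a\<^sup>2 + b\<^sup>2)))"

instance real :: real_or_complex
  by standard simp

instance complex :: real_or_complex
proof
  have "x = Re x *\<^sub>R 1 + Im x *\<^sub>R \<i> \<and> norm x = sqrt ((Re x)\<^sup>2 + (Im x)\<^sup>2)" for x
    by (simp add: complex_eq_iff cmod_def)
  then show "(\<forall>x::complex. \<exists>a. x = a *\<^sub>R 1) \<or>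
     (\<exists>i::complex. i * i = - 1 \<and>
       (\<forall>x. \<exists>a b. x = a *\<^sub>R 1 + b *\<^sub>R i \<and> norm x = sqrt (a\<^sup>2 + b\<^sup>2)))"
    by (metis i_squared)
qed

(* A normed space is a linear subspace V of an ambient vector space (the type 'v with
   scalar multiplication s) together with a function N that is a norm on V;
   the values of N outside V are irrelevant. *)
locale normed_space_on = vector_space s
  for s :: "'k::real_normed_field \<Rightarrow> 'v::ab_group_add \<Rightarrow> 'v" +
  fixes V :: "'v set" and N :: "'v \<Rightarrow> real"
  assumes subspace_carrier: "subspace V"
    and norm_on_nonneg: "x \<in> V \<Longrightarrow> 0 \<le> N x"
    and norm_on_eq_0D: "x \<in> V \<Longrightarrow> N x = 0 \<Longrightarrow> x = 0"
    and norm_on_triangle: "x \<in> V \<Longrightarrow> y \<in> V \<Longrightarrow> N (x + y) \<le> N x + N y"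
    and norm_on_scale: "x \<in> V \<Longrightarrow> N (s c x) = norm c * N x"

(* The value 0 off V makes this satisfy the unrelativised axioms of Metric_space. *)
definition norm_dist :: "'v::ab_group_add set \<Rightarrow> ('v \<Rightarrow> real) \<Rightarrow> 'v \<Rightarrow> 'v \<Rightarrow> real" where
  "norm_dist V N x y = (if x \<in> V \<and> y \<in> V then N (x - y) else 0)"

lemma (in normed_space_on) Metric_space_norm_dist: "Metric_space V (norm_dist V N)"
proof
  fix x y z
  have diff: "a - b \<in> V" if "a \<in> V" "b \<in> V" for a b
    using subspace_carrier that by (rule subspace_diff)
  show "0 \<le> norm_dist V N x y"
    by (simp add: norm_dist_def norm_on_nonneg diff)
  have "N (a - b) = N (b - a)" if "a \<in> V" "b \<in> V" for a b
    using norm_on_scale[OF diff[OF that(2,1)], of "-1"] by simp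
  then show "norm_dist V N x y = norm_dist V N y x"
    by (simp add: norm_dist_def)
  have "N 0 = 0"
    using norm_on_scale[OF subspace_0[OF subspace_carrier], of 0] by simp
  then show "norm_dist V N x y = 0 \<longleftrightarrow> x = y" if "x \<in> V" "y \<in> V"
    using that norm_on_eq_0D[OF diff[OF that]] by (auto simp: norm_dist_def)
  show "norm_dist V N x z \<le> norm_dist V N x y + norm_dist V N y z"
    if "x \<in> V" "y \<in> V" "z \<in> V"
    using that norm_on_triangle[OF diff diff, of x y y z] by (simp add: norm_dist_def)
qed

locale finite_dim_banach_on = normed_space_on s V N
  for s :: "'k::real_normed_field \<Rightarrow> 'v::ab_group_add \<Rightarrow> 'v" and V N +
  assumes complete_carrier: "Metric_space.mcomplete V (norm_dist V N)"
    and finite_dim_carrier: "\<exists>B. finite B \<and> V = span B"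

definition linear_map_on ::
  "('k \<Rightarrow> 'v::ab_group_add \<Rightarrow> 'v) \<Rightarrow> ('k \<Rightarrow> 'w::ab_group_add \<Rightarrow> 'w) \<Rightarrow> 'v set \<Rightarrow> ('v \<Rightarrow> 'w) \<Rightarrow> bool"
  where
  "linear_map_on s t V T \<longleftrightarrow>
     (\<forall>x\<in>V. \<forall>y\<in>V. T (x + y) = T x + T y) \<and> (\<forall>c. \<forall>x\<in>V. T (s c x) = t c (T x))"

definition bounded_map_on ::
  "'v set \<Rightarrow> ('v \<Rightarrow> real) \<Rightarrow> ('w \<Rightarrow> real) \<Rightarrow> ('v \<Rightarrow> 'w) \<Rightarrow> bool" where
  "bounded_map_on V N M T \<longleftrightarrow> (\<exists>C. \<forall>x\<in>V. M (T x) \<le> C * N x)"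

definition op_norm :: "'v set \<Rightarrow> ('v \<Rightarrow> real) \<Rightarrow> ('w \<Rightarrow> real) \<Rightarrow> ('v \<Rightarrow> 'w) \<Rightarrow> real" where
  "op_norm V N M T = (SUP x\<in>{x\<in>V. N x \<le> 1}. M (T x))"

definition banach_iso ::
  "('k \<Rightarrow> 'v::ab_group_add \<Rightarrow> 'v) \<Rightarrow> 'v set \<Rightarrow> ('v \<Rightarrow> real) \<Rightarrow>
   ('k \<Rightarrow> 'w::ab_group_add \<Rightarrow> 'w) \<Rightarrow> 'w set \<Rightarrow> ('w \<Rightarrow> real) \<Rightarrow> ('v \<Rightarrow> 'w) \<Rightarrow> bool" where
  "banach_iso s V N t W M T \<longleftrightarrow>
     linear_map_on s t V T \<and> bij_betw T V W \<and>
     bounded_map_on V N M T \<and> bounded_map_on W M N (inv_into V T)"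

(* Meaningful only for isomorphic spaces (otherwise the infimum of the empty set occurs). *)
definition banach_mazur_dist ::
  "('k \<Rightarrow> 'v::ab_group_add \<Rightarrow> 'v) \<Rightarrow> 'v set \<Rightarrow> ('v \<Rightarrow> real) \<Rightarrow>
   ('k \<Rightarrow> 'w::ab_group_add \<Rightarrow> 'w) \<Rightarrow> 'w set \<Rightarrow> ('w \<Rightarrow> real) \<Rightarrow> real" where
  "banach_mazur_dist s V N t W M =
     Inf {op_norm V N M T * op_norm W M N (inv_into V T) | T. banach_iso s V N t W M T}"

definition pointwise_scale :: "('k \<Rightarrow> 'v \<Rightarrow> 'v) \<Rightarrow> 'k \<Rightarrow> ('i \<Rightarrow> 'v) \<Rightarrow> 'i \<Rightarrow> 'v" where
  "pointwise_scale s c f = (\<lambda>i. s c (f i))"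

abbreviation scale_fun :: "'k::real_normed_field \<Rightarrow> ('i \<Rightarrow> 'k) \<Rightarrow> 'i \<Rightarrow> 'k" where
  "scale_fun \<equiv> pointwise_scale (*)"

lemma vector_space_pointwise_scale:
  assumes "vector_space s"
  shows "vector_space (pointwise_scale s)"
proof -
  interpret vector_space s by fact
  show ?thesis
    by standard (auto simp: pointwise_scale_def scale_right_distrib scale_left_distrib)
qed

(* Every finite-dimensional space over 'k is isometrically isomorphic to one whose carrier
   is a subspace of the space of all scalar sequences, so letting (V, N) range over the
   latter is no restriction on E. *)
definition banach_mazur_dense ::
  "('k::real_normed_field \<Rightarrow> 'v::ab_group_add \<Rightarrow> 'v) \<Rightarrow> (nat \<Rightarrow> 'v set) \<Rightarrow> (nat \<Rightarrow> 'v \<Rightarrow> real) \<Rightarrow> bool"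
  where
  "banach_mazur_dense s F NF \<longleftrightarrow>
     (\<forall>(V :: (nat \<Rightarrow> 'k) set) N. finite_dim_banach_on scale_fun V N \<longrightarrow>
       (\<forall>\<epsilon>>0. \<exists>n. vector_space.dim s (F n) = vector_space.dim scale_fun V \<and>
          banach_mazur_dist scale_fun V N s (F n) (NF n) \<le> 1 + \<epsilon>))"

definition l1_sum :: "(nat \<Rightarrow> 'v set) \<Rightarrow> (nat \<Rightarrow> 'v \<Rightarrow> real) \<Rightarrow> (nat \<Rightarrow> 'v) set" where
  "l1_sum F NF = {f. (\<forall>n. f n \<in> F n) \<and> summable (\<lambda>n. NF n (f n))}"

definition l1_sum_norm :: "(nat \<Rightarrow> 'v \<Rightarrow> real) \<Rightarrow> (nat \<Rightarrow> 'v) \<Rightarrow> real" where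
  "l1_sum_norm NF f = (\<Sum>n. NF n (f n))"

definition l1 :: "(nat \<Rightarrow> 'k::real_normed_field) set" where
  "l1 = l1_sum (\<lambda>n. UNIV) (\<lambda>n. norm)"

definition l1_norm :: "(nat \<Rightarrow> 'k::real_normed_field) \<Rightarrow> real" where
  "l1_norm = l1_sum_norm (\<lambda>n. norm)"

definition c0 :: "(nat \<Rightarrow> 'k::real_normed_field) set" where
  "c0 = {x. x \<longlonglongrightarrow> 0}"

definition c0_norm :: "(nat \<Rightarrow> 'k::real_normed_field) \<Rightarrow> real" where
  "c0_norm x = (SUP n. norm (x n))"

definition closed_subspace_c0 :: "(nat \<Rightarrow> 'k::real_normed_field) set \<Rightarrow> bool" where
  "closed_subspace_c0 H \<longleftrightarrow> module.subspace scale_fun H \<and>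
     closedin (Metric_space.mtopology c0 (norm_dist c0 c0_norm)) H"

(* A functional on V is represented by its extension by 0 to the ambient type. *)
definition dual_space ::
  "('k \<Rightarrow> 'v::ab_group_add \<Rightarrow> 'v) \<Rightarrow> 'v set \<Rightarrow> ('v \<Rightarrow> real) \<Rightarrow> ('v \<Rightarrow> 'k::real_normed_field) set" where
  "dual_space s V N =
     {\<phi>. linear_map_on s (*) V \<phi> \<and> bounded_map_on V N norm \<phi> \<and> (\<forall>x. x \<notin> V \<longrightarrow> \<phi> x = 0)}"

definition dual_norm ::
  "'v set \<Rightarrow> ('v \<Rightarrow> real) \<Rightarrow> ('v \<Rightarrow> 'k::real_normed_field) \<Rightarrow> real" where
  "dual_norm V N \<phi> = op_norm V N norm \<phi>"

definition annihilator :: "(nat \<Rightarrow> 'k::real_normed_field) set \<Rightarrow> (nat \<Rightarrow> 'k) set" where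
  "annihilator H = {x \<in> l1. \<forall>h\<in>H. (\<Sum>n. x n * h n) = 0}"

definition continuous_bilinear_form_on ::
  "('k \<Rightarrow> 'v::ab_group_add \<Rightarrow> 'v) \<Rightarrow> 'v set \<Rightarrow> ('v \<Rightarrow> real) \<Rightarrow>
   ('v \<Rightarrow> 'v \<Rightarrow> 'k::real_normed_field) \<Rightarrow> bool" where
  "continuous_bilinear_form_on s V N B \<longleftrightarrow>
     (\<forall>y\<in>V. linear_map_on s (*) V (\<lambda>x. B x y)) \<and>
     (\<forall>x\<in>V. linear_map_on s (*) V (B x)) \<and>
     (\<exists>C. \<forall>x\<in>V. \<forall>y\<in>V. norm (B x y) \<le> C * N x * N y)"

end

theory Submission
  imports Defs
begin

text \<open>Write \<open>A\<close> for the annihilator of \<open>H\<close>.  By Hahn--Banach every functional on \<open>H\<close> comes from \<open>l1\<close>, so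
the hypothesis on the dual provides a bounded linear surjection \<open>q\<close> of \<open>l1\<close> onto the \<open>l1\<close>-sum of the
\<open>F n\<close> with kernel \<open>A\<close> (\<open>annihilator_quotient_map\<close>).

The obstruction is finite-dimensional.  On \<open>N = 2^d\<close> points let \<open>K\<close> be the span of the \<open>d\<close>
Rademacher functions \<open>r_k\<close> in \<open>l1^N\<close>.  By Khintchine's inequality the norms of \<open>l1^N\<close> and, suitably
normalised, of \<open>l2\<close> are equivalent on \<open>K\<close> with a constant that does not depend on \<open>d\<close>, so the scalar
product of coefficients is a bilinear form on \<open>K\<close> of norm at most 4 (\<open>norm_rad_form_le\<close>).  Yet a
bilinear form \<open>b\<close> of norm \<open>D\<close> on all of \<open>l1^N\<close> is an \<open>N \<times> N\<close> matrix with entries bounded by \<open>D\<close>, and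
averaging the signs shows that the trace \<open>b(r_1, r_1) + ... + b(r_d, r_d)\<close> is at most \<open>D N^2 \<surd>d\<close>
(\<open>rademacher_average_le\<close>), whereas it equals \<open>d N^2\<close> for the scalar product.  Every extension of that
form to \<open>l1^N\<close> therefore has norm at least \<open>\<surd>d\<close>.

The obstruction is carried to \<open>A\<close> because \<open>l1\<close> is projective.  By density some \<open>F n_m\<close> is, with
constant 3, the quotient of \<open>l1^N\<close> by \<open>K\<close> for \<open>d = 16^m\<close>; growing dimensions make the indices
\<open>n_m\<close> distinct.  Lifting \<open>q\<close> followed by the projection to \<open>F n_m\<close> on the unit vectors gives a
bounded map \<open>\<psi>_m\<close> from \<open>l1\<close> to \<open>l1^N\<close> that sends \<open>A\<close> into \<open>K\<close> (\<open>l1_lifting\<close>), and lifting the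
quotient map \<open>l1^N \<rightarrow> F n_m\<close> through \<open>q\<close> gives \<open>Y_m\<close> from \<open>l1^N\<close> to \<open>l1\<close>.  All constants are uniform in
\<open>m\<close>.  The bilinear form is the sum over \<open>m\<close> of \<open>2^-m\<close> times the scalar product of \<open>\<psi>_m x\<close> and \<open>\<psi>_m y\<close>.

Suppose that it extends to \<open>l1\<close>, and consider the trace of its pull-back along \<open>Y_m\<close>.  The
extension makes it \<open>O(N^2 \<surd>d)\<close>.  The summands with index \<open>j \<noteq> m\<close> contribute \<open>O(N^2 \<surd>d)\<close> as well, since
\<open>\<psi>_j Y_m\<close> maps everything into the \<open>j\<close>-th copy of \<open>K\<close>, where the scalar product is bounded
(\<open>rademacher_trace_kernel_le\<close>).  For \<open>j = m\<close>, however, \<open>\<psi>_m Y_m\<close> differs from the identity by a map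
into \<open>K\<close>, so the trace is \<open>d N^2 + O(N^2 \<surd>d)\<close> (\<open>rademacher_trace_main\<close>).  Hence \<open>2^-m \<surd>d\<close> stays
bounded, contrary to \<open>\<surd>d = 4^m\<close>.\<close>

section \<open>Real coordinates of the scalar field\<close>

text \<open>Treats both scalar fields at once: \<open>\<rho>\<close> is the real part, and \<open>j\<close> is the imaginary unit over the
complex field and 0 over the real field, so that \<open>- \<rho> (j * x)\<close> is the imaginary part in the first
case and 0 in the second.\<close>

lemma real_or_complex_coordinates:
  obtains \<rho> :: "'k::real_or_complex \<Rightarrow> real" and j :: 'k
  where "linear \<rho>" and "\<And>x. x = \<rho> x *\<^sub>R 1 - \<rho> (j * x) *\<^sub>R j"
    and "\<And>x. (norm x)\<^sup>2 = (\<rho> x)\<^sup>2 + (\<rho> (j * x))\<^sup>2" and "norm j \<le> 1"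
proof (cases "\<forall>x::'k. \<exists>a. x = a *\<^sub>R 1")
  case True
  then obtain \<rho> :: "'k \<Rightarrow> real" where \<rho>: "\<And>x. x = \<rho> x *\<^sub>R 1"
    by metis
  have uniq: "\<rho> (a *\<^sub>R 1) = a" for a
    using \<rho>[of "a *\<^sub>R 1"] by simp
  have "\<rho> (x + y) = \<rho> x + \<rho> y" "\<rho> (r *\<^sub>R x) = r *\<^sub>R \<rho> x" for x y r
    by (metis \<rho> uniq scaleR_add_left) (metis \<rho> uniq scaleR_scaleR real_scaleR_def)
  then have lin: "linear \<rho>"
    by (rule linearI)
  have "norm x = \<bar>\<rho> x\<bar>" for x
    by (metis \<rho> norm_scaleR norm_one mult.right_neutral)
  then show ?thesis
    using \<rho> lin by (intro that[of \<rho> 0]) (simp_all add: linear_0)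
next
  case False
  then obtain i :: 'k where i: "i * i = - 1" and
    ex: "\<forall>x. \<exists>a b. x = a *\<^sub>R 1 + b *\<^sub>R i \<and> norm x = sqrt (a\<^sup>2 + b\<^sup>2)"
    using real_or_complex by blast
  obtain \<rho> \<eta> :: "'k \<Rightarrow> real" where rep: "\<And>x. x = \<rho> x *\<^sub>R 1 + \<eta> x *\<^sub>R i"
    and nrm: "\<And>x. norm x = sqrt ((\<rho> x)\<^sup>2 + (\<eta> x)\<^sup>2)"
    using ex by metis
  have indep: "a = 0 \<and> b = 0" if "a *\<^sub>R 1 + b *\<^sub>R i = 0" for a b :: real
  proof -
    have "b = 0"
    proof (rule ccontr)
      assume "b \<noteq> 0"
      have "b *\<^sub>R i = (- a) *\<^sub>R 1"
        using that by (simp add: eq_neg_iff_add_eq_0 add.commute)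
      then have "(1 / b) *\<^sub>R (b *\<^sub>R i) = (1 / b) *\<^sub>R ((- a) *\<^sub>R 1)"
        by simp
      then have "i = (- a / b) *\<^sub>R 1"
        using \<open>b \<noteq> 0\<close> by simp
      then have "(((- a / b) * (- a / b)) :: real) *\<^sub>R (1::'k) = (-1) *\<^sub>R 1"
        using i by simp
      then have "(- a / b) * (- a / b) = -1"
        using scaleR_cancel_right one_neq_zero by blast
      then show False
        by (smt (verit) zero_le_square)
    qed
    with that show ?thesis by simp
  qed
  have uniq: "\<rho> (a *\<^sub>R 1 + b *\<^sub>R i) = a \<and> \<eta> (a *\<^sub>R 1 + b *\<^sub>R i) = b" for a b
  proof -
    have "(\<rho> (a *\<^sub>R 1 + b *\<^sub>R i) - a) *\<^sub>R 1 + (\<eta> (a *\<^sub>R 1 + b *\<^sub>R i) - b) *\<^sub>R i = 0"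
      using rep[of "a *\<^sub>R 1 + b *\<^sub>R i"] by (simp add: algebra_simps)
    from indep[OF this] show ?thesis by simp
  qed
  have add: "\<rho> (x + y) = \<rho> x + \<rho> y" for x y
  proof -
    have "x + y = (\<rho> x + \<rho> y) *\<^sub>R 1 + (\<eta> x + \<eta> y) *\<^sub>R i"
      using rep[of x] rep[of y] by (simp add: algebra_simps)
    then show ?thesis using uniq by metis
  qed
  have scale: "\<rho> (r *\<^sub>R x) = r *\<^sub>R \<rho> x" for x r
  proof -
    have "r *\<^sub>R x = (r * \<rho> x) *\<^sub>R 1 + (r * \<eta> x) *\<^sub>R i"
      using rep[of x] by (metis scaleR_right_distrib scaleR_scaleR)
    then show ?thesis using uniq by (metis real_scaleR_def)
  qed
  have im: "\<rho> (i * x) = - \<eta> x" for x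
  proof -
    have "i * x = (- \<eta> x) *\<^sub>R 1 + \<rho> x *\<^sub>R i"
      using arg_cong[OF rep[of x], of "\<lambda>z. i * z"] by (simp add: algebra_simps i)
    then show ?thesis using uniq by metis
  qed
  show ?thesis
  proof (rule that)
    show "linear \<rho>"
      using add scale by (rule linearI)
    show "x = \<rho> x *\<^sub>R 1 - \<rho> (i * x) *\<^sub>R i" for x
      using rep[of x] by (simp add: im)
    show "(norm x)\<^sup>2 = (\<rho> x)\<^sup>2 + (\<rho> (i * x))\<^sup>2" for x
      by (simp add: nrm im)
    have "(norm i)\<^sup>2 = 1"
      using i by (metis norm_minus_cancel norm_mult norm_one power2_eq_square)
    then show "norm i \<le> 1"
      by (simp add: power2_eq_1_iff) (smt (verit) norm_ge_zero)
  qed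
qed

lemma parallelogram_law:
  fixes x y :: "'k::real_or_complex"
  shows "(norm (x + y))\<^sup>2 + (norm (x - y))\<^sup>2 = 2 * (norm x)\<^sup>2 + 2 * (norm y)\<^sup>2"
proof -
  obtain \<rho> :: "'k \<Rightarrow> real" and j where "linear \<rho>"
    and nrm: "\<And>x. (norm x)\<^sup>2 = (\<rho> x)\<^sup>2 + (\<rho> (j * x))\<^sup>2"
    using real_or_complex_coordinates by metis
  then interpret linear \<rho> by simp
  show ?thesis
    by (simp add: nrm distrib_left right_diff_distrib add diff power2_sum power2_diff)
qed

instance real_or_complex \<subseteq> banach
proof
  fix X :: "nat \<Rightarrow> 'a"
  assume X: "Cauchy X"
  obtain \<rho> :: "'a \<Rightarrow> real" and j where lin: "linear \<rho>"
    and rep: "\<And>x. x = \<rho> x *\<^sub>R 1 - \<rho> (j * x) *\<^sub>R j"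
    and nrm: "\<And>x. (norm x)\<^sup>2 = (\<rho> x)\<^sup>2 + (\<rho> (j * x))\<^sup>2"
    using real_or_complex_coordinates by metis
  interpret linear \<rho> by fact
  have le1: "\<bar>\<rho> x\<bar> \<le> norm x" and le2: "\<bar>\<rho> (j * x)\<bar> \<le> norm x" for x
    by (rule power2_le_imp_le; simp add: nrm)+
  have c1: "convergent (\<lambda>n. \<rho> (X n))"
  proof (rule Cauchy_convergent, rule CauchyI)
    fix e :: real assume "0 < e"
    from CauchyD[OF X this] obtain M where "\<forall>m\<ge>M. \<forall>n\<ge>M. norm (X m - X n) < e"
      by blast
    moreover have "norm (\<rho> (X m) - \<rho> (X n)) \<le> norm (X m - X n)" for m n
      using le1[of "X m - X n"] by (simp add: diff right_diff_distrib)
    ultimately show "\<exists>M. \<forall>m\<ge>M. \<forall>n\<ge>M. norm (\<rho> (X m) - \<rho> (X n)) < e"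
      by (meson le_less_trans)
  qed
  have c2: "convergent (\<lambda>n. \<rho> (j * X n))"
  proof (rule Cauchy_convergent, rule CauchyI)
    fix e :: real assume "0 < e"
    from CauchyD[OF X this] obtain M where "\<forall>m\<ge>M. \<forall>n\<ge>M. norm (X m - X n) < e"
      by blast
    moreover have "norm (\<rho> (j * X m) - \<rho> (j * X n)) \<le> norm (X m - X n)" for m n
      using le2[of "X m - X n"] by (simp add: diff right_diff_distrib)
    ultimately show "\<exists>M. \<forall>m\<ge>M. \<forall>n\<ge>M. norm (\<rho> (j * X m) - \<rho> (j * X n)) < e"
      by (meson le_less_trans)
  qed
  from c1 c2 obtain a b where "(\<lambda>n. \<rho> (X n)) \<longlonglongrightarrow> a" "(\<lambda>n. \<rho> (j * X n)) \<longlonglongrightarrow> b"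
    by (auto simp: convergent_def)
  then have "(\<lambda>n. \<rho> (X n) *\<^sub>R 1 - \<rho> (j * X n) *\<^sub>R j) \<longlonglongrightarrow> a *\<^sub>R 1 - b *\<^sub>R j"
    by (intro tendsto_intros)
  then show "convergent X"
    unfolding convergent_def rep[symmetric] by blast
qed

section \<open>Functionals on subspaces of c0\<close>

text \<open>One step of the Hahn--Banach theorem.  A dominated functional on a subspace is represented by the
set \<open>S\<close> of pairs (point, value), so that it can be extended without checking that the new direction
is independent of the old ones.\<close>

lemma dominated_extension_value:
  fixes sc :: "real \<Rightarrow> 'v::ab_group_add \<Rightarrow> 'v" and p :: "'v \<Rightarrow> real" and S :: "('v \<times> real) set"
  assumes "vector_space sc"
    and W: "module.subspace sc W"
    and p_add: "\<And>x y. x \<in> W \<Longrightarrow> y \<in> W \<Longrightarrow> p (x + y) \<le> p x + p y"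
    and p_scale: "\<And>x r. x \<in> W \<Longrightarrow> 0 < r \<Longrightarrow> p (sc r x) = r * p x"
    and S_add: "\<And>x r y q. (x, r) \<in> S \<Longrightarrow> (y, q) \<in> S \<Longrightarrow> (x + y, r + q) \<in> S"
    and S_scale: "\<And>x r t. (x, r) \<in> S \<Longrightarrow> (sc t x, t * r) \<in> S"
    and S_ne: "S \<noteq> {}"
    and S_dom: "\<And>x r. (x, r) \<in> S \<Longrightarrow> x \<in> W \<and> r \<le> p x"
    and e: "e \<in> W"
  shows "\<exists>c. \<forall>x r t. (x, r) \<in> S \<longrightarrow> r + t * c \<le> p (x + sc t e)"
proof -
  interpret vector_space sc by fact
  define L where "L = (\<lambda>(x, r). r - p (x - e)) ` S"
  define c where "c = Sup L"
  have sep: "r - p (x - e) \<le> p (y + e) - q" if "(x, r) \<in> S" "(y, q) \<in> S" for x r y q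
  proof -
    have "r + q \<le> p ((x - e) + (y + e))"
      using S_dom[OF S_add[OF that]] by (simp add: algebra_simps)
    also have "\<dots> \<le> p (x - e) + p (y + e)"
      using that S_dom W e by (intro p_add subspace_add subspace_diff) auto
    finally show ?thesis by simp
  qed
  have "bdd_above L"
  proof -
    obtain y q where "(y, q) \<in> S"
      using S_ne by fastforce
    then show ?thesis
      using sep unfolding L_def by (intro bdd_aboveI[of _ "p (y + e) - q"]) auto
  qed
  then have lower: "r - p (x - e) \<le> c" if "(x, r) \<in> S" for x r
    unfolding c_def using that by (intro cSup_upper) (auto simp: L_def)
  have upper: "c \<le> p (x + e) - r" if "(x, r) \<in> S" for x r
    unfolding c_def using that S_ne sep by (intro cSup_least) (auto simp: L_def)
  show ?thesis
  proof (intro exI[of _ c] allI impI)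
    fix x r and t :: real
    assume xr: "(x, r) \<in> S"
    consider "t = 0" | "t > 0" | "t < 0"
      by linarith
    then show "r + t * c \<le> p (x + sc t e)"
    proof cases
      case 1
      then show ?thesis using S_dom[OF xr] by simp
    next
      case 2
      have "t * c \<le> t * (p (sc (1 / t) x + e) - 1 / t * r)"
        using 2 upper[OF S_scale[OF xr, of "1 / t"]] by (intro mult_left_mono) auto
      also have "\<dots> = p (sc t (sc (1 / t) x + e)) - r"
        using 2 S_dom[OF S_scale[OF xr, of "1 / t"]] e W
        by (subst p_scale) (auto simp: right_diff_distrib intro: subspace_add)
      also have "sc t (sc (1 / t) x + e) = x + sc t e"
        using 2 by (simp add: scale_right_distrib)
      finally show ?thesis by simp
    next
      case 3
      have "(- t) * (1 / (- t) * r - p (sc (1 / (- t)) x - e)) \<le> (- t) * c"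
        using 3 lower[OF S_scale[OF xr, of "1 / (- t)"]] by (intro mult_left_mono) auto
      moreover have "(- t) * (1 / (- t) * r - p (sc (1 / (- t)) x - e))
          = r - p (sc (- t) (sc (1 / (- t)) x - e))"
        using 3 S_dom[OF S_scale[OF xr, of "1 / (- t)"]] e W
        by (subst p_scale) (auto simp: right_diff_distrib intro!: subspace_diff)
      moreover have "sc (- t) (sc (1 / (- t)) x - e) = x + sc t e"
        using 3 by (simp add: scale_right_diff_distrib)
      ultimately show ?thesis by simp
    qed
  qed
qed

text \<open>Countably many Hahn--Banach steps.  Only the values \<open>c i\<close> at the new directions are recorded: they
determine the extension, and domination is all that later estimates use.\<close>

lemma dominated_extension_sequence:
  fixes sc :: "real \<Rightarrow> 'v::ab_group_add \<Rightarrow> 'v" and p :: "'v \<Rightarrow> real"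
    and e :: "nat \<Rightarrow> 'v"
  assumes "vector_space sc"
    and W: "module.subspace sc W"
    and p_add: "\<And>x y. x \<in> W \<Longrightarrow> y \<in> W \<Longrightarrow> p (x + y) \<le> p x + p y"
    and p_scale: "\<And>x r. x \<in> W \<Longrightarrow> 0 < r \<Longrightarrow> p (sc r x) = r * p x"
    and H: "module.subspace sc H"
    and u_add: "\<And>x y. x \<in> H \<Longrightarrow> y \<in> H \<Longrightarrow> u (x + y) = u x + u y"
    and u_scale: "\<And>x r. x \<in> H \<Longrightarrow> u (sc r x) = r * u x"
    and u_dom: "\<And>x. x \<in> H \<Longrightarrow> x \<in> W \<and> u x \<le> p x"
    and e: "\<And>n. e n \<in> W"
  obtains c :: "nat \<Rightarrow> real" where
    "\<And>n h t. h \<in> H \<Longrightarrow> u h + (\<Sum>i<n. t i * c i) \<le> p (h + (\<Sum>i<n. sc (t i) (e i)))"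
proof -
  interpret vector_space sc by fact
  define good where "good S \<longleftrightarrow>
      (\<forall>x r y q. (x, r) \<in> S \<longrightarrow> (y, q) \<in> S \<longrightarrow> (x + y, r + q) \<in> S) \<and>
      (\<forall>x r t. (x, r) \<in> S \<longrightarrow> (sc t x, t * r) \<in> S) \<and> S \<noteq> {} \<and>
      (\<forall>x r. (x, r) \<in> S \<longrightarrow> x \<in> W \<and> r \<le> p x)" for S :: "('v \<times> real) set"
  define pick where "pick S v = (SOME c. \<forall>x r t. (x, r) \<in> S \<longrightarrow> r + t * c \<le> p (x + sc t v))" for S v
  have pick: "r + t * pick S v \<le> p (x + sc t v)" if "good S" "v \<in> W" "(x, r) \<in> S" for S v x r t
  proof -
    have "\<exists>c. \<forall>x r t. (x, r) \<in> S \<longrightarrow> r + t * c \<le> p (x + sc t v)"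
      using that(1,2) unfolding good_def
      by (intro dominated_extension_value[OF assms(1) W p_add p_scale]) blast+
    from someI_ex[OF this] that(3) show ?thesis
      unfolding pick_def by blast
  qed
  define ext where "ext v S = {(x + sc t v, r + t * pick S v) | x r t. (x, r) \<in> S}" for v S
  have good_ext: "good (ext v S)" if S: "good S" and v: "v \<in> W" for S v
  proof -
    have "(x + y, r + q) \<in> ext v S" if xr: "(x, r) \<in> ext v S" and yq: "(y, q) \<in> ext v S" for x r y q
    proof -
      obtain x' r' t where 1: "x = x' + sc t v" "r = r' + t * pick S v" "(x', r') \<in> S"
        using xr by (auto simp: ext_def)
      obtain y' q' t' where 2: "y = y' + sc t' v" "q = q' + t' * pick S v" "(y', q') \<in> S"
        using yq by (auto simp: ext_def)
      have "(x' + y', r' + q') \<in> S"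
        using S 1(3) 2(3) unfolding good_def by blast
      moreover have "x + y = (x' + y') + sc (t + t') v" "r + q = (r' + q') + (t + t') * pick S v"
        by (simp_all add: 1 2 algebra_simps scale_left_distrib)
      ultimately show ?thesis unfolding ext_def by blast
    qed
    moreover have "(sc t x, t * r) \<in> ext v S" if xr: "(x, r) \<in> ext v S" for x r t
    proof -
      obtain x' r' t' where 1: "x = x' + sc t' v" "r = r' + t' * pick S v" "(x', r') \<in> S"
        using xr by (auto simp: ext_def)
      have "(sc t x', t * r') \<in> S"
        using S 1(3) unfolding good_def by blast
      moreover have "sc t x = sc t x' + sc (t * t') v" "t * r = t * r' + (t * t') * pick S v"
        by (simp_all add: 1 algebra_simps scale_right_distrib)
      ultimately show ?thesis unfolding ext_def by blast
    qed
    moreover have "ext v S \<noteq> {}"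
      using S unfolding good_def ext_def by fastforce
    moreover have "x \<in> W \<and> r \<le> p x" if "(x, r) \<in> ext v S" for x r
      using that pick[OF S v] S v W unfolding ext_def good_def
      by (auto intro!: subspace_add subspace_scale)
    ultimately show ?thesis
      unfolding good_def by blast
  qed
  define S where "S = rec_nat ((\<lambda>h. (h, u h)) ` H) (\<lambda>n. ext (e n))"
  have S0: "S 0 = (\<lambda>h. (h, u h)) ` H" and S_Suc: "S (Suc n) = ext (e n) (S n)" for n
    by (simp_all add: S_def)
  have good_S: "good (S n)" for n
  proof (induction n)
    case 0
    have "H \<noteq> {}"
      using H subspace_0 by blast
    then show ?case
      using u_dom H subspace_add[OF H] subspace_scale[OF H]
      by (auto simp: S0 good_def image_iff u_add u_scale)
  next
    case (Suc n)
    then show ?case using good_ext e by (simp add: S_Suc)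
  qed
  define c where "c n = pick (S n) (e n)" for n
  have "(h + (\<Sum>i<n. sc (t i) (e i)), u h + (\<Sum>i<n. t i * c i)) \<in> S n" if "h \<in> H" for h t n
  proof (induction n)
    case 0
    then show ?case using that by (simp add: S0)
  next
    case (Suc n)
    then show ?case
      unfolding S_Suc ext_def sum.lessThan_Suc c_def add.assoc[symmetric] by blast
  qed
  then show ?thesis
    using good_S that unfolding good_def by blast
qed

lemma sum_function_apply: "(\<Sum>i\<in>I. F i) n = (\<Sum>i\<in>I. F i n)"
  by (induction I rule: infinite_finite_induct) simp_all

lemma c0_bdd_above:
  assumes "x \<in> c0" shows "bdd_above (range (\<lambda>n. norm (x n)))"
proof -
  have "convergent x"
    using assms by (auto simp: c0_def convergent_def)
  then have "Bseq x"
    by (rule convergent_imp_Bseq)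
  then show ?thesis
    by (auto simp: Bseq_def bdd_above_def)
qed

lemma norm_le_c0_norm: "x \<in> c0 \<Longrightarrow> norm (x n) \<le> c0_norm x"
  unfolding c0_norm_def by (intro cSUP_upper c0_bdd_above) simp_all

lemma c0_norm_le: "(\<And>n. norm (x n) \<le> b) \<Longrightarrow> c0_norm x \<le> b"
  unfolding c0_norm_def by (intro cSUP_least) simp_all

lemma c0_norm_nonneg: "x \<in> c0 \<Longrightarrow> 0 \<le> c0_norm x"
  using norm_le_c0_norm[of x 0] norm_ge_zero order_trans by blast

lemma c0_norm_triangle: "x \<in> c0 \<Longrightarrow> y \<in> c0 \<Longrightarrow> c0_norm (x + y) \<le> c0_norm x + c0_norm y"
  by (intro c0_norm_le) (auto intro: norm_triangle_le add_mono norm_le_c0_norm)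

lemma vector_space_mult: "vector_space ((*) :: 'k::field \<Rightarrow> 'k \<Rightarrow> 'k)"
  by (unfold_locales; simp add: algebra_simps)

lemma vector_space_scale_fun:
  "vector_space (scale_fun :: 'k::real_normed_field \<Rightarrow> ('i \<Rightarrow> 'k) \<Rightarrow> 'i \<Rightarrow> 'k)"
  by (intro vector_space_pointwise_scale vector_space_mult)

lemma subspace_c0: "module.subspace scale_fun (c0 :: (nat \<Rightarrow> 'k::real_normed_field) set)"
proof -
  interpret vector_space "scale_fun :: 'k \<Rightarrow> (nat \<Rightarrow> 'k) \<Rightarrow> nat \<Rightarrow> 'k"
    by (rule vector_space_scale_fun)
  show ?thesis
    by (rule subspaceI)
      (auto simp: c0_def pointwise_scale_def zero_fun_def plus_fun_def
        intro!: tendsto_add_zero tendsto_mult_right_zero)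
qed

lemma c0_norm_scale:
  fixes x :: "nat \<Rightarrow> 'k::real_normed_field"
  assumes x: "x \<in> c0"
  shows "c0_norm (scale_fun c x) = norm c * c0_norm x"
proof (cases "c = 0")
  case True
  then have "scale_fun c x = (\<lambda>n. 0)"
    by (simp add: pointwise_scale_def)
  then show ?thesis
    using True by (simp add: c0_norm_def)
next
  case False
  interpret vector_space "scale_fun :: 'k \<Rightarrow> (nat \<Rightarrow> 'k) \<Rightarrow> nat \<Rightarrow> 'k"
    by (rule vector_space_scale_fun)
  show ?thesis
  proof (rule antisym)
    show "c0_norm (scale_fun c x) \<le> norm c * c0_norm x"
      by (intro c0_norm_le) (simp add: pointwise_scale_def norm_mult mult_left_mono norm_le_c0_norm[OF x])
    have "c0_norm x \<le> c0_norm (scale_fun c x) / norm c"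
    proof (rule c0_norm_le)
      show "norm (x n) \<le> c0_norm (scale_fun c x) / norm c" for n
        using norm_le_c0_norm[OF subspace_scale[OF subspace_c0 x], of c n] False
        by (simp add: pointwise_scale_def norm_mult pos_le_divide_eq mult.commute)
    qed
    then show "norm c * c0_norm x \<le> c0_norm (scale_fun c x)"
      using False by (simp add: pos_le_divide_eq mult.commute)
  qed
qed

lemma sum_lessThan_double:
  fixes g :: "nat \<Rightarrow> 'a::comm_monoid_add"
  shows "(\<Sum>i<2 * N. g i) = (\<Sum>n<N. g (2 * n) + g (2 * n + 1))"
  by (induction N) (simp_all add: add.assoc)

text \<open>The real part of \<open>f\<close> is extended to the unit vectors and their multiples by \<open>j\<close>, and \<open>x n\<close> is the
value at the \<open>n\<close>-th unit vector of the complexified extension.  Since a sequence in \<open>c0\<close> is the limit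
of its truncations, domination by the norm forces the coordinatewise pairing with \<open>x\<close> to agree with
\<open>f\<close>.  The factor 2 is the price of bounding real and imaginary parts separately.\<close>

lemma c0_functional_represented_in_l1:
  fixes H :: "(nat \<Rightarrow> 'k::real_or_complex) set"
  assumes H: "module.subspace scale_fun H" "H \<subseteq> c0"
    and lin: "linear_map_on scale_fun (*) H f"
    and bound: "\<And>h. h \<in> H \<Longrightarrow> norm (f h) \<le> C * c0_norm h" and C: "0 \<le> C"
  obtains x where "x \<in> l1" "l1_norm x \<le> 2 * C" "\<And>h. h \<in> H \<Longrightarrow> (\<lambda>n. x n * h n) sums f h"
proof -
  obtain \<rho> :: "'k \<Rightarrow> real" and j :: 'k where "linear \<rho>"
    and rep: "\<And>x. x = \<rho> x *\<^sub>R 1 - \<rho> (j * x) *\<^sub>R j"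
    and nrm: "\<And>x. (norm x)\<^sup>2 = (\<rho> x)\<^sup>2 + (\<rho> (j * x))\<^sup>2" and j: "norm j \<le> 1"
    using real_or_complex_coordinates by blast
  interpret \<rho>: linear \<rho> by fact
  have \<rho>_le: "\<bar>\<rho> x\<bar> \<le> norm x" for x
    by (rule power2_le_imp_le; simp add: nrm)
  have norm_le: "norm x \<le> \<bar>\<rho> x\<bar> + \<bar>\<rho> (j * x)\<bar>" for x
    by (rule power2_le_imp_le; simp add: nrm power2_sum)
  interpret K: vector_space "scale_fun :: 'k \<Rightarrow> (nat \<Rightarrow> 'k) \<Rightarrow> nat \<Rightarrow> 'k"
    by (rule vector_space_scale_fun)
  have vsR: "vector_space (pointwise_scale scaleR :: real \<Rightarrow> (nat \<Rightarrow> 'k) \<Rightarrow> nat \<Rightarrow> 'k)"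
    by (intro vector_space_pointwise_scale real_vector.vector_space_axioms)
  interpret R: vector_space "pointwise_scale scaleR :: real \<Rightarrow> (nat \<Rightarrow> 'k) \<Rightarrow> nat \<Rightarrow> 'k"
    by (rule vsR)
  have scaleR_eq: "pointwise_scale scaleR r x = scale_fun (of_real r) x" for r and x :: "nat \<Rightarrow> 'k"
    by (simp add: pointwise_scale_def scaleR_conv_of_real)
  have f_add: "f (x + y) = f x + f y" if "x \<in> H" "y \<in> H" for x y
    using lin that by (simp add: linear_map_on_def)
  have f_scale: "f (scale_fun c x) = c * f x" if "x \<in> H" for c x
    using lin that by (simp add: linear_map_on_def)
  define e :: "nat \<Rightarrow> nat \<Rightarrow> 'k" where
    "e i = (\<lambda>n. if n = i div 2 then if even i then 1 else j else 0)" for i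
  have e_c0: "e i \<in> c0" for i
  proof -
    have "\<forall>\<^sub>F n in sequentially. e i n = 0"
      using eventually_gt_at_top[of "i div 2"] by eventually_elim (simp add: e_def)
    then show ?thesis
      by (simp add: c0_def tendsto_eventually)
  qed
  have span_e: "(\<Sum>i<2 * N. pointwise_scale scaleR (t i) (e i)) n
      = (if n < N then t (2 * n) *\<^sub>R 1 + t (2 * n + 1) *\<^sub>R j else 0)" for N n and t :: "nat \<Rightarrow> real"
  proof -
    have "(\<Sum>i<2 * N. pointwise_scale scaleR (t i) (e i)) n
        = (\<Sum>m<N. if m = n then t (2 * m) *\<^sub>R 1 + t (2 * m + 1) *\<^sub>R j else 0)"
      unfolding sum_function_apply sum_lessThan_double
      by (intro sum.cong) (auto simp: pointwise_scale_def e_def)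
    then show ?thesis by simp
  qed
  obtain c where c: "\<And>n h t. h \<in> H \<Longrightarrow> \<rho> (f h) + (\<Sum>i<n. t i * c i)
      \<le> C * c0_norm (h + (\<Sum>i<n. pointwise_scale scaleR (t i) (e i)))"
  proof (rule dominated_extension_sequence[OF vsR, of c0 "\<lambda>x. C * c0_norm x" H "\<lambda>h. \<rho> (f h)" e])
    have "R.subspace G" if "K.subspace G" for G
      using that
      by (intro R.subspaceI) (auto simp: scaleR_eq K.subspace_0 K.subspace_add K.subspace_scale)
    then show "R.subspace c0" "R.subspace H"
      using subspace_c0 H(1) by blast+
    show "C * c0_norm (x + y) \<le> C * c0_norm x + C * c0_norm y" if "x \<in> c0" "y \<in> c0" for x y
      using c0_norm_triangle[OF that] C by (simp add: distrib_left[symmetric] mult_left_mono)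
    show "C * c0_norm (pointwise_scale scaleR r x) = r * (C * c0_norm x)"
      if "x \<in> c0" "0 < r" for x :: "nat \<Rightarrow> 'k" and r
      using that(2) by (simp add: scaleR_eq c0_norm_scale[OF that(1)])
    show "\<rho> (f (x + y)) = \<rho> (f x) + \<rho> (f y)" if "x \<in> H" "y \<in> H" for x y
      by (simp add: f_add[OF that] \<rho>.add)
    show "\<rho> (f (pointwise_scale scaleR r x)) = r * \<rho> (f x)" if "x \<in> H" for x r
      using \<rho>.scale[of r "f x"] by (simp add: scaleR_eq f_scale[OF that] scaleR_conv_of_real)
    show "x \<in> c0 \<and> \<rho> (f x) \<le> C * c0_norm x" if "x \<in> H" for x
      using that H \<rho>_le[of "f x"] bound[OF that] by auto
  qed (use e_c0 in blast)+
  define x where "x n = c (2 * n) *\<^sub>R 1 - c (2 * n + 1) *\<^sub>R j" for n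
  have \<rho>_x: "\<rho> (x n * z) = c (2 * n) * \<rho> z - c (2 * n + 1) * \<rho> (j * z)" for n z
  proof -
    have "x n * z = c (2 * n) *\<^sub>R z - c (2 * n + 1) *\<^sub>R (j * z)"
      by (simp add: x_def left_diff_distrib)
    then show ?thesis by (simp add: \<rho>.diff \<rho>.scale)
  qed
  have H0: "0 \<in> H" "f 0 = 0"
    using K.subspace_0[OF H(1)] f_scale[of 0 0] by simp_all
  have partial: "(\<Sum>n<N. norm (x n)) \<le> 2 * C" for N
  proof -
    have "(\<Sum>n<N. norm (x n)) \<le> (\<Sum>n<N. \<bar>c (2 * n)\<bar> + \<bar>c (2 * n + 1)\<bar>)"
    proof (rule sum_mono)
      fix n
      have "norm (x n) \<le> norm (c (2 * n) *\<^sub>R (1::'k)) + norm (c (2 * n + 1) *\<^sub>R j)"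
        unfolding x_def by (rule norm_triangle_ineq4)
      also have "\<dots> \<le> \<bar>c (2 * n)\<bar> + \<bar>c (2 * n + 1)\<bar>"
        using j by (simp add: mult_left_le)
      finally show "norm (x n) \<le> \<bar>c (2 * n)\<bar> + \<bar>c (2 * n + 1)\<bar>" .
    qed
    also have "\<dots> = (\<Sum>i<2 * N. sgn (c i) * c i)"
      unfolding sum_lessThan_double by (simp add: abs_sgn mult.commute)
    also have "\<dots> \<le> C * c0_norm (0 + (\<Sum>i<2 * N. pointwise_scale scaleR (sgn (c i)) (e i)))"
      using c[OF H0(1), of "\<lambda>i. sgn (c i)" "2 * N"] H0 by (simp add: \<rho>.zero)
    also have "\<dots> \<le> C * 2"
    proof (intro mult_left_mono C c0_norm_le)
      fix n
      have "norm (sgn (c (2 * n)) *\<^sub>R (1::'k) + sgn (c (2 * n + 1)) *\<^sub>R j) \<le> 1 + 1"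
        using j by (intro norm_triangle_mono) (auto simp: abs_sgn_eq)
      then show "norm ((0 + (\<Sum>i<2 * N. pointwise_scale scaleR (sgn (c i)) (e i))) n) \<le> 2"
        by (simp add: span_e)
    qed
    finally show ?thesis by simp
  qed
  have x_summable: "summable (\<lambda>n. norm (x n))"
    using partial by (intro bounded_imp_summable[of _ "2 * C"]) (auto simp: lessThan_Suc_atMost[symmetric] simp del: sum.lessThan_Suc)
  have key: "\<rho> (f h - (\<Sum>n<N. x n * h n)) \<le> C * \<delta>"
    if h: "h \<in> H" and small: "\<And>n. n \<ge> N \<Longrightarrow> norm (h n) \<le> \<delta>" and \<delta>: "0 \<le> \<delta>" for h N \<delta>
  proof -
    \<comment> \<open>These multiples of the directions \<open>e i\<close> cancel the first \<open>N\<close> coordinates of \<open>h\<close>.\<close>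
    define t where "t i = (if even i then - \<rho> (h (i div 2)) else \<rho> (j * h (i div 2)))" for i
    have "(\<Sum>i<2 * N. t i * c i) = - (\<Sum>n<N. \<rho> (x n * h n))"
      unfolding sum_lessThan_double sum_negf[symmetric]
      by (intro sum.cong) (simp_all add: t_def \<rho>_x)
    then have "\<rho> (f h - (\<Sum>n<N. x n * h n)) = \<rho> (f h) + (\<Sum>i<2 * N. t i * c i)"
      by (simp add: \<rho>.diff \<rho>.sum)
    also have "\<dots> \<le> C * c0_norm (h + (\<Sum>i<2 * N. pointwise_scale scaleR (t i) (e i)))"
      using c[OF h] .
    also have "\<dots> \<le> C * \<delta>"
    proof (intro mult_left_mono C c0_norm_le)
      fix n
      have "h n + (t (2 * n) *\<^sub>R 1 + t (2 * n + 1) *\<^sub>R j) = h n - (\<rho> (h n) *\<^sub>R 1 - \<rho> (j * h n) *\<^sub>R j)"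
        by (simp add: t_def)
      also have "\<dots> = 0"
        unfolding rep[symmetric] by simp
      finally show "norm ((h + (\<Sum>i<2 * N. pointwise_scale scaleR (t i) (e i))) n) \<le> \<delta>"
        using small[of n] \<delta> by (auto simp: span_e)
    qed
    finally show ?thesis .
  qed
  have key': "norm (f h - (\<Sum>n<N. x n * h n)) \<le> 2 * C * \<delta>"
    if h: "h \<in> H" and small: "\<And>n. n \<ge> N \<Longrightarrow> norm (h n) \<le> \<delta>" and \<delta>: "0 \<le> \<delta>" for h N \<delta>
  proof -
    define d where "d = f h - (\<Sum>n<N. x n * h n)"
    have mult: "\<rho> (a * d) \<le> C * \<delta>" if a: "norm a \<le> 1" for a
    proof -
      have "norm (scale_fun a h n) \<le> \<delta>" if "n \<ge> N" for n
        using small[OF that] a mult_mono[of "norm a" 1 "norm (h n)" \<delta>] \<delta>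
        by (simp add: pointwise_scale_def norm_mult)
      then have "\<rho> (f (scale_fun a h) - (\<Sum>n<N. x n * scale_fun a h n)) \<le> C * \<delta>"
        by (intro key K.subspace_scale H h \<delta>)
      then show ?thesis
        unfolding f_scale[OF h]
        by (simp add: d_def pointwise_scale_def right_diff_distrib sum_distrib_left mult.left_commute)
    qed
    have "\<bar>\<rho> (a * d)\<bar> \<le> C * \<delta>" if "norm a \<le> 1" for a
      using mult[OF that] mult[of "- a"] that by (simp add: \<rho>.neg)
    from this[of 1] this[OF j] show ?thesis
      using norm_le[of d] by (simp add: d_def)
  qed
  have sums: "(\<lambda>n. x n * h n) sums f h" if h: "h \<in> H" for h
    unfolding sums_def
  proof (rule LIMSEQ_I)
    fix r :: real assume r: "0 < r"
    define \<delta> where "\<delta> = r / (2 * C + 1)"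
    have \<delta>: "0 < \<delta>" "2 * C * \<delta> < r"
      using r C by (auto simp: \<delta>_def field_simps)
    have "h \<longlonglongrightarrow> 0"
      using h H by (auto simp: c0_def)
    from LIMSEQ_D[OF this \<delta>(1)] obtain N where N: "\<And>n. n \<ge> N \<Longrightarrow> norm (h n) \<le> \<delta>"
      by (auto intro: less_imp_le)
    have "norm ((\<Sum>n<M. x n * h n) - f h) < r" if "M \<ge> N" for M
      using key'[OF h, of M \<delta>] N that \<delta> by (subst norm_minus_commute) fastforce
    then show "\<exists>N. \<forall>M\<ge>N. norm ((\<Sum>n<M. x n * h n) - f h) < r"
      by blast
  qed
  show ?thesis
  proof (rule that)
    show "x \<in> l1"
      using x_summable by (simp add: l1_def l1_sum_def)
    show "l1_norm x \<le> 2 * C"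
      unfolding l1_norm_def l1_sum_norm_def using partial by (intro suminf_le_const x_summable)
  qed (rule sums)
qed

section \<open>Finite-dimensional normed spaces\<close>

text \<open>Completeness of a subset with respect to a norm defined on a larger space; this form suits the
induction over spanning sets below.\<close>

definition complete_on :: "('v::ab_group_add \<Rightarrow> real) \<Rightarrow> 'v set \<Rightarrow> bool" where
  "complete_on N W \<longleftrightarrow>
     (\<forall>X :: nat \<Rightarrow> 'v. (\<forall>n. X n \<in> W) \<longrightarrow> (\<forall>e>0. \<exists>M. \<forall>m\<ge>M. \<forall>n\<ge>M. N (X m - X n) < e) \<longrightarrow>
        (\<exists>l\<in>W. (\<lambda>n. N (X n - l)) \<longlonglongrightarrow> 0))"

context normed_space_on
begin

lemma norm_on_0: "N 0 = 0"
  using norm_on_scale[OF subspace_0[OF subspace_carrier], of 0] by simp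

lemma norm_on_minus: "x \<in> V \<Longrightarrow> N (- x) = N x"
  using norm_on_scale[of x "- 1"] by simp

lemma norm_on_triangle_diff: "x \<in> V \<Longrightarrow> y \<in> V \<Longrightarrow> N (x - y) \<le> N x + N y"
  using norm_on_triangle[of x "- y"] norm_on_minus[of y] subspace_neg[OF subspace_carrier] by simp

lemma mcomplete_if_complete_on:
  assumes "complete_on N V"
  shows "Metric_space.mcomplete V (norm_dist V N)"
proof -
  interpret M: Metric_space V "norm_dist V N"
    by (rule Metric_space_norm_dist)
  show ?thesis
    unfolding M.mcomplete_def
  proof (intro allI impI)
    fix X assume X: "M.MCauchy X"
    then have in_V: "X n \<in> V" for n
      by (auto simp: M.MCauchy_def)
    have cauchy: "\<forall>e>0. \<exists>K. \<forall>m\<ge>K. \<forall>n\<ge>K. N (X m - X n) < e"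
      using X in_V unfolding M.MCauchy_def norm_dist_def by simp
    obtain l where l: "l \<in> V" "(\<lambda>n. N (X n - l)) \<longlonglongrightarrow> 0"
      using assms in_V cauchy unfolding complete_on_def by metis
    have "\<exists>K. \<forall>n\<ge>K. X n \<in> V \<and> norm_dist V N (X n) l < e" if "e > 0" for e
    proof -
      have "\<forall>\<^sub>F n in sequentially. N (X n - l) < e"
        using order_tendstoD(2)[OF l(2) that] .
      then show ?thesis
        using in_V l(1) by (auto simp: eventually_sequentially norm_dist_def)
    qed
    then show "\<exists>l. limitin M.mtopology X l sequentially"
      using l(1) by (auto simp: M.limit_metric_sequentially)
  qed
qed

lemma op_norm_bdd_above:
  assumes "bounded_map_on V N M T"
  shows "bdd_above ((\<lambda>x. M (T x)) ` {x \<in> V. N x \<le> 1})"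
proof -
  obtain C where C: "\<And>x. x \<in> V \<Longrightarrow> M (T x) \<le> C * N x"
    using assms by (auto simp: bounded_map_on_def)
  show ?thesis
  proof (rule bdd_aboveI2)
    fix x assume x: "x \<in> {x \<in> V. N x \<le> 1}"
    have "M (T x) \<le> C * N x" using C x by blast
    also have "\<dots> \<le> \<bar>C\<bar> * N x"
      using x norm_on_nonneg[of x] by (intro mult_right_mono) auto
    also have "\<dots> \<le> \<bar>C\<bar> * 1"
      using x by (intro mult_left_mono) auto
    finally show "M (T x) \<le> \<bar>C\<bar>" by simp
  qed
qed

text \<open>A complete subspace is closed, so a vector outside it has positive distance from it.\<close>

lemma complete_on_gap:
  assumes W: "subspace W" "W \<subseteq> V" "complete_on N W" and b: "b \<in> V" "b \<notin> W"
  obtains \<delta> where "0 < \<delta>" "\<And>y c. y \<in> W \<Longrightarrow> norm c * \<delta> \<le> N (y + s c b)"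
proof -
  note V [simp, intro] = subspace_add[OF subspace_carrier] subspace_diff[OF subspace_carrier]
    subspace_neg[OF subspace_carrier] subspace_scale[OF subspace_carrier]
  have "\<exists>\<delta>>0. \<forall>y\<in>W. \<delta> \<le> N (y + b)"
  proof (rule ccontr)
    assume "\<not> ?thesis"
    then have "\<exists>y\<in>W. N (y + b) < inverse (real (Suc n))" for n
      by (meson inverse_positive_iff_positive not_le of_nat_0_less_iff zero_less_Suc)
    then obtain Y where Y: "\<And>n. Y n \<in> W" "\<And>n. N (Y n + b) < inverse (real (Suc n))"
      by metis
    have YV: "Y n \<in> V" for n
      using Y W by blast
    have lim: "(\<lambda>n. N (Y n + b)) \<longlonglongrightarrow> 0"
      by (rule tendsto_sandwich[OF _ _ tendsto_const LIMSEQ_inverse_real_of_nat])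
        (use Y(2) YV b in \<open>auto intro!: always_eventually norm_on_nonneg simp del: of_nat_Suc dest: less_imp_le\<close>)
    have "\<exists>M. \<forall>m\<ge>M. \<forall>n\<ge>M. N (Y m - Y n) < e" if "e > 0" for e
    proof -
      have "\<forall>\<^sub>F n in sequentially. N (Y n + b) < e / 2"
        using order_tendstoD(2)[OF lim, of "e / 2"] that by simp
      then obtain M where M: "\<And>n. n \<ge> M \<Longrightarrow> N (Y n + b) < e / 2"
        by (auto simp: eventually_sequentially)
      have "N (Y m - Y n) < e" if "m \<ge> M" "n \<ge> M" for m n
        using norm_on_triangle_diff[of "Y m + b" "Y n + b"] M[OF that(1)] M[OF that(2)] YV b by simp
      then show ?thesis by blast
    qed
    then obtain l where l: "l \<in> W" "(\<lambda>n. N (Y n - l)) \<longlonglongrightarrow> 0"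
      using W(3) Y(1) unfolding complete_on_def by blast
    have lV: "l \<in> V"
      using l W by blast
    have "(\<lambda>n. N (Y n + b) + N (Y n - l)) \<longlonglongrightarrow> 0 + 0"
      by (intro tendsto_add lim l)
    moreover have "N (l + b) \<le> N (Y n + b) + N (Y n - l)" for n
      using norm_on_triangle_diff[of "Y n + b" "Y n - l"] YV[of n] lV b by (simp add: add.commute)
    ultimately have "N (l + b) \<le> 0"
      by (intro LIMSEQ_le_const) auto
    then have "l + b = 0"
      using norm_on_nonneg[of "l + b"] norm_on_eq_0D[of "l + b"] lV b by fastforce
    then have "b = - l"
      by (simp add: eq_neg_iff_add_eq_0 add.commute)
    then show False
      using b l subspace_neg[OF W(1)] by blast
  qed
  then obtain \<delta> where \<delta>: "\<delta> > 0" "\<And>y. y \<in> W \<Longrightarrow> \<delta> \<le> N (y + b)"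
    by blast
  show ?thesis
  proof (rule that[OF \<delta>(1)])
    fix y c assume y: "y \<in> W"
    show "norm c * \<delta> \<le> N (y + s c b)"
    proof (cases "c = 0")
      case True
      then show ?thesis using y W norm_on_nonneg by auto
    next
      case False
      have "norm c * \<delta> \<le> norm c * N (s (inverse c) y + b)"
        using \<delta>(2)[of "s (inverse c) y"] subspace_scale[OF W(1) y] by (simp add: mult_left_mono)
      also have "\<dots> = N (s c (s (inverse c) y + b))"
        using y W b by (subst norm_on_scale) auto
      also have "s c (s (inverse c) y + b) = y + s c b"
        using False by (simp add: scale_right_distrib)
      finally show ?thesis .
    qed
  qed
qed

end

text \<open>Adding one vector \<open>b\<close> outside the span: by \<open>complete_on_gap\<close> the coefficient of \<open>b\<close> depends
continuously on the vector, so a Cauchy sequence splits into Cauchy sequences of coefficients and of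
vectors in the smaller span.\<close>

lemma complete_on_span_finite:
  fixes s :: "'k::{real_normed_field, banach} \<Rightarrow> 'v::ab_group_add \<Rightarrow> 'v"
  assumes "normed_space_on s V N" and "finite B" "B \<subseteq> V"
  shows "complete_on N (module.span s B)"
  using assms(2,3)
proof (induction B)
  interpret normed_space_on s V N by fact
  case empty
  have "(\<lambda>n. N (X n - 0)) \<longlonglongrightarrow> 0" if "\<forall>n. X n \<in> {0}" for X :: "nat \<Rightarrow> 'v"
    using that by (simp add: norm_on_0)
  then show ?case
    by (simp add: complete_on_def)
next
  interpret normed_space_on s V N by fact
  note V [simp, intro] = subspace_add[OF subspace_carrier] subspace_diff[OF subspace_carrier]
    subspace_neg[OF subspace_carrier] subspace_scale[OF subspace_carrier]
  case (insert b B)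
  then have b: "b \<in> V" and BV: "span B \<subseteq> V" and IH: "complete_on N (span B)"
    using span_minimal[OF _ subspace_carrier] by auto
  show ?case
  proof (cases "b \<in> span B")
    case True
    then show ?thesis using IH by (simp add: span_redundant)
  next
    case False
    obtain \<delta> where \<delta>: "0 < \<delta>" "\<And>y c. y \<in> span B \<Longrightarrow> norm c * \<delta> \<le> N (y + s c b)"
      using complete_on_gap[OF subspace_span BV IH b False] by blast
    show ?thesis
      unfolding complete_on_def
    proof (intro allI impI)
      fix X :: "nat \<Rightarrow> 'v"
      assume X: "\<forall>n. X n \<in> span (insert b B)"
        and cauchy: "\<forall>e>0. \<exists>M. \<forall>m\<ge>M. \<forall>n\<ge>M. N (X m - X n) < e"
      obtain c where c: "\<And>n. X n - s (c n) b \<in> span B"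
        using X unfolding span_insert mem_Collect_eq by metis
      define Y where "Y n = X n - s (c n) b" for n
      have YB: "Y n \<in> span B" and YV: "Y n \<in> V" for n
        using c BV by (auto simp: Y_def)
      have X_eq: "X n = Y n + s (c n) b" for n
        by (simp add: Y_def)
      have diff: "X m - X n = (Y m - Y n) + s (c m - c n) b" for m n
        by (simp add: X_eq scale_left_diff_distrib)
      have c_le: "norm (c m - c n) \<le> N (X m - X n) / \<delta>" for m n
        using \<delta>(2)[OF span_diff[OF YB YB], of "c m - c n" m n] \<delta>(1) by (simp add: diff field_simps)
      have "Cauchy c"
      proof (rule CauchyI)
        fix e :: real assume "0 < e"
        then have "0 < e * \<delta>" using \<delta> by simp
        then obtain M where "\<forall>m\<ge>M. \<forall>n\<ge>M. N (X m - X n) < e * \<delta>"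
          using cauchy by blast
        moreover have "norm (c m - c n) < e" if "N (X m - X n) < e * \<delta>" for m n
          using c_le[of m n] that \<delta>(1) by (metis le_less_trans pos_divide_less_eq)
        ultimately show "\<exists>M. \<forall>m\<ge>M. \<forall>n\<ge>M. norm (c m - c n) < e"
          by blast
      qed
      then obtain c' where c': "c \<longlonglongrightarrow> c'"
        using Cauchy_convergent_iff convergent_def by blast
      have Y_le: "N (Y m - Y n) \<le> (1 + N b / \<delta>) * N (X m - X n)" for m n
      proof -
        have "N (Y m - Y n) \<le> N (X m - X n) + N (s (c m - c n) b)"
          using norm_on_triangle_diff[of "X m - X n" "s (c m - c n) b"] YV b by (simp add: diff)
        also have "\<dots> = N (X m - X n) + norm (c m - c n) * N b"
          using b by (simp add: norm_on_scale)
        also have "\<dots> \<le> N (X m - X n) + N (X m - X n) / \<delta> * N b"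
          using c_le norm_on_nonneg[OF b] by (intro add_left_mono mult_right_mono)
        finally show ?thesis by (simp add: field_simps)
      qed
      have "\<forall>e>0. \<exists>M. \<forall>m\<ge>M. \<forall>n\<ge>M. N (Y m - Y n) < e"
      proof (intro allI impI)
        fix e :: real assume "0 < e"
        define K where "K = 1 + N b / \<delta>"
        have K: "0 < K"
          using \<delta> norm_on_nonneg[OF b] by (simp add: K_def add_pos_nonneg)
        with \<open>0 < e\<close> have "0 < e / K" by simp
        then obtain M where "\<forall>m\<ge>M. \<forall>n\<ge>M. N (X m - X n) < e / K"
          using cauchy by blast
        moreover have "N (Y m - Y n) < e" if "N (X m - X n) < e / K" for m n
          using Y_le[of m n, folded K_def] that K by (simp add: field_simps)
        ultimately show "\<exists>M. \<forall>m\<ge>M. \<forall>n\<ge>M. N (Y m - Y n) < e"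
          by blast
      qed
      then obtain y where y: "y \<in> span B" "(\<lambda>n. N (Y n - y)) \<longlonglongrightarrow> 0"
        using IH YB unfolding complete_on_def by blast
      then have yV: "y \<in> V" using BV by blast
      define l where "l = y + s c' b"
      have "l - s c' b \<in> span B"
        using y by (simp add: l_def)
      then have "l \<in> span (insert b B)"
        unfolding span_insert by blast
      moreover have "(\<lambda>n. N (X n - l)) \<longlonglongrightarrow> 0"
      proof (rule tendsto_sandwich[OF _ _ tendsto_const])
        have "(\<lambda>n. norm (c n - c')) \<longlonglongrightarrow> 0"
          using c' by (simp add: LIM_zero tendsto_norm_zero)
        then have "(\<lambda>n. N (Y n - y) + norm (c n - c') * N b) \<longlonglongrightarrow> 0 + 0 * N b"
          by (intro tendsto_intros y)
        then show "(\<lambda>n. N (Y n - y) + norm (c n - c') * N b) \<longlonglongrightarrow> 0" by simp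
        have eq: "X n - l = (Y n - y) + s (c n - c') b" for n
          by (simp add: X_eq l_def scale_left_diff_distrib)
        show "\<forall>\<^sub>F n in sequentially. N (X n - l) \<le> N (Y n - y) + norm (c n - c') * N b"
          using norm_on_triangle[of "Y _ - y" "s (c _ - c') b"] YV yV b
          by (intro always_eventually) (simp add: eq norm_on_scale)
        show "\<forall>\<^sub>F n in sequentially. 0 \<le> N (X n - l)"
          using YV yV b by (intro always_eventually) (simp add: eq norm_on_nonneg)
      qed
      ultimately show "\<exists>l\<in>span (insert b B). (\<lambda>n. N (X n - l)) \<longlonglongrightarrow> 0"
        by blast
    qed
  qed
qed

text \<open>The same induction as for completeness: the coefficient of the last spanning vector is controlled by
\<open>complete_on_gap\<close>.\<close>

lemma linear_map_on_span_finite_bounded: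
  fixes s :: "'k::{real_normed_field, banach} \<Rightarrow> 'v::ab_group_add \<Rightarrow> 'v"
    and t :: "'k \<Rightarrow> 'w::ab_group_add \<Rightarrow> 'w"
  assumes V: "normed_space_on s V N" and W: "normed_space_on t W M"
    and B: "finite B" "B \<subseteq> V"
    and T: "linear_map_on s t (module.span s B) T" "T ` module.span s B \<subseteq> W"
  shows "\<exists>C\<ge>0. \<forall>x\<in>module.span s B. M (T x) \<le> C * N x"
  using B T
proof (induction B)
  interpret V: normed_space_on s V N by fact
  interpret W: normed_space_on t W M by fact
  case empty
  then have "T 0 = 0"
    unfolding linear_map_on_def by (metis V.scale_zero_left V.span_empty W.scale_zero_left singletonI)
  then show ?case
    by (auto simp: W.norm_on_0 V.norm_on_0)
next
  interpret V: normed_space_on s V N by fact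
  interpret W: normed_space_on t W M by fact
  case (insert b B)
  then have b: "b \<in> V" and BV: "V.span B \<subseteq> V" and BB: "B \<subseteq> V"
    using V.span_minimal[OF _ V.subspace_carrier] by auto
  have sub: "V.span B \<subseteq> V.span (insert b B)" and bs: "b \<in> V.span (insert b B)"
    by (auto intro: V.span_mono[THEN subsetD] V.span_base)
  have add: "T (x + y) = T x + T y" if "x \<in> V.span (insert b B)" "y \<in> V.span (insert b B)" for x y
    using insert.prems(2) that by (simp add: linear_map_on_def)
  have scale: "T (s c x) = t c (T x)" if "x \<in> V.span (insert b B)" for c x
    using insert.prems(2) that by (simp add: linear_map_on_def)
  have Tb: "T b \<in> W"
    using insert.prems(3) bs by blast
  have "linear_map_on s t (V.span B) T"
    unfolding linear_map_on_def using add scale sub by (meson subsetD)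
  then obtain C where C: "C \<ge> 0" "\<And>x. x \<in> V.span B \<Longrightarrow> M (T x) \<le> C * N x"
    using insert.IH[OF BB] insert.prems(3) sub by blast
  show ?case
  proof (cases "b \<in> V.span B")
    case True
    then show ?thesis using C by (auto simp: V.span_redundant)
  next
    case False
    obtain \<delta> where \<delta>: "0 < \<delta>" "\<And>y c. y \<in> V.span B \<Longrightarrow> norm c * \<delta> \<le> N (y + s c b)"
      using V.complete_on_gap[OF V.subspace_span BV complete_on_span_finite[OF V insert.hyps(1) BB] b False]
      by blast
    define K where "K = C + (C * N b + M (T b)) / \<delta>"
    have nonneg: "0 \<le> C * N b + M (T b)"
      using C V.norm_on_nonneg[OF b] W.norm_on_nonneg[OF Tb] by simp
    have "M (T x) \<le> K * N x" if x: "x \<in> V.span (insert b B)" for x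
    proof -
      obtain c where c: "x - s c b \<in> V.span B"
        using x unfolding V.span_insert by blast
      define y where "y = x - s c b"
      have y: "y \<in> V.span B" "y \<in> V" and x_eq: "x = y + s c b"
        using c BV by (auto simp: y_def)
      have ys: "y \<in> V.span (insert b B)"
        using y sub by blast
      have xV: "x \<in> V"
        using x_eq y b by (simp add: V.subspace_add[OF V.subspace_carrier] V.subspace_scale[OF V.subspace_carrier])
      have c_le: "norm c \<le> N x / \<delta>"
        using \<delta>(2)[OF y(1), of c] \<delta>(1) by (simp add: x_eq field_simps)
      have "M (T x) = M (T y + t c (T b))"
        using add[OF ys V.span_scale[OF bs]] scale[OF bs] by (simp add: x_eq)
      also have "\<dots> \<le> M (T y) + norm c * M (T b)"
        using W.norm_on_triangle[of "T y" "t c (T b)"] W.norm_on_scale[OF Tb]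
          W.subspace_scale[OF W.subspace_carrier Tb] insert.prems(3) ys by auto
      also have "\<dots> \<le> C * (N x + norm c * N b) + norm c * M (T b)"
      proof -
        have "N y \<le> N x + norm c * N b"
          using V.norm_on_triangle_diff[OF xV V.subspace_scale[OF V.subspace_carrier b], of c]
            V.norm_on_scale[OF b] by (simp add: y_def)
        then show ?thesis
          using C(2)[OF y(1)] mult_left_mono[OF _ C(1)] by fastforce
      qed
      also have "\<dots> = C * N x + norm c * (C * N b + M (T b))"
        by (simp add: algebra_simps)
      also have "\<dots> \<le> C * N x + N x / \<delta> * (C * N b + M (T b))"
        using c_le nonneg by (intro add_left_mono mult_right_mono)
      finally show ?thesis
        by (simp add: K_def algebra_simps add_divide_distrib)
    qed
    moreover have "K \<ge> 0"
      using C nonneg \<delta> by (simp add: K_def)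
    ultimately show ?thesis by blast
  qed
qed

lemma linear_map_on_inv_into:
  assumes "vector_space s" "module.subspace s V" and lin: "linear_map_on s t V T" and bij: "bij_betw T V W"
  shows "linear_map_on t s W (inv_into V T)"
proof -
  interpret vector_space s by fact
  have inj: "inj_on T V"
    using bij by (simp add: bij_betw_def)
  have inv: "inv_into V T y \<in> V" "T (inv_into V T y) = y" if "y \<in> W" for y
    using that bij by (auto simp: bij_betw_inv_into_right bij_betw_def inv_into_into)
  show ?thesis
    unfolding linear_map_on_def
  proof (intro conjI ballI allI)
    fix x c assume x: "x \<in> W"
    show "inv_into V T (x + y) = inv_into V T x + inv_into V T y" if "y \<in> W" for y
      using inv_into_f_f[OF inj, of "inv_into V T x + inv_into V T y"] inv[OF x] inv[OF that] lin
        subspace_add[OF assms(2)] by (simp add: linear_map_on_def)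
    show "inv_into V T (t c x) = s c (inv_into V T x)"
      using inv_into_f_f[OF inj, of "s c (inv_into V T x)"] inv[OF x] lin
        subspace_scale[OF assms(2)] by (simp add: linear_map_on_def)
  qed
qed

text \<open>Guarantees that the infimum in the Banach--Mazur distance of two spaces of equal dimension ranges
over a nonempty set.\<close>

lemma finite_dim_banach_iso_exists:
  fixes s :: "'k::{real_normed_field, banach} \<Rightarrow> 'v::ab_group_add \<Rightarrow> 'v"
    and t :: "'k \<Rightarrow> 'w::ab_group_add \<Rightarrow> 'w"
  assumes V: "finite_dim_banach_on s V N" and W: "finite_dim_banach_on t W M"
    and dim: "vector_space.dim s V = vector_space.dim t W"
  shows "\<exists>T. banach_iso s V N t W M T"
proof -
  interpret V: finite_dim_banach_on s V N by fact
  interpret W: finite_dim_banach_on t W M by fact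
  interpret P: vector_space_pair s t ..
  obtain B where B: "B \<subseteq> V" "V.independent B" "V \<subseteq> V.span B" "card B = V.dim V"
    using V.basis_exists .
  obtain C where C: "C \<subseteq> W" "W.independent C" "W \<subseteq> W.span C" "card C = W.dim W"
    using W.basis_exists .
  have finB: "finite B" and finC: "finite C"
    using V.finite_dim_carrier W.finite_dim_carrier V.independent_span_bound[OF _ B(2)]
      W.independent_span_bound[OF _ C(2)] B(1) C(1) by metis+
  have V_eq: "V = V.span B" and W_eq: "W = W.span C"
    using B C V.span_minimal[OF _ V.subspace_carrier] W.span_minimal[OF _ W.subspace_carrier] by blast+
  have "card B = card C"
    using B C dim by simp
  then obtain g where g: "bij_betw g B C"
    using finite_same_card_bij finB finC by blast
  define T where "T = P.construct B g"
  have lin: "Vector_Spaces.linear s t T"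
    unfolding T_def by (rule P.linear_construct[OF B(2)])
  have TB: "T b = g b" if "b \<in> B" for b
    unfolding T_def by (rule P.construct_basis[OF B(2) that])
  have imB: "T ` B = C"
    using g TB by (auto simp: bij_betw_def image_iff)
  have "inj_on T B"
    using g TB by (metis bij_betw_def inj_on_cong)
  then have inj: "inj_on T V"
    unfolding V_eq using P.linear_inj_on_span_iff_independent_image[OF lin, of B] imB C(2) by simp
  have im: "T ` V = W"
    using P.linear_span_image[OF lin, of B] imB V_eq W_eq by simp
  have bij: "bij_betw T V W"
    using inj im by (simp add: bij_betw_def)
  have lin_on: "linear_map_on s t V T"
    by (simp add: linear_map_on_def P.linear_add[OF lin] P.linear_scale[OF lin])
  have inv: "inv_into V T y \<in> V" "T (inv_into V T y) = y" if "y \<in> W" for y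
    using that im by (auto intro: inv_into_into f_inv_into_f)
  have lin_inv: "linear_map_on t s W (inv_into V T)"
    using linear_map_on_inv_into[OF V.vector_space_axioms V.subspace_carrier lin_on bij] .
  have "bounded_map_on V N M T"
    using linear_map_on_span_finite_bounded[OF V.normed_space_on_axioms W.normed_space_on_axioms finB B(1)]
      lin_on im unfolding bounded_map_on_def V_eq[symmetric] by blast
  moreover have "bounded_map_on W M N (inv_into V T)"
    using linear_map_on_span_finite_bounded[OF W.normed_space_on_axioms V.normed_space_on_axioms finC C(1)]
      lin_inv inv(1) unfolding bounded_map_on_def W_eq[symmetric] by blast
  ultimately show ?thesis
    using lin_on bij unfolding banach_iso_def by blast
qed

lemma le_op_norm:
  fixes s :: "'k::real_normed_field \<Rightarrow> 'v::ab_group_add \<Rightarrow> 'v"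
    and t :: "'k \<Rightarrow> 'w::ab_group_add \<Rightarrow> 'w"
  assumes V: "normed_space_on s V N" and W: "normed_space_on t W M"
    and T: "linear_map_on s t V T" "bounded_map_on V N M T" "T ` V \<subseteq> W" and x: "x \<in> V"
  shows "M (T x) \<le> op_norm V N M T * N x"
proof -
  interpret V: normed_space_on s V N by fact
  interpret W: normed_space_on t W M by fact
  note bdd = V.op_norm_bdd_above[OF T(2)]
  show ?thesis
  proof (cases "N x = 0")
    case True
    then have "T x = 0"
      using V.norm_on_eq_0D[OF x] V.subspace_0[OF V.subspace_carrier] T(1)
      by (metis W.scale_zero_left V.scale_zero_left linear_map_on_def)
    then show ?thesis using True W.norm_on_0 by simp
  next
    case False
    then have pos: "N x > 0"
      using V.norm_on_nonneg[OF x] by simp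
    define c :: 'k where "c = of_real (inverse (N x))"
    have "norm c = inverse (N x)"
      using pos by (simp add: c_def norm_inverse)
    moreover have "s c x \<in> V" using x V.subspace_scale[OF V.subspace_carrier] by blast
    ultimately have "M (T (s c x)) \<le> op_norm V N M T"
      using pos x unfolding op_norm_def by (intro cSUP_upper bdd) (simp add: V.norm_on_scale)
    moreover have "M (T (s c x)) = M (T x) / N x"
      using T x W.norm_on_scale[of "T x" c] \<open>norm c = _\<close>
      by (auto simp: linear_map_on_def divide_inverse mult.commute)
    ultimately show ?thesis
      using pos by (simp add: field_simps)
  qed
qed

lemma op_norm_nonneg:
  assumes "normed_space_on s V N" "normed_space_on t W M" "linear_map_on s t V T"
    "bounded_map_on V N M T" "T ` V \<subseteq> W"
  shows "0 \<le> op_norm V N M T"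
proof -
  interpret V: normed_space_on s V N by fact
  interpret W: normed_space_on t W M by fact
  have zero: "0 \<in> V" using V.subspace_0[OF V.subspace_carrier] .
  have "0 \<le> M (T 0)"
    using W.norm_on_nonneg assms(5) zero by blast
  also have "\<dots> \<le> op_norm V N M T"
    unfolding op_norm_def using zero V.norm_on_0 by (intro cSUP_upper V.op_norm_bdd_above assms(4)) simp
  finally show ?thesis .
qed

text \<open>A near-optimal isomorphism, rescaled so that the whole distortion sits in one of the two estimates.\<close>

lemma banach_mazur_dist_isomorphism:
  fixes s :: "'k::{real_normed_field, banach} \<Rightarrow> 'v::ab_group_add \<Rightarrow> 'v"
    and t :: "'k \<Rightarrow> 'w::ab_group_add \<Rightarrow> 'w"
  assumes V: "finite_dim_banach_on s V N" and W: "finite_dim_banach_on t W M"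
    and dim: "vector_space.dim s V = vector_space.dim t W"
    and dist: "banach_mazur_dist s V N t W M < D"
  obtains T where "linear_map_on s t V T" "bij_betw T V W"
    "\<And>x. x \<in> V \<Longrightarrow> M (T x) \<le> D * N x" "\<And>x. x \<in> V \<Longrightarrow> N x \<le> M (T x)"
proof -
  interpret V: finite_dim_banach_on s V N by fact
  interpret W: finite_dim_banach_on t W M by fact
  note ns = V.normed_space_on_axioms W.normed_space_on_axioms
  obtain T where iso: "banach_iso s V N t W M T"
    and less: "op_norm V N M T * op_norm W M N (inv_into V T) < D"
    using cInf_lessD[OF _ dist[unfolded banach_mazur_dist_def]]
      finite_dim_banach_iso_exists[OF V W dim] by blast
  have T: "linear_map_on s t V T" "bij_betw T V W" "bounded_map_on V N M T"
    "bounded_map_on W M N (inv_into V T)"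
    using iso by (auto simp: banach_iso_def)
  have im: "T ` V \<subseteq> W" and inj: "inj_on T V"
    using T(2) by (auto simp: bij_betw_def)
  have inv: "inv_into V T ` W \<subseteq> V"
    using T(2) by (metis bij_betw_def bij_betw_inv_into subset_refl)
  have lin_inv: "linear_map_on t s W (inv_into V T)"
    using linear_map_on_inv_into[OF V.vector_space_axioms V.subspace_carrier T(1,2)] .
  define a where "a = op_norm V N M T"
  define b where "b = op_norm W M N (inv_into V T)"
  have a: "0 \<le> a" and b: "0 \<le> b"
    unfolding a_def b_def
    using op_norm_nonneg[OF ns T(1,3) im] op_norm_nonneg[OF ns(2,1) lin_inv T(4) inv] by auto
  define \<eta> where "\<eta> = (D - a * b) / (a + 1)"
  have \<eta>: "0 < \<eta>" "a * \<eta> \<le> D - a * b"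
    using less a by (auto simp: \<eta>_def a_def[symmetric] b_def[symmetric] field_simps)
  \<comment> \<open>The slack in \<open>less\<close> leaves room for a strictly positive factor, also when \<open>b = 0\<close>.\<close>
  define \<beta> where "\<beta> = b + \<eta>"
  define c :: 'k where "c = of_real \<beta>"
  have \<beta>: "0 < \<beta>" "\<beta> * a \<le> D"
    using b \<eta> by (auto simp: \<beta>_def distrib_left mult.commute)
  then have c: "c \<noteq> 0" "norm c = \<beta>"
    by (simp_all add: c_def)
  have bij_c: "bij_betw (t c) W W"
    by (rule bij_betw_byWitness[where f' = "t (inverse c)"])
      (use c W.subspace_scale[OF W.subspace_carrier] in auto)
  show ?thesis
  proof (rule that)
    show "linear_map_on s t V (t c \<circ> T)"
      using T(1) by (simp add: linear_map_on_def W.scale_right_distrib mult.commute)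
    show "bij_betw (t c \<circ> T) V W"
      using T(2) bij_c by (rule bij_betw_trans)
    fix x assume x: "x \<in> V"
    then have Tx: "T x \<in> W" using im by blast
    have norm_cT: "M ((t c \<circ> T) x) = \<beta> * M (T x)"
      by (simp add: W.norm_on_scale[OF Tx] c)
    also have "\<dots> \<le> \<beta> * (a * N x)"
      unfolding a_def using \<beta> by (intro mult_left_mono le_op_norm[OF ns T(1,3) im x]) simp
    also have "\<dots> \<le> D * N x"
      using \<beta>(2) V.norm_on_nonneg[OF x] by (simp add: mult.assoc[symmetric] mult_right_mono)
    finally show "M ((t c \<circ> T) x) \<le> D * N x" .
    have "N x \<le> b * M (T x)"
      using le_op_norm[OF ns(2,1) lin_inv T(4) inv Tx] inv_into_f_f[OF inj x] by (simp add: b_def)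
    also have "\<dots> \<le> \<beta> * M (T x)"
      unfolding \<beta>_def using \<eta> W.norm_on_nonneg[OF Tx] by (intro mult_right_mono) auto
    finally show "N x \<le> M ((t c \<circ> T) x)"
      unfolding norm_cT .
  qed
qed

section \<open>Rademacher sums\<close>

text \<open>The numbers below \<open>2 ^ d\<close> encode the sign vectors of length \<open>d\<close> by their binary digits; the \<open>k\<close>-th
Rademacher function reads off the \<open>k\<close>-th sign.\<close>

definition rademacher :: "nat \<Rightarrow> nat \<Rightarrow> real" where
  "rademacher k \<omega> = (if even (\<omega> div 2 ^ k) then 1 else - 1)"

definition rad_sum :: "nat \<Rightarrow> (nat \<Rightarrow> 'k::real_normed_field) \<Rightarrow> nat \<Rightarrow> 'k" where
  "rad_sum d a \<omega> = (\<Sum>k<d. rademacher k \<omega> *\<^sub>R a k)"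

text \<open>On the span of the Rademacher functions \<open>r_k\<close> these are the coefficients with respect to the
\<open>l1\<close>-normalised functions \<open>2^-d r_k\<close>; hence the factor \<open>1 / 2 ^ d\<close> in \<open>rad_proj\<close>, the projection whose
kernel is that span.\<close>

definition rad_coeff :: "nat \<Rightarrow> (nat \<Rightarrow> 'k::real_normed_field) \<Rightarrow> nat \<Rightarrow> 'k" where
  "rad_coeff d f k = (\<Sum>\<omega><2 ^ d. rademacher k \<omega> *\<^sub>R f \<omega>)"

definition rad_proj :: "nat \<Rightarrow> (nat \<Rightarrow> 'k::real_normed_field) \<Rightarrow> nat \<Rightarrow> 'k" where
  "rad_proj d f \<omega> = f \<omega> - (1 / 2 ^ d) *\<^sub>R rad_sum d (rad_coeff d f) \<omega>"

definition rad_form :: "nat \<Rightarrow> (nat \<Rightarrow> 'k::real_normed_field) \<Rightarrow> (nat \<Rightarrow> 'k) \<Rightarrow> 'k" where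
  "rad_form d f g = (\<Sum>k<d. rad_coeff d f k * rad_coeff d g k)"

lemma rademacher_abs [simp]: "\<bar>rademacher k \<omega>\<bar> = 1"
  and rademacher_square [simp]: "rademacher k \<omega> * rademacher k \<omega> = 1"
  by (simp_all add: rademacher_def)

lemma rademacher_shift: "k < d \<Longrightarrow> rademacher k (\<omega> + 2 ^ d) = rademacher k \<omega>"
proof -
  assume "k < d"
  then have "(2::nat) ^ d = 2 ^ (d - k) * 2 ^ k" "even ((2::nat) ^ (d - k))"
    by (simp_all flip: power_add)
  then show ?thesis
    by (simp add: rademacher_def)
qed

lemma rademacher_top:
  assumes "\<omega> < 2 ^ d"
  shows "rademacher d \<omega> = 1" "rademacher d (\<omega> + 2 ^ d) = - 1"
  using assms by (simp_all add: rademacher_def)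

lemma sum_lessThan_power2_Suc:
  fixes g :: "nat \<Rightarrow> 'a::comm_monoid_add"
  shows "(\<Sum>\<omega><2 ^ Suc d. g \<omega>) = (\<Sum>\<omega><2 ^ d. g \<omega> + g (\<omega> + 2 ^ d))"
proof -
  have "(\<Sum>\<omega><2 ^ Suc d. g \<omega>) = (\<Sum>\<omega><2 ^ d + 2 ^ d. g \<omega>)"
    by (simp add: mult_2)
  also have "\<dots> = (\<Sum>\<omega><2 ^ d. g \<omega>) + (\<Sum>\<omega>=2 ^ d..<2 ^ d + 2 ^ d. g \<omega>)"
    by (simp add: lessThan_atLeast0 sum.atLeastLessThan_concat)
  also have "(\<Sum>\<omega>=2 ^ d..<2 ^ d + 2 ^ d. g \<omega>) = (\<Sum>\<omega><2 ^ d. g (\<omega> + 2 ^ d))"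
    using sum.shift_bounds_nat_ivl[of g 0 "2 ^ d" "2 ^ d"] by (simp add: lessThan_atLeast0)
  finally show ?thesis
    by (simp add: sum.distrib)
qed

lemma rademacher_orthogonal:
  "k < d \<Longrightarrow> l < d \<Longrightarrow>
    (\<Sum>\<omega><2 ^ d. rademacher k \<omega> * rademacher l \<omega>) = (if k = l then 2 ^ d else 0)"
proof (induction d)
  case (Suc d)
  consider "k < d" "l < d" | "k = d" "l = d" | "k = d" "l < d" | "k < d" "l = d"
    using Suc.prems by linarith
  then show ?case
  proof cases
    case 1
    then show ?thesis
      unfolding sum_lessThan_power2_Suc using Suc.IH[OF 1]
      by (simp add: rademacher_shift sum_distrib_left[symmetric])
  qed (simp_all add: sum_lessThan_power2_Suc rademacher_shift rademacher_top del: power_Suc)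
qed simp

lemma rad_sum_Suc:
  assumes "\<omega> < 2 ^ d"
  shows "rad_sum (Suc d) a \<omega> = rad_sum d a \<omega> + a d"
    and "rad_sum (Suc d) a (\<omega> + 2 ^ d) = rad_sum d a \<omega> - a d"
  using assms by (simp_all add: rad_sum_def rademacher_shift rademacher_top)

text \<open>By induction on \<open>d\<close>: the last sign takes both values, so each step is the parallelogram law.\<close>

lemma rad_sum_second_moment:
  fixes a :: "nat \<Rightarrow> 'k::real_or_complex"
  shows "(\<Sum>\<omega><2 ^ d. (norm (rad_sum d a \<omega>))\<^sup>2) = 2 ^ d * (\<Sum>k<d. (norm (a k))\<^sup>2)"
proof (induction d)
  case 0
  then show ?case by (simp add: rad_sum_def)
next
  case (Suc d)
  have "(\<Sum>\<omega><2 ^ Suc d. (norm (rad_sum (Suc d) a \<omega>))\<^sup>2)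
      = (\<Sum>\<omega><2 ^ d. 2 * (norm (rad_sum d a \<omega>))\<^sup>2 + 2 * (norm (a d))\<^sup>2)"
    unfolding sum_lessThan_power2_Suc
    by (intro sum.cong) (simp_all add: rad_sum_Suc parallelogram_law)
  also have "\<dots> = 2 * (2 ^ d * (\<Sum>k<d. (norm (a k))\<^sup>2)) + 2 ^ d * (2 * (norm (a d))\<^sup>2)"
    by (simp add: sum.distrib sum_distrib_left[symmetric] Suc.IH)
  finally show ?case
    by (simp add: algebra_simps)
qed

lemma fourth_power_parallelogram:
  fixes x y :: "'k::real_or_complex"
  shows "norm (x + y) ^ 4 + norm (x - y) ^ 4
    \<le> 2 * norm x ^ 4 + 12 * ((norm x)\<^sup>2 * (norm y)\<^sup>2) + 2 * norm y ^ 4"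
proof -
  define P where "P = (norm (x + y))\<^sup>2"
  define Q where "Q = (norm (x - y))\<^sup>2"
  have sum: "P + Q = 2 * (norm x)\<^sup>2 + 2 * (norm y)\<^sup>2"
    unfolding P_def Q_def by (rule parallelogram_law)
  have up: "P \<le> (norm x + norm y)\<^sup>2" "Q \<le> (norm x + norm y)\<^sup>2"
    unfolding P_def Q_def by (intro power_mono norm_triangle_ineq norm_triangle_ineq4 norm_ge_zero)+
  have "\<bar>P - Q\<bar> \<le> 4 * (norm x * norm y)"
    using sum up by (simp add: power2_sum)
  then have "\<bar>P - Q\<bar>\<^sup>2 \<le> (4 * (norm x * norm y))\<^sup>2"
    by (rule power_mono) simp
  then have "2 * (P\<^sup>2 + Q\<^sup>2) \<le> (P + Q)\<^sup>2 + (4 * (norm x * norm y))\<^sup>2"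
    unfolding power2_abs by (simp add: power2_sum power2_diff)
  then have "P\<^sup>2 + Q\<^sup>2 \<le> 2 * ((norm x)\<^sup>2 + (norm y)\<^sup>2)\<^sup>2 + 8 * (norm x * norm y)\<^sup>2"
    unfolding sum by (simp add: power2_sum power_mult_distrib)
  then show ?thesis
    unfolding P_def Q_def by (simp add: power2_sum power_mult_distrib flip: power_mult)
qed

lemma rad_sum_fourth_moment:
  fixes a :: "nat \<Rightarrow> 'k::real_or_complex"
  shows "(\<Sum>\<omega><2 ^ d. norm (rad_sum d a \<omega>) ^ 4) \<le> 3 * 2 ^ d * (\<Sum>k<d. (norm (a k))\<^sup>2)\<^sup>2"
proof (induction d)
  case 0
  then show ?case by (simp add: rad_sum_def)
next
  case (Suc d)
  define \<sigma> where "\<sigma> = (\<Sum>k<d. (norm (a k))\<^sup>2)"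
  define y where "y = (norm (a d))\<^sup>2"
  have "(\<Sum>\<omega><2 ^ Suc d. norm (rad_sum (Suc d) a \<omega>) ^ 4)
      = (\<Sum>\<omega><2 ^ d. norm (rad_sum d a \<omega> + a d) ^ 4 + norm (rad_sum d a \<omega> - a d) ^ 4)"
    unfolding sum_lessThan_power2_Suc by (intro sum.cong) (simp_all add: rad_sum_Suc)
  also have "\<dots> \<le> (\<Sum>\<omega><2 ^ d. 2 * norm (rad_sum d a \<omega>) ^ 4
      + 12 * ((norm (rad_sum d a \<omega>))\<^sup>2 * y) + 2 * norm (a d) ^ 4)"
    unfolding y_def by (intro sum_mono fourth_power_parallelogram)
  also have "\<dots> = 2 * (\<Sum>\<omega><2 ^ d. norm (rad_sum d a \<omega>) ^ 4) + 12 * (2 ^ d * \<sigma> * y) + 2 ^ d * (2 * y\<^sup>2)"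
    unfolding sum.distrib sum_distrib_left[symmetric] sum_distrib_right[symmetric]
    by (simp add: rad_sum_second_moment \<sigma>_def y_def flip: power_mult)
  also have "\<dots> \<le> 2 * (3 * 2 ^ d * \<sigma>\<^sup>2) + 12 * (2 ^ d * \<sigma> * y) + 2 ^ d * (6 * y\<^sup>2)"
    using Suc.IH by (intro add_mono mult_left_mono) (auto simp: \<sigma>_def sum_nonneg)
  also have "\<dots> = 3 * 2 ^ Suc d * (\<sigma> + y)\<^sup>2"
    by (simp add: power2_sum algebra_simps)
  finally show ?case
    by (simp add: \<sigma>_def y_def)
qed

text \<open>The first absolute moment is bounded below by interpolation between the second and the fourth: the
polynomial inequality \<open>t\<^sup>2 \<sigma>\<^sup>2 \<le> t \<sigma>^3 + t^4 / 6\<close>, averaged over the signs, gives \<open>\<sigma>^4\<close> on the left and at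
most \<open>\<sigma>^3\<close> times the first moment plus \<open>\<sigma>^4 / 2\<close> on the right.\<close>

lemma khintchine_L1:
  fixes a :: "nat \<Rightarrow> 'k::real_or_complex"
  shows "2 ^ d * sqrt (\<Sum>k<d. (norm (a k))\<^sup>2) \<le> 2 * (\<Sum>\<omega><2 ^ d. norm (rad_sum d a \<omega>))"
proof -
  define \<sigma> where "\<sigma> = sqrt (\<Sum>k<d. (norm (a k))\<^sup>2)"
  define E where "E = (\<Sum>\<omega><2 ^ d. norm (rad_sum d a \<omega>))"
  have \<sigma>: "0 \<le> \<sigma>" "\<sigma>\<^sup>2 = (\<Sum>k<d. (norm (a k))\<^sup>2)"
    by (auto simp: \<sigma>_def sum_nonneg)
  have pw: "t\<^sup>2 * \<sigma>\<^sup>2 \<le> t * \<sigma> ^ 3 + t ^ 4 / 6" if t: "0 \<le> t" for t :: real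
  proof -
    \<comment> \<open>The cubic \<open>t^3 - 6 t \<sigma>\<^sup>2 + 6 \<sigma>^3\<close> has its minimum over \<open>t \<ge> 0\<close> at \<open>\<surd>2 \<sigma>\<close>; completing the square at
      the rational approximation \<open>10 / 7\<close> of \<open>\<surd>2\<close> leaves nonnegative remainders.\<close>
    have "0 \<le> t * ((t - 10 / 7 * \<sigma>)\<^sup>2 * (t + 20 / 7 * \<sigma>) + 6 / 49 * t * \<sigma>\<^sup>2 + 58 / 343 * \<sigma> ^ 3)"
      using t \<sigma>(1) by simp
    also have "\<dots> = 6 * (t * \<sigma> ^ 3 + t ^ 4 / 6 - t\<^sup>2 * \<sigma>\<^sup>2)"
      by (simp add: power2_eq_square power3_eq_cube power4_eq_xxxx field_simps)
    finally show ?thesis by simp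
  qed
  show ?thesis
  proof (cases "\<sigma> = 0")
    case True
    then show ?thesis by (simp add: \<sigma>_def sum_nonneg)
  next
    case False
    have "(\<Sum>\<omega><2 ^ d. (norm (rad_sum d a \<omega>))\<^sup>2 * \<sigma>\<^sup>2)
        \<le> (\<Sum>\<omega><2 ^ d. norm (rad_sum d a \<omega>) * \<sigma> ^ 3 + norm (rad_sum d a \<omega>) ^ 4 / 6)"
      by (intro sum_mono pw) simp
    also have "\<dots> = E * \<sigma> ^ 3 + (\<Sum>\<omega><2 ^ d. norm (rad_sum d a \<omega>) ^ 4) / 6"
      by (simp add: sum.distrib E_def sum_distrib_right sum_divide_distrib)
    also have "\<dots> \<le> E * \<sigma> ^ 3 + (3 * 2 ^ d * (\<sigma>\<^sup>2)\<^sup>2) / 6"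
      using rad_sum_fourth_moment[of d a] by (intro add_left_mono divide_right_mono) (simp_all add: \<sigma>)
    finally have "2 ^ d * \<sigma>\<^sup>2 * \<sigma>\<^sup>2 \<le> E * \<sigma> ^ 3 + 2 ^ d * (\<sigma>\<^sup>2)\<^sup>2 / 2"
      by (simp add: sum_distrib_right[symmetric] rad_sum_second_moment \<sigma>)
    then have "\<sigma> ^ 3 * (2 ^ d * \<sigma>) \<le> \<sigma> ^ 3 * (2 * E)"
      by (simp add: power2_eq_square power3_eq_cube algebra_simps)
    moreover have "0 < \<sigma> ^ 3"
      using False \<sigma> by simp
    ultimately show ?thesis
      unfolding \<sigma>_def[symmetric] E_def[symmetric] by (rule mult_left_le_imp_le)
  qed
qed

lemma rad_sum_L1_le:
  fixes a :: "nat \<Rightarrow> 'k::real_or_complex"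
  shows "(\<Sum>\<omega><2 ^ d. norm (rad_sum d a \<omega>)) \<le> 2 ^ d * sqrt (\<Sum>k<d. (norm (a k))\<^sup>2)"
proof (rule power2_le_imp_le)
  have "(\<Sum>\<omega><2 ^ d. norm (rad_sum d a \<omega>) * 1)\<^sup>2
      \<le> (\<Sum>\<omega><2 ^ d. (norm (rad_sum d a \<omega>))\<^sup>2) * (\<Sum>\<omega><(2::nat) ^ d. 1\<^sup>2)"
    by (rule Cauchy_Schwarz_ineq_sum)
  also have "\<dots> = (2 ^ d * sqrt (\<Sum>k<d. (norm (a k))\<^sup>2))\<^sup>2"
    unfolding rad_sum_second_moment
    by (simp add: power_mult_distrib sum_nonneg) (simp add: power2_eq_square)
  finally show "(\<Sum>\<omega><2 ^ d. norm (rad_sum d a \<omega>))\<^sup>2 \<le> (2 ^ d * sqrt (\<Sum>k<d. (norm (a k))\<^sup>2))\<^sup>2"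
    by simp
qed (simp add: sum_nonneg)

text \<open>For fixed \<open>\<omega>\<close> the sum over \<open>k\<close> is a Rademacher sum in \<open>\<omega>'\<close> with unimodular coefficients, hence of
average modulus at most \<open>\<surd>d\<close>; a trivial estimate would give \<open>d\<close>.\<close>

lemma rademacher_average_le:
  fixes M :: "nat \<Rightarrow> nat \<Rightarrow> 'k::real_or_complex"
  assumes M: "\<And>\<omega> \<omega>'. \<omega> < 2 ^ d \<Longrightarrow> \<omega>' < 2 ^ d \<Longrightarrow> norm (M \<omega> \<omega>') \<le> D" and D: "0 \<le> D"
  shows "norm (\<Sum>k<d. \<Sum>\<omega><2 ^ d. \<Sum>\<omega>'<2 ^ d. (rademacher k \<omega> * rademacher k \<omega>') *\<^sub>R M \<omega> \<omega>')
    \<le> D * 4 ^ d * sqrt d"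
proof -
  have "(\<Sum>k<d. \<Sum>\<omega><2 ^ d. \<Sum>\<omega>'<2 ^ d. (rademacher k \<omega> * rademacher k \<omega>') *\<^sub>R M \<omega> \<omega>')
      = (\<Sum>\<omega><2 ^ d. \<Sum>k<d. \<Sum>\<omega>'<2 ^ d. (rademacher k \<omega> * rademacher k \<omega>') *\<^sub>R M \<omega> \<omega>')"
    by (rule sum.swap)
  also have "\<dots> = (\<Sum>\<omega><2 ^ d. \<Sum>\<omega>'<2 ^ d. \<Sum>k<d. (rademacher k \<omega> * rademacher k \<omega>') *\<^sub>R M \<omega> \<omega>')"
    by (intro sum.cong refl sum.swap)
  also have "\<dots> = (\<Sum>\<omega><2 ^ d. \<Sum>\<omega>'<2 ^ d. rad_sum d (\<lambda>k. rademacher k \<omega>) \<omega>' *\<^sub>R M \<omega> \<omega>')"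
    by (simp add: rad_sum_def scaleR_left.sum mult.commute)
  also have "norm \<dots> \<le> (\<Sum>\<omega><2 ^ d. \<Sum>\<omega>'<2 ^ d. norm (rad_sum d (\<lambda>k. rademacher k \<omega>) \<omega>') * D)"
    using M by (intro sum_norm_le) (auto intro!: mult_left_mono)
  also have "\<dots> \<le> (\<Sum>\<omega><(2::nat) ^ d. 2 ^ d * sqrt d * D)"
  proof (intro sum_mono)
    fix \<omega> :: nat
    show "(\<Sum>\<omega>'<2 ^ d. norm (rad_sum d (\<lambda>k. rademacher k \<omega>) \<omega>') * D) \<le> 2 ^ d * sqrt d * D"
      using rad_sum_L1_le[of d "\<lambda>k. rademacher k \<omega>"] D
      by (simp add: sum_distrib_right[symmetric] mult_right_mono)
  qed
  also have "\<dots> = D * 4 ^ d * sqrt d"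
    by (simp add: power_mult_distrib[symmetric] mult_ac)
  finally show ?thesis .
qed

lemma rad_coeff_add: "rad_coeff d (\<lambda>\<omega>. f \<omega> + g \<omega>) k = rad_coeff d f k + rad_coeff d g k"
  by (simp add: rad_coeff_def scaleR_add_right sum.distrib)

lemma rad_coeff_diff: "rad_coeff d (\<lambda>\<omega>. f \<omega> - g \<omega>) k = rad_coeff d f k - rad_coeff d g k"
  by (simp add: rad_coeff_def scaleR_diff_right sum_subtractf)

lemma rad_coeff_mult: "rad_coeff d (\<lambda>\<omega>. c * f \<omega>) k = c * rad_coeff d f k"
  by (simp add: rad_coeff_def sum_distrib_left)

lemma rad_coeff_scaleR: "rad_coeff d (\<lambda>\<omega>. c *\<^sub>R f \<omega>) k = c *\<^sub>R rad_coeff d f k"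
  by (simp add: rad_coeff_def scaleR_sum_right mult.commute)

lemma rad_coeff_sum: "rad_coeff d (\<lambda>\<omega>. \<Sum>i\<in>I. f i \<omega>) k = (\<Sum>i\<in>I. rad_coeff d (f i) k)"
  unfolding rad_coeff_def scaleR_sum_right by (rule sum.swap)

lemma rad_coeff_cong: "(\<And>\<omega>. \<omega> < 2 ^ d \<Longrightarrow> f \<omega> = g \<omega>) \<Longrightarrow> rad_coeff d f k = rad_coeff d g k"
  by (simp add: rad_coeff_def)

lemma rad_coeff_rad_sum:
  assumes "k < d" shows "rad_coeff d (rad_sum d a) k = 2 ^ d *\<^sub>R a k"
proof -
  have "rad_coeff d (rad_sum d a) k = (\<Sum>l<d. (\<Sum>\<omega><2 ^ d. rademacher k \<omega> * rademacher l \<omega>) *\<^sub>R a l)"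
    unfolding rad_coeff_def rad_sum_def scaleR_sum_right scaleR_scaleR scaleR_left.sum
    by (rule sum.swap)
  also have "\<dots> = (\<Sum>l<d. if k = l then 2 ^ d *\<^sub>R a l else 0)"
    using assms by (intro sum.cong) (simp_all add: rademacher_orthogonal)
  finally show ?thesis using assms by simp
qed

lemma rad_coeff_rad_proj: "k < d \<Longrightarrow> rad_coeff d (rad_proj d f) k = 0"
  unfolding rad_proj_def by (simp add: rad_coeff_diff rad_coeff_scaleR rad_coeff_rad_sum)

lemma rad_proj_eq_self: "(\<And>k. k < d \<Longrightarrow> rad_coeff d f k = 0) \<Longrightarrow> rad_proj d f \<omega> = f \<omega>"
  by (simp add: rad_proj_def rad_sum_def)

lemma rad_proj_rad_sum: "rad_proj d (rad_sum d a) \<omega> = 0"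
proof -
  have "rad_sum d (rad_coeff d (rad_sum d a)) \<omega> = 2 ^ d *\<^sub>R rad_sum d a \<omega>"
    unfolding rad_sum_def scaleR_sum_right
    by (intro sum.cong) (simp_all add: rad_coeff_rad_sum[unfolded rad_sum_def])
  then show ?thesis
    by (simp add: rad_proj_def)
qed

lemma rad_sum_add: "rad_sum d (\<lambda>k. a k + b k) \<omega> = rad_sum d a \<omega> + rad_sum d b \<omega>"
  by (simp add: rad_sum_def scaleR_add_right sum.distrib)

lemma rad_sum_mult: "rad_sum d (\<lambda>k. c * a k) \<omega> = c * rad_sum d a \<omega>"
  by (simp add: rad_sum_def sum_distrib_left)

lemma rad_proj_add: "rad_proj d (\<lambda>\<omega>. f \<omega> + g \<omega>) \<omega> = rad_proj d f \<omega> + rad_proj d g \<omega>"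
  by (simp add: rad_proj_def rad_sum_def rad_coeff_add scaleR_add_right sum.distrib)

lemma rad_proj_mult: "rad_proj d (\<lambda>\<omega>. c * f \<omega>) \<omega> = c * rad_proj d f \<omega>"
  by (simp add: rad_proj_def rad_sum_def rad_coeff_mult sum_distrib_left right_diff_distrib)

lemma norm_rad_coeff_le: "norm (rad_coeff d f k) \<le> (\<Sum>\<omega><2 ^ d. norm (f \<omega>))"
  unfolding rad_coeff_def by (intro sum_norm_le) simp

lemma norm_rad_proj_le:
  assumes "\<omega> < 2 ^ d"
  shows "norm (rad_proj d f \<omega>) \<le> (1 + real d) * (\<Sum>\<omega>'<2 ^ d. norm (f \<omega>'))"
proof -
  define L where "L = (\<Sum>\<omega>'<2 ^ d. norm (f \<omega>'))"
  have "norm (f \<omega>) \<le> L"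
    using assms unfolding L_def by (intro member_le_sum) auto
  moreover have "norm (rad_sum d (rad_coeff d f) \<omega>) \<le> (\<Sum>k<d. L)"
    unfolding rad_sum_def L_def by (intro sum_norm_le) (simp add: norm_rad_coeff_le)
  moreover have "norm (rad_proj d f \<omega>) \<le> norm (f \<omega>) + norm ((1 / 2 ^ d) *\<^sub>R rad_sum d (rad_coeff d f) \<omega>)"
    unfolding rad_proj_def by (rule norm_triangle_ineq4)
  moreover have "norm ((1 / 2 ^ d) *\<^sub>R rad_sum d (rad_coeff d f) \<omega>) \<le> norm (rad_sum d (rad_coeff d f) \<omega>)"
    unfolding norm_scaleR by (rule mult_left_le_one_le) simp_all
  ultimately show ?thesis
    unfolding L_def[symmetric] by (simp add: algebra_simps)
qed

text \<open>Khintchine's inequality on the kernel of the projection, that is, on the span of the Rademacher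
functions.\<close>

lemma rad_coeff_L2_le:
  fixes f :: "nat \<Rightarrow> 'k::real_or_complex"
  assumes "\<And>\<omega>. \<omega> < 2 ^ d \<Longrightarrow> rad_proj d f \<omega> = 0"
  shows "sqrt (\<Sum>k<d. (norm (rad_coeff d f k))\<^sup>2) \<le> 2 * (\<Sum>\<omega><2 ^ d. norm (f \<omega>))"
proof -
  have "(\<Sum>\<omega><2 ^ d. norm (rad_sum d (rad_coeff d f) \<omega>)) = (\<Sum>\<omega><2 ^ d. 2 ^ d * norm (f \<omega>))"
    using assms by (intro sum.cong) (auto simp: rad_proj_def)
  then have "2 ^ d * sqrt (\<Sum>k<d. (norm (rad_coeff d f k))\<^sup>2) \<le> 2 ^ d * (2 * (\<Sum>\<omega><2 ^ d. norm (f \<omega>)))"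
    using khintchine_L1[of d "rad_coeff d f"] by (simp add: sum_distrib_left[symmetric] mult.left_commute)
  then show ?thesis by simp
qed

lemma norm_sum_mult_le_L2:
  fixes a b :: "nat \<Rightarrow> 'k::real_normed_field"
  shows "norm (\<Sum>k<d. a k * b k) \<le> sqrt (\<Sum>k<d. (norm (a k))\<^sup>2) * sqrt (\<Sum>k<d. (norm (b k))\<^sup>2)"
proof -
  have "norm (\<Sum>k<d. a k * b k) \<le> (\<Sum>k<d. norm (a k) * norm (b k))"
    by (intro sum_norm_le) (simp add: norm_mult)
  also have "\<dots> \<le> sqrt (\<Sum>k<d. (norm (a k))\<^sup>2) * sqrt (\<Sum>k<d. (norm (b k))\<^sup>2)"
    using L2_set_mult_ineq[of "\<lambda>k. norm (a k)" "\<lambda>k. norm (b k)" "{..<d}"] by (simp add: L2_set_def)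
  finally show ?thesis .
qed

lemma norm_rad_form_le:
  fixes f g :: "nat \<Rightarrow> 'k::real_or_complex"
  assumes "\<And>\<omega>. \<omega> < 2 ^ d \<Longrightarrow> rad_proj d f \<omega> = 0" "\<And>\<omega>. \<omega> < 2 ^ d \<Longrightarrow> rad_proj d g \<omega> = 0"
  shows "norm (rad_form d f g) \<le> 4 * (\<Sum>\<omega><2 ^ d. norm (f \<omega>)) * (\<Sum>\<omega><2 ^ d. norm (g \<omega>))"
proof -
  have "norm (rad_form d f g) \<le> sqrt (\<Sum>k<d. (norm (rad_coeff d f k))\<^sup>2) * sqrt (\<Sum>k<d. (norm (rad_coeff d g k))\<^sup>2)"
    unfolding rad_form_def by (rule norm_sum_mult_le_L2)
  also have "\<dots> \<le> (2 * (\<Sum>\<omega><2 ^ d. norm (f \<omega>))) * (2 * (\<Sum>\<omega><2 ^ d. norm (g \<omega>)))"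
    using assms by (intro mult_mono rad_coeff_L2_le) (auto simp: sum_nonneg)
  finally show ?thesis by simp
qed

section \<open>The quotient of a finite-dimensional l1 space by the Rademacher functions\<close>

text \<open>The quotient of \<open>l1^N\<close>, \<open>N = 2 ^ d\<close>, by the span of the Rademacher functions, realised on the
complementary subspace of sequences that are orthogonal to them.\<close>

definition rad_quot :: "nat \<Rightarrow> (nat \<Rightarrow> 'k::real_normed_field) set" where
  "rad_quot d = {g. (\<forall>\<omega>\<ge>2 ^ d. g \<omega> = 0) \<and> (\<forall>k<d. rad_coeff d g k = 0)}"

definition rad_quot_norm :: "nat \<Rightarrow> (nat \<Rightarrow> 'k::real_normed_field) \<Rightarrow> real" where
  "rad_quot_norm d g = (INF a. \<Sum>\<omega><2 ^ d. norm (g \<omega> + rad_sum d a \<omega>))"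

definition rad_quot_map :: "nat \<Rightarrow> (nat \<Rightarrow> 'k::real_normed_field) \<Rightarrow> nat \<Rightarrow> 'k" where
  "rad_quot_map d f \<omega> = (if \<omega> < 2 ^ d then rad_proj d f \<omega> else 0)"

lemma rad_quot_norm_bdd_below:
  "bdd_below (range (\<lambda>a. \<Sum>\<omega><2 ^ d. norm (g \<omega> + rad_sum d a \<omega>)))"
  by (rule bdd_belowI2[of _ 0]) (simp add: sum_nonneg)

lemma rad_quot_norm_le: "rad_quot_norm d g \<le> (\<Sum>\<omega><2 ^ d. norm (g \<omega> + rad_sum d a \<omega>))"
  unfolding rad_quot_norm_def by (intro cINF_lower rad_quot_norm_bdd_below) simp

lemma le_rad_quot_norm:
  "(\<And>a. c \<le> (\<Sum>\<omega><2 ^ d. norm (g \<omega> + rad_sum d a \<omega>))) \<Longrightarrow> c \<le> rad_quot_norm d g"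
  unfolding rad_quot_norm_def by (intro cINF_greatest) simp_all

lemma rad_quot_norm_attained:
  assumes "0 < e"
  obtains a where "(\<Sum>\<omega><2 ^ d. norm (g \<omega> + rad_sum d a \<omega>)) < rad_quot_norm d g + e"
proof -
  have "\<exists>a. \<not> rad_quot_norm d g + e \<le> (\<Sum>\<omega><2 ^ d. norm (g \<omega> + rad_sum d a \<omega>))"
  proof (rule ccontr)
    assume "\<not> ?thesis"
    then have "rad_quot_norm d g + e \<le> rad_quot_norm d g"
      by (intro le_rad_quot_norm) blast
    then show False using assms by simp
  qed
  then show ?thesis using that by (auto simp: not_le)
qed

lemma rad_quot_norm_nonneg: "0 \<le> rad_quot_norm d g"
  by (intro le_rad_quot_norm sum_nonneg) simp

lemma rad_proj_rad_quot: "g \<in> rad_quot d \<Longrightarrow> rad_proj d g \<omega> = g \<omega>"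
  by (intro rad_proj_eq_self) (simp add: rad_quot_def)

text \<open>The projection recovers \<open>g\<close> from every representative of its class.  The constant depends on \<open>d\<close>, so
this serves only for definiteness and continuity of coordinates.\<close>

lemma norm_le_rad_quot_norm:
  assumes "g \<in> rad_quot d"
  shows "norm (g \<omega>) \<le> (1 + real d) * rad_quot_norm d g"
proof (cases "\<omega> < 2 ^ d")
  case True
  have "norm (g \<omega>) / (1 + real d) \<le> rad_quot_norm d g"
  proof (rule le_rad_quot_norm)
    fix a
    have "rad_proj d (\<lambda>\<omega>. g \<omega> + rad_sum d a \<omega>) \<omega> = g \<omega>"
      using assms by (simp add: rad_proj_add rad_proj_rad_quot rad_proj_rad_sum)
    then have "norm (g \<omega>) \<le> (1 + real d) * (\<Sum>\<omega><2 ^ d. norm (g \<omega> + rad_sum d a \<omega>))"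
      using norm_rad_proj_le[OF True, of "\<lambda>\<omega>. g \<omega> + rad_sum d a \<omega>"] by simp
    then show "norm (g \<omega>) / (1 + real d) \<le> (\<Sum>\<omega><2 ^ d. norm (g \<omega> + rad_sum d a \<omega>))"
      by (simp add: divide_le_eq mult.commute)
  qed
  then show ?thesis
    by (simp add: divide_le_eq mult.commute)
next
  case False
  then show ?thesis
    using assms by (simp add: rad_quot_def rad_quot_norm_nonneg)
qed

lemma rad_quot_norm_triangle: "rad_quot_norm d (g + h) \<le> rad_quot_norm d g + rad_quot_norm d h"
proof (rule field_le_epsilon)
  fix e :: real assume "0 < e"
  then have e: "0 < e / 2" by simp
  obtain a where a: "(\<Sum>\<omega><2 ^ d. norm (g \<omega> + rad_sum d a \<omega>)) < rad_quot_norm d g + e / 2"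
    using rad_quot_norm_attained[OF e] .
  obtain b where b: "(\<Sum>\<omega><2 ^ d. norm (h \<omega> + rad_sum d b \<omega>)) < rad_quot_norm d h + e / 2"
    using rad_quot_norm_attained[OF e] .
  have "rad_quot_norm d (g + h) \<le> (\<Sum>\<omega><2 ^ d. norm ((g + h) \<omega> + rad_sum d (\<lambda>k. a k + b k) \<omega>))"
    by (rule rad_quot_norm_le)
  also have "\<dots> = (\<Sum>\<omega><2 ^ d. norm ((g \<omega> + rad_sum d a \<omega>) + (h \<omega> + rad_sum d b \<omega>)))"
    by (simp add: rad_sum_add algebra_simps)
  also have "\<dots> \<le> (\<Sum>\<omega><2 ^ d. norm (g \<omega> + rad_sum d a \<omega>)) + (\<Sum>\<omega><2 ^ d. norm (h \<omega> + rad_sum d b \<omega>))"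
    unfolding sum.distrib[symmetric] by (intro sum_mono norm_triangle_ineq)
  finally show "rad_quot_norm d (g + h) \<le> rad_quot_norm d g + rad_quot_norm d h + e"
    using a b by simp
qed

lemma rad_quot_norm_scale_le: "rad_quot_norm d (scale_fun c g) \<le> norm c * rad_quot_norm d g"
proof (cases "c = 0")
  case True
  have "rad_quot_norm d (scale_fun c g) \<le> (\<Sum>\<omega><2 ^ d. norm (scale_fun c g \<omega> + rad_sum d (\<lambda>k. 0) \<omega>))"
    by (rule rad_quot_norm_le)
  then show ?thesis
    using True by (simp add: pointwise_scale_def rad_sum_def)
next
  case False
  have "rad_quot_norm d (scale_fun c g) / norm c \<le> rad_quot_norm d g"
  proof (rule le_rad_quot_norm)
    fix a
    have "rad_quot_norm d (scale_fun c g)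
        \<le> (\<Sum>\<omega><2 ^ d. norm (scale_fun c g \<omega> + rad_sum d (\<lambda>k. c * a k) \<omega>))"
      by (rule rad_quot_norm_le)
    also have "\<dots> = norm c * (\<Sum>\<omega><2 ^ d. norm (g \<omega> + rad_sum d a \<omega>))"
      by (simp add: pointwise_scale_def rad_sum_mult distrib_left[symmetric] norm_mult sum_distrib_left)
    finally show "rad_quot_norm d (scale_fun c g) / norm c \<le> (\<Sum>\<omega><2 ^ d. norm (g \<omega> + rad_sum d a \<omega>))"
      using False by (simp add: divide_le_eq mult.commute)
  qed
  then show ?thesis
    using False by (simp add: divide_le_eq mult.commute)
qed

lemma rad_quot_norm_scale: "rad_quot_norm d (scale_fun c g) = norm c * rad_quot_norm d g"
proof (cases "c = 0")
  case True
  then show ?thesis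
    using rad_quot_norm_scale_le[of d c g] rad_quot_norm_nonneg[of d "scale_fun c g"] by simp
next
  case False
  have "norm c * rad_quot_norm d (scale_fun (inverse c) (scale_fun c g))
      \<le> norm c * (norm (inverse c) * rad_quot_norm d (scale_fun c g))"
    by (intro mult_left_mono rad_quot_norm_scale_le norm_ge_zero)
  moreover have "scale_fun (inverse c) (scale_fun c g) = g"
    using False by (simp add: pointwise_scale_def fun_eq_iff)
  ultimately have "norm c * rad_quot_norm d g \<le> rad_quot_norm d (scale_fun c g)"
    using False by (simp add: norm_inverse mult.assoc[symmetric] del: mult_le_cancel_left_pos)
  then show ?thesis
    by (rule antisym[OF rad_quot_norm_scale_le])
qed

lemma rad_quot_map_in: "rad_quot_map d f \<in> rad_quot d"
proof -
  have "rad_coeff d (rad_quot_map d f) k = rad_coeff d (rad_proj d f) k" for k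
    by (intro rad_coeff_cong) (simp add: rad_quot_map_def)
  then show ?thesis
    by (simp add: rad_quot_def rad_quot_map_def rad_coeff_rad_proj)
qed

lemma rad_quot_norm_map_le: "rad_quot_norm d (rad_quot_map d f) \<le> (\<Sum>\<omega><2 ^ d. norm (f \<omega>))"
proof -
  have "rad_quot_map d f \<omega> + rad_sum d (\<lambda>k. of_real (1 / 2 ^ d) * rad_coeff d f k) \<omega> = f \<omega>"
    if "\<omega> < 2 ^ d" for \<omega>
    unfolding rad_sum_mult using that
    by (simp add: rad_quot_map_def rad_proj_def scaleR_conv_of_real)
  then show ?thesis
    using rad_quot_norm_le[of d "rad_quot_map d f" "\<lambda>k. of_real (1 / 2 ^ d) * rad_coeff d f k"] by simp
qed

lemma subspace_rad_quot: "module.subspace scale_fun (rad_quot d :: (nat \<Rightarrow> 'k::real_normed_field) set)"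
proof -
  interpret vector_space "scale_fun :: 'k \<Rightarrow> (nat \<Rightarrow> 'k) \<Rightarrow> nat \<Rightarrow> 'k"
    by (rule vector_space_scale_fun)
  show ?thesis
    by (rule subspaceI)
      (auto simp: rad_quot_def pointwise_scale_def rad_coeff_mult plus_fun_def rad_coeff_add zero_fun_def
        rad_coeff_def[of _ "\<lambda>_. 0"])
qed

lemma normed_space_on_rad_quot:
  "normed_space_on scale_fun (rad_quot d :: (nat \<Rightarrow> 'k::real_normed_field) set) (rad_quot_norm d)"
proof -
  interpret vector_space "scale_fun :: 'k \<Rightarrow> (nat \<Rightarrow> 'k) \<Rightarrow> nat \<Rightarrow> 'k"
    by (rule vector_space_scale_fun)
  show ?thesis
  proof
    show "x = 0" if "x \<in> rad_quot d" "rad_quot_norm d x = 0" for x :: "nat \<Rightarrow> 'k"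
      using norm_le_rad_quot_norm[OF that(1)] that(2) by (simp add: fun_eq_iff)
  qed (simp_all add: subspace_rad_quot rad_quot_norm_nonneg rad_quot_norm_triangle rad_quot_norm_scale)
qed

definition unit_seq :: "nat \<Rightarrow> nat \<Rightarrow> 'k::real_normed_field" where
  "unit_seq i = (\<lambda>n. if n = i then 1 else 0)"

lemma unit_seq_expansion:
  fixes g :: "nat \<Rightarrow> 'k::real_normed_field"
  assumes "\<And>\<omega>. \<omega> \<ge> n \<Longrightarrow> g \<omega> = 0"
  shows "g = (\<Sum>\<omega><n. scale_fun (g \<omega>) (unit_seq \<omega>))"
proof
  fix i
  have "(\<Sum>\<omega><n. scale_fun (g \<omega>) (unit_seq \<omega>)) i = (\<Sum>\<omega><n. if \<omega> = i then g \<omega> else 0)"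
    unfolding sum_function_apply by (intro sum.cong) (auto simp: pointwise_scale_def unit_seq_def)
  then show "g i = (\<Sum>\<omega><n. scale_fun (g \<omega>) (unit_seq \<omega>)) i"
    using assms[of i] by simp
qed

text \<open>The lower bound on the dimension holds because the complement together with the \<open>d\<close> Rademacher
functions spans all unit vectors.\<close>

lemma rad_quot_basis:
  obtains B :: "(nat \<Rightarrow> 'k::real_normed_field) set" where "finite B" "B \<subseteq> rad_quot d"
    "rad_quot d = module.span scale_fun B" "vector_space.dim scale_fun (rad_quot d :: (nat \<Rightarrow> 'k) set) = card B"
    "card B \<le> 2 ^ d" "2 ^ d \<le> card B + d"
proof -
  interpret vector_space "scale_fun :: 'k \<Rightarrow> (nat \<Rightarrow> 'k) \<Rightarrow> nat \<Rightarrow> 'k"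
    by (rule vector_space_scale_fun)
  obtain B :: "(nat \<Rightarrow> 'k) set" where B: "B \<subseteq> rad_quot d" "independent B" "rad_quot d \<subseteq> span B"
    "card B = dim (rad_quot d :: (nat \<Rightarrow> 'k) set)"
    using basis_exists .
  define E :: "(nat \<Rightarrow> 'k) set" where "E = unit_seq ` {..<2 ^ d}"
  have inj: "inj_on (unit_seq :: nat \<Rightarrow> nat \<Rightarrow> 'k) A" for A
    by (rule inj_onI) (metis unit_seq_def zero_neq_one)
  have E: "finite E" "card E = 2 ^ d"
    by (simp_all add: E_def card_image inj)
  have "B \<subseteq> span E"
  proof
    fix g assume "g \<in> B"
    then have "g = (\<Sum>\<omega><2 ^ d. scale_fun (g \<omega>) (unit_seq \<omega>))"
      using B(1) by (intro unit_seq_expansion) (auto simp: rad_quot_def)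
    also have "\<dots> \<in> span E"
      by (intro span_sum span_scale span_base) (simp add: E_def)
    finally show "g \<in> span E" .
  qed
  from independent_span_bound[OF E(1) B(2) this] have fin: "finite B" and up: "card B \<le> 2 ^ d"
    using E by auto
  define r :: "nat \<Rightarrow> nat \<Rightarrow> 'k" where
    "r k = (\<lambda>\<omega>. if \<omega> < 2 ^ d then of_real (rademacher k \<omega>) else 0)" for k
  have "E \<subseteq> span (B \<union> r ` {..<d})"
  proof
    fix f assume "f \<in> E"
    then have supp: "f \<omega> = 0" if "\<not> \<omega> < 2 ^ d" for \<omega>
      using that by (auto simp: E_def unit_seq_def)
    have "f = rad_quot_map d f + (\<Sum>k<d. scale_fun (of_real (1 / 2 ^ d) * rad_coeff d f k) (r k))"
    proof
      fix \<omega>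
      show "f \<omega> = (rad_quot_map d f + (\<Sum>k<d. scale_fun (of_real (1 / 2 ^ d) * rad_coeff d f k) (r k))) \<omega>"
        using supp[of \<omega>]
        by (simp add: sum_function_apply pointwise_scale_def r_def rad_quot_map_def rad_proj_def
            rad_sum_def scaleR_sum_right scaleR_conv_of_real sum_divide_distrib mult_ac)
    qed
    also have "\<dots> \<in> span (B \<union> r ` {..<d})"
      using rad_quot_map_in[of d f] B(3) span_mono[of B "B \<union> r ` {..<d}"]
      by (intro span_add span_sum span_scale) (auto intro: span_base)
    finally show "f \<in> span (B \<union> r ` {..<d})" .
  qed
  moreover have "independent E"
  proof (rule independent_if_scalars_zero[OF E(1)])
    fix c :: "(nat \<Rightarrow> 'k) \<Rightarrow> 'k" and x
    assume zero: "(\<Sum>x\<in>E. scale_fun (c x) x) = 0" and "x \<in> E"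
    then obtain i where i: "i < 2 ^ d" "x = unit_seq i"
      by (auto simp: E_def)
    have "0 = (\<Sum>x\<in>E. scale_fun (c x) x) i"
      using zero by simp
    also have "\<dots> = (\<Sum>\<omega><2 ^ d. if \<omega> = i then c (unit_seq \<omega>) else 0)"
      unfolding E_def sum_function_apply sum.reindex[OF inj]
      by (intro sum.cong) (auto simp: pointwise_scale_def unit_seq_def)
    finally show "c x = 0"
      using i by simp
  qed
  ultimately have "card E \<le> card (B \<union> r ` {..<d})"
    using independent_span_bound[of "B \<union> r ` {..<d}" E] fin by blast
  also have "\<dots> \<le> card B + card (r ` {..<d})"
    by (rule card_Un_le)
  also have "\<dots> \<le> card B + d"
    using card_image_le[of "{..<d}" r] by simp
  finally have low: "2 ^ d \<le> card B + d"
    by (simp add: E)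
  have "rad_quot d = span B"
    using B(1,3) span_minimal[OF _ subspace_rad_quot] by blast
  with fin B(1) show ?thesis
    using B(4) up low by (intro that) auto
qed

lemma finite_dim_banach_on_rad_quot:
  "finite_dim_banach_on scale_fun (rad_quot d :: (nat \<Rightarrow> 'k::{real_normed_field, banach}) set) (rad_quot_norm d)"
proof -
  interpret normed_space_on scale_fun "rad_quot d :: (nat \<Rightarrow> 'k) set" "rad_quot_norm d"
    by (rule normed_space_on_rad_quot)
  obtain B :: "(nat \<Rightarrow> 'k) set" where B: "finite B" "B \<subseteq> rad_quot d" "rad_quot d = span B"
    using rad_quot_basis .
  show ?thesis
  proof
    show "Metric_space.mcomplete (rad_quot d) (norm_dist (rad_quot d :: (nat \<Rightarrow> 'k) set) (rad_quot_norm d))"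
      using complete_on_span_finite[OF normed_space_on_axioms B(1,2)] B(3)
      by (intro mcomplete_if_complete_on) simp
    show "\<exists>B. finite B \<and> (rad_quot d :: (nat \<Rightarrow> 'k) set) = span B"
      using B by blast
  qed
qed

text \<open>Keeps the members of the dense sequence that approximate different quotients apart.\<close>

lemma rad_quot_dim_strict_mono:
  assumes "d + 2 \<le> e"
  shows "vector_space.dim scale_fun (rad_quot d :: (nat \<Rightarrow> 'k::real_normed_field) set)
    < vector_space.dim scale_fun (rad_quot e :: (nat \<Rightarrow> 'k) set)"
proof -
  obtain B :: "(nat \<Rightarrow> 'k) set" where B: "vector_space.dim scale_fun (rad_quot d :: (nat \<Rightarrow> 'k) set) = card B" "card B \<le> 2 ^ d"
    using rad_quot_basis by metis
  obtain C :: "(nat \<Rightarrow> 'k) set" where C: "vector_space.dim scale_fun (rad_quot e :: (nat \<Rightarrow> 'k) set) = card C" "2 ^ e \<le> card C + e"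
    using rad_quot_basis by metis
  have "(2::nat) ^ d < 2 ^ (e - 1)"
    using assms by (intro power_strict_increasing) auto
  moreover have "e \<le> 2 ^ (e - 1)"
    using less_exp[of "e - 1"] assms by linarith
  moreover have "(2::nat) ^ e = 2 ^ (e - 1) + 2 ^ (e - 1)"
    using assms by (cases e) auto
  ultimately show ?thesis
    using B C by linarith
qed

section \<open>Traces of bilinear forms along the Rademacher functions\<close>

lemma rad_coeff_combination:
  "rad_coeff d (\<lambda>\<nu>. \<Sum>\<omega>\<in>I. r \<omega> *\<^sub>R g \<omega> \<nu>) k = (\<Sum>\<omega>\<in>I. r \<omega> *\<^sub>R rad_coeff d (g \<omega>) k)"
  by (simp add: rad_coeff_sum rad_coeff_scaleR)

lemma rad_form_combination:
  "rad_form d (\<lambda>\<nu>. \<Sum>\<omega>\<in>I. r \<omega> *\<^sub>R g \<omega> \<nu>) (\<lambda>\<nu>. \<Sum>\<omega>\<in>I. r \<omega> *\<^sub>R g \<omega> \<nu>)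
    = (\<Sum>\<omega>\<in>I. \<Sum>\<omega>'\<in>I. (r \<omega> * r \<omega>') *\<^sub>R rad_form d (g \<omega>) (g \<omega>'))"
proof -
  have "rad_form d (\<lambda>\<nu>. \<Sum>\<omega>\<in>I. r \<omega> *\<^sub>R g \<omega> \<nu>) (\<lambda>\<nu>. \<Sum>\<omega>\<in>I. r \<omega> *\<^sub>R g \<omega> \<nu>)
      = (\<Sum>k<d. \<Sum>\<omega>\<in>I. \<Sum>\<omega>'\<in>I. (r \<omega> * r \<omega>') *\<^sub>R (rad_coeff d (g \<omega>) k * rad_coeff d (g \<omega>') k))"
    by (simp add: rad_form_def rad_coeff_combination sum_product mult.commute)
  also have "\<dots> = (\<Sum>\<omega>\<in>I. \<Sum>k<d. \<Sum>\<omega>'\<in>I. (r \<omega> * r \<omega>') *\<^sub>R (rad_coeff d (g \<omega>) k * rad_coeff d (g \<omega>') k))"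
    by (rule sum.swap)
  also have "\<dots> = (\<Sum>\<omega>\<in>I. \<Sum>\<omega>'\<in>I. \<Sum>k<d. (r \<omega> * r \<omega>') *\<^sub>R (rad_coeff d (g \<omega>) k * rad_coeff d (g \<omega>') k))"
    by (intro sum.cong refl sum.swap)
  finally show ?thesis
    by (simp add: rad_form_def scaleR_sum_right)
qed

text \<open>The trace of the scalar product pulled back along a map into the span of the Rademacher functions:
there the scalar product is bounded, so the pull-back is a matrix with bounded entries.\<close>

lemma rademacher_trace_kernel_le:
  fixes g :: "nat \<Rightarrow> nat \<Rightarrow> 'k::real_or_complex"
  assumes ker: "\<And>\<omega> \<nu>. \<omega> < 2 ^ d \<Longrightarrow> \<nu> < 2 ^ e \<Longrightarrow> rad_proj e (g \<omega>) \<nu> = 0"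
    and L: "\<And>\<omega>. \<omega> < 2 ^ d \<Longrightarrow> (\<Sum>\<nu><2 ^ e. norm (g \<omega> \<nu>)) \<le> L"
  shows "norm (\<Sum>k<d. rad_form e (\<lambda>\<nu>. \<Sum>\<omega><2 ^ d. rademacher k \<omega> *\<^sub>R g \<omega> \<nu>)
      (\<lambda>\<nu>. \<Sum>\<omega><2 ^ d. rademacher k \<omega> *\<^sub>R g \<omega> \<nu>)) \<le> 4 * L\<^sup>2 * 4 ^ d * sqrt d"
  unfolding rad_form_combination
proof (rule rademacher_average_le)
  fix \<omega> \<omega>' :: nat assume w: "\<omega> < 2 ^ d" "\<omega>' < 2 ^ d"
  have "0 \<le> (\<Sum>\<nu><2 ^ e. norm (g \<omega> \<nu>))"
    by (rule sum_nonneg) simp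
  then have L0: "0 \<le> L"
    using L[OF w(1)] by linarith
  have "norm (rad_form e (g \<omega>) (g \<omega>')) \<le> 4 * (\<Sum>\<nu><2 ^ e. norm (g \<omega> \<nu>)) * (\<Sum>\<nu><2 ^ e. norm (g \<omega>' \<nu>))"
    using ker w by (intro norm_rad_form_le) auto
  also have "\<dots> \<le> 4 * L * L"
    using L[OF w(1)] L[OF w(2)] L0 by (intro mult_mono) (auto simp: sum_nonneg)
  finally show "norm (rad_form e (g \<omega>) (g \<omega>')) \<le> 4 * L\<^sup>2"
    by (simp add: power2_eq_square)
qed simp

text \<open>Here \<open>g\<close> is the identity plus a map \<open>w\<close> into the span of the Rademacher functions.  The identity
contributes \<open>d * 4 ^ d\<close>, the mixed terms form a multiple of the trace of \<open>w\<close>, which is of order \<open>\<surd>d\<close> by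
Khintchine's inequality, and the terms quadratic in \<open>w\<close> are covered by
\<open>rademacher_trace_kernel_le\<close>.\<close>

lemma rademacher_trace_main:
  fixes g :: "nat \<Rightarrow> nat \<Rightarrow> 'k::real_or_complex"
  assumes proj: "\<And>\<omega> \<nu>. \<omega> < 2 ^ d \<Longrightarrow> \<nu> < 2 ^ d \<Longrightarrow> rad_proj d (g \<omega>) \<nu> = rad_proj d (unit_seq \<omega>) \<nu>"
    and L: "\<And>\<omega>. \<omega> < 2 ^ d \<Longrightarrow> (\<Sum>\<nu><2 ^ d. norm (g \<omega> \<nu>)) \<le> L"
  shows "norm ((\<Sum>k<d. rad_form d (\<lambda>\<nu>. \<Sum>\<omega><2 ^ d. rademacher k \<omega> *\<^sub>R g \<omega> \<nu>)
      (\<lambda>\<nu>. \<Sum>\<omega><2 ^ d. rademacher k \<omega> *\<^sub>R g \<omega> \<nu>)) - of_real (d * 4 ^ d))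
    \<le> (4 * (L + 1) + 4 * (L + 1)\<^sup>2) * 4 ^ d * sqrt d"
proof -
  define w where "w \<omega> \<nu> = g \<omega> \<nu> - unit_seq \<omega> \<nu>" for \<omega> \<nu>
  have ker: "rad_proj d (w \<omega>) \<nu> = 0" if "\<omega> < 2 ^ d" "\<nu> < 2 ^ d" for \<omega> \<nu>
    using proj[OF that] rad_proj_add[of d "g \<omega>" "\<lambda>\<nu>. (- 1) * unit_seq \<omega> \<nu>" \<nu>]
    unfolding rad_proj_mult by (simp add: w_def[abs_def])
  have w_le: "(\<Sum>\<nu><2 ^ d. norm (w \<omega> \<nu>)) \<le> L + 1" if "\<omega> < 2 ^ d" for \<omega>
  proof -
    have "(\<Sum>\<nu><2 ^ d. norm (w \<omega> \<nu>)) \<le> (\<Sum>\<nu><2 ^ d. norm (g \<omega> \<nu>) + norm (unit_seq \<omega> \<nu> :: 'k))"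
      unfolding w_def by (intro sum_mono norm_triangle_ineq4)
    also have "(\<Sum>\<nu><2 ^ d. norm (unit_seq \<omega> \<nu> :: 'k)) = (\<Sum>\<nu><2 ^ d. if \<nu> = \<omega> then 1 else 0)"
      by (intro sum.cong) (auto simp: unit_seq_def)
    then have "(\<Sum>\<nu><2 ^ d. norm (g \<omega> \<nu>) + norm (unit_seq \<omega> \<nu> :: 'k)) \<le> L + 1"
      using L[OF that] that by (simp add: sum.distrib)
    finally show ?thesis .
  qed
  define u where "u k l = (\<Sum>\<omega><2 ^ d. rademacher k \<omega> *\<^sub>R rad_coeff d (w \<omega>) l)" for k l
  have coeff_unit: "rad_coeff d (unit_seq \<omega> :: nat \<Rightarrow> 'k) l = of_real (rademacher l \<omega>)" if "\<omega> < 2 ^ d" for \<omega> l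
  proof -
    have "rad_coeff d (unit_seq \<omega> :: nat \<Rightarrow> 'k) l = (\<Sum>\<nu><2 ^ d. if \<nu> = \<omega> then of_real (rademacher l \<nu>) else 0)"
      unfolding rad_coeff_def by (intro sum.cong) (auto simp: unit_seq_def scaleR_conv_of_real)
    then show ?thesis using that by simp
  qed
  have coeff: "rad_coeff d (\<lambda>\<nu>. \<Sum>\<omega><2 ^ d. rademacher k \<omega> *\<^sub>R g \<omega> \<nu>) l
      = (if k = l then 2 ^ d else 0) + u k l" if "k < d" "l < d" for k l
  proof -
    have "rad_coeff d (g \<omega>) l = of_real (rademacher l \<omega>) + rad_coeff d (w \<omega>) l" if "\<omega> < 2 ^ d" for \<omega>
      unfolding w_def using coeff_unit[OF that] by (simp add: rad_coeff_diff)
    then have "rad_coeff d (\<lambda>\<nu>. \<Sum>\<omega><2 ^ d. rademacher k \<omega> *\<^sub>R g \<omega> \<nu>) l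
        = of_real (\<Sum>\<omega><2 ^ d. rademacher k \<omega> * rademacher l \<omega>) + u k l"
      unfolding rad_coeff_combination u_def by (simp add: distrib_left sum.distrib scaleR_conv_of_real)
    then show ?thesis
      by (simp add: rademacher_orthogonal[OF that])
  qed
  have form: "rad_form d (\<lambda>\<nu>. \<Sum>\<omega><2 ^ d. rademacher k \<omega> *\<^sub>R g \<omega> \<nu>) (\<lambda>\<nu>. \<Sum>\<omega><2 ^ d. rademacher k \<omega> *\<^sub>R g \<omega> \<nu>)
      = 4 ^ d + 2 * 2 ^ d * u k k + rad_form d (\<lambda>\<nu>. \<Sum>\<omega><2 ^ d. rademacher k \<omega> *\<^sub>R w \<omega> \<nu>)
          (\<lambda>\<nu>. \<Sum>\<omega><2 ^ d. rademacher k \<omega> *\<^sub>R w \<omega> \<nu>)" if k: "k < d" for k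
  proof -
    have "rad_form d (\<lambda>\<nu>. \<Sum>\<omega><2 ^ d. rademacher k \<omega> *\<^sub>R g \<omega> \<nu>) (\<lambda>\<nu>. \<Sum>\<omega><2 ^ d. rademacher k \<omega> *\<^sub>R g \<omega> \<nu>)
        = (\<Sum>l<d. ((if k = l then 2 ^ d else 0) + u k l) * ((if k = l then 2 ^ d else 0) + u k l))"
      unfolding rad_form_def by (intro sum.cong) (simp_all add: coeff k)
    also have "\<dots> = (\<Sum>l<d. (if k = l then 4 ^ d + 2 * 2 ^ d * u k l else 0) + u k l * u k l)"
      by (intro sum.cong) (auto simp: algebra_simps simp flip: power_mult_distrib)
    also have "\<dots> = 4 ^ d + 2 * 2 ^ d * u k k + (\<Sum>l<d. u k l * u k l)"
      using k by (simp add: sum.distrib)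
    finally show ?thesis
      by (simp add: rad_form_def rad_coeff_combination u_def)
  qed
  have diag: "norm (\<Sum>k<d. u k k) \<le> 2 ^ d * (sqrt d * (2 * (L + 1)))"
  proof -
    have "(\<Sum>k<d. u k k) = (\<Sum>\<omega><2 ^ d. \<Sum>k<d. of_real (rademacher k \<omega>) * rad_coeff d (w \<omega>) k)"
      unfolding u_def scaleR_conv_of_real by (rule sum.swap)
    also have "norm \<dots> \<le> (\<Sum>\<omega><(2::nat) ^ d. sqrt d * (2 * (L + 1)))"
    proof (rule sum_norm_le)
      fix \<omega> :: nat assume "\<omega> \<in> {..<2 ^ d}"
      then have w: "\<omega> < 2 ^ d" by simp
      have "norm (\<Sum>k<d. of_real (rademacher k \<omega>) * rad_coeff d (w \<omega>) k)
          \<le> sqrt (\<Sum>k<d. (norm (of_real (rademacher k \<omega>) :: 'k))\<^sup>2) * sqrt (\<Sum>k<d. (norm (rad_coeff d (w \<omega>) k))\<^sup>2)"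
        by (rule norm_sum_mult_le_L2)
      also have "\<dots> \<le> sqrt d * (2 * (\<Sum>\<nu><2 ^ d. norm (w \<omega> \<nu>)))"
        using ker[OF w] by (intro mult_mono rad_coeff_L2_le) (auto simp: sum_nonneg)
      also have "\<dots> \<le> sqrt d * (2 * (L + 1))"
        using w_le[OF w] by (intro mult_left_mono) auto
      finally show "norm (\<Sum>k<d. of_real (rademacher k \<omega>) * rad_coeff d (w \<omega>) k) \<le> sqrt d * (2 * (L + 1))" .
    qed
    finally show ?thesis by simp
  qed
  define R where "R = (\<Sum>k<d. rad_form d (\<lambda>\<nu>. \<Sum>\<omega><2 ^ d. rademacher k \<omega> *\<^sub>R w \<omega> \<nu>)
          (\<lambda>\<nu>. \<Sum>\<omega><2 ^ d. rademacher k \<omega> *\<^sub>R w \<omega> \<nu>))"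
  have R: "norm R \<le> 4 * (L + 1)\<^sup>2 * 4 ^ d * sqrt d"
    unfolding R_def by (rule rademacher_trace_kernel_le) (use ker w_le in auto)
  have "(\<Sum>k<d. rad_form d (\<lambda>\<nu>. \<Sum>\<omega><2 ^ d. rademacher k \<omega> *\<^sub>R g \<omega> \<nu>)
      (\<lambda>\<nu>. \<Sum>\<omega><2 ^ d. rademacher k \<omega> *\<^sub>R g \<omega> \<nu>)) - of_real (d * 4 ^ d) = 2 * 2 ^ d * (\<Sum>k<d. u k k) + R"
    by (simp add: form R_def sum.distrib sum_distrib_left)
  also have "norm \<dots> \<le> 2 * 2 ^ d * norm (\<Sum>k<d. u k k) + norm R"
    by (rule norm_triangle_le) (simp add: norm_mult norm_power)
  also have "\<dots> \<le> 2 * 2 ^ d * (2 ^ d * (sqrt d * (2 * (L + 1)))) + 4 * (L + 1)\<^sup>2 * 4 ^ d * sqrt d"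
    using diag R by (intro add_mono mult_left_mono) auto
  also have "2 * 2 ^ d * (2 ^ d * (sqrt d * (2 * (L + 1)))) = 4 * (L + 1) * (2 ^ d * 2 ^ d) * sqrt d"
    by (simp add: algebra_simps)
  also have "(2::real) ^ d * 2 ^ d = 4 ^ d"
    by (simp flip: power_mult_distrib)
  finally show ?thesis
    by (simp add: algebra_simps)
qed

section \<open>Maps out of l1\<close>

lemma l1_iff: "x \<in> l1 \<longleftrightarrow> summable (\<lambda>n. norm (x n))"
  by (simp add: l1_def l1_sum_def)

lemma l1_norm_eq: "l1_norm x = (\<Sum>n. norm (x n))"
  by (simp add: l1_norm_def l1_sum_norm_def)

lemma subspace_l1: "module.subspace scale_fun (l1 :: (nat \<Rightarrow> 'k::real_normed_field) set)"
proof -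
  interpret vector_space "scale_fun :: 'k \<Rightarrow> (nat \<Rightarrow> 'k) \<Rightarrow> nat \<Rightarrow> 'k"
    by (rule vector_space_scale_fun)
  show ?thesis
  proof (rule subspaceI)
    show "x + y \<in> l1" if "x \<in> l1" "y \<in> l1" for x y :: "nat \<Rightarrow> 'k"
      unfolding l1_iff using summable_add[OF that[unfolded l1_iff]]
      by (rule summable_comparison_test') (simp add: norm_triangle_ineq)
    show "scale_fun c x \<in> l1" if "x \<in> l1" for c and x :: "nat \<Rightarrow> 'k"
      using summable_mult[OF that[unfolded l1_iff], of "norm c"]
      by (simp add: l1_iff pointwise_scale_def norm_mult)
  qed (simp add: l1_iff)
qed

lemma
  shows unit_seq_l1: "(unit_seq i :: nat \<Rightarrow> 'k::real_normed_field) \<in> l1"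
    and l1_norm_unit_seq: "l1_norm (unit_seq i :: nat \<Rightarrow> 'k) = 1"
proof -
  have "(\<lambda>n. norm (unit_seq i n :: 'k)) sums (\<Sum>n\<in>{i}. norm (unit_seq i n :: 'k))"
    by (rule sums_finite) (auto simp: unit_seq_def)
  then show "(unit_seq i :: nat \<Rightarrow> 'k) \<in> l1" "l1_norm (unit_seq i :: nat \<Rightarrow> 'k) = 1"
    unfolding l1_iff l1_norm_eq by (auto simp: sums_iff unit_seq_def)
qed

lemma l1_norm_nonneg: "x \<in> l1 \<Longrightarrow> 0 \<le> l1_norm x"
  unfolding l1_norm_eq l1_iff by (rule suminf_nonneg) auto

lemma linear_map_on_sum:
  assumes "vector_space s" "vector_space t" and V: "module.subspace s V"
    and T: "linear_map_on s t V T" and v: "\<And>i. i \<in> I \<Longrightarrow> v i \<in> V"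
  shows "T (\<Sum>i\<in>I. s (c i) (v i)) = (\<Sum>i\<in>I. t (c i) (T (v i)))"
proof -
  interpret S: vector_space s by fact
  interpret U: vector_space t by fact
  have T0: "T 0 = 0"
    using T S.subspace_0[OF V] unfolding linear_map_on_def
    by (metis S.scale_zero_left U.scale_zero_left)
  show ?thesis
    using v
  proof (induction I rule: infinite_finite_induct)
    case (insert i I)
    have "(\<Sum>i\<in>I. s (c i) (v i)) \<in> V" "s (c i) (v i) \<in> V"
      using insert.prems by (auto intro!: S.subspace_sum V S.subspace_scale)
    then show ?case
      using insert T by (simp add: linear_map_on_def)
  qed (simp_all add: T0)
qed

text \<open>The unit vectors span a dense subspace, so bounded functionals are determined by their values there.\<close>

lemma l1_functional_expansion:
  fixes F :: "(nat \<Rightarrow> 'k::real_normed_field) \<Rightarrow> 'k"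
  assumes F: "linear_map_on scale_fun (*) l1 F"
    and bound: "\<And>x. x \<in> l1 \<Longrightarrow> norm (F x) \<le> C * l1_norm x" and x: "x \<in> l1"
  shows "(\<lambda>i. x i * F (unit_seq i)) sums F x"
proof -
  interpret S: vector_space "scale_fun :: 'k \<Rightarrow> (nat \<Rightarrow> 'k) \<Rightarrow> nat \<Rightarrow> 'k"
    by (rule vector_space_scale_fun)
  have est: "norm (F x - (\<Sum>i<n. x i * F (unit_seq i))) \<le> C * (l1_norm x - (\<Sum>i<n. norm (x i)))" for n
  proof -
    define h where "h = (\<Sum>i<n. scale_fun (x i) (unit_seq i))"
    have h: "h \<in> l1"
      unfolding h_def by (intro S.subspace_sum S.subspace_scale subspace_l1 unit_seq_l1)
    have h_eq: "h = (\<lambda>i. if i < n then x i else 0)"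
      using unit_seq_expansion[of n "\<lambda>i. if i < n then x i else 0"] by (simp add: h_def)
    have xh: "x - h \<in> l1"
      by (intro S.subspace_diff subspace_l1 x h)
    have "(\<lambda>i. norm (x i)) sums l1_norm x"
      using x unfolding l1_iff l1_norm_eq by (rule summable_sums)
    moreover have "(\<lambda>i. if i < n then norm (x i) else 0) sums (\<Sum>i<n. norm (x i))"
      using sums_If_finite_set[of "{..<n}" "\<lambda>i. norm (x i)"] by simp
    ultimately have "(\<lambda>i. norm (x i) - (if i < n then norm (x i) else 0)) sums (l1_norm x - (\<Sum>i<n. norm (x i)))"
      by (rule sums_diff)
    moreover have "norm (x i) - (if i < n then norm (x i) else 0) = norm ((x - h) i)" for i
      by (simp add: h_eq)
    ultimately have tail: "l1_norm (x - h) = l1_norm x - (\<Sum>i<n. norm (x i))"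
      unfolding l1_norm_eq[of "x - h"] by (simp add: sums_iff)
    have "F ((x - h) + h) = F (x - h) + F h"
      using F xh h unfolding linear_map_on_def by blast
    moreover have "F h = (\<Sum>i<n. x i * F (unit_seq i))"
      unfolding h_def by (rule linear_map_on_sum[OF vector_space_scale_fun vector_space_mult subspace_l1 F unit_seq_l1])
    ultimately show ?thesis
      using bound[OF xh] tail by simp
  qed
  have "(\<lambda>n. C * (l1_norm x - (\<Sum>i<n. norm (x i)))) \<longlonglongrightarrow> C * (l1_norm x - l1_norm x)"
    using x unfolding l1_iff l1_norm_eq
    by (intro tendsto_intros summable_LIMSEQ)
  then have "(\<lambda>n. C * (l1_norm x - (\<Sum>i<n. norm (x i)))) \<longlonglongrightarrow> 0"
    by simp
  then have "(\<lambda>n. F x - (\<Sum>i<n. x i * F (unit_seq i))) \<longlonglongrightarrow> 0"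
    by (rule Lim_null_comparison[OF always_eventually, rotated]) (use est in blast)
  then have "(\<lambda>n. F x - (F x - (\<Sum>i<n. x i * F (unit_seq i)))) \<longlonglongrightarrow> F x - 0"
    by (intro tendsto_intros)
  then show ?thesis
    by (simp add: sums_def)
qed

text \<open>Projectivity of \<open>l1\<close>: the values of \<open>p\<close> at the unit vectors are lifted with uniformly bounded norm to
representatives in \<open>l1^N\<close>, and these are extended linearly.\<close>

lemma l1_lifting:
  fixes p :: "(nat \<Rightarrow> 'k::{real_normed_field, banach}) \<Rightarrow> nat \<Rightarrow> 'k"
  assumes p: "linear_map_on scale_fun scale_fun l1 p"
    and p_in: "\<And>x. x \<in> l1 \<Longrightarrow> p x \<in> rad_quot d"
    and p_le: "\<And>x. x \<in> l1 \<Longrightarrow> rad_quot_norm d (p x) \<le> C * l1_norm x"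
  obtains \<psi> where "linear_map_on scale_fun scale_fun l1 \<psi>"
    "\<And>x. x \<in> l1 \<Longrightarrow> (\<Sum>\<omega><2 ^ d. norm (\<psi> x \<omega>)) \<le> (C + 1) * l1_norm x"
    "\<And>x \<omega>. x \<in> l1 \<Longrightarrow> \<omega> < 2 ^ d \<Longrightarrow> rad_proj d (\<psi> x) \<omega> = p x \<omega>"
proof -
  have "\<exists>a. (\<Sum>\<omega><2 ^ d. norm (p (unit_seq i) \<omega> + rad_sum d a \<omega>)) \<le> C + 1" for i
  proof -
    obtain a where "(\<Sum>\<omega><2 ^ d. norm (p (unit_seq i) \<omega> + rad_sum d a \<omega>)) < rad_quot_norm d (p (unit_seq i)) + 1"
      using rad_quot_norm_attained[of 1] zero_less_one by metis
    then show ?thesis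
      using p_le[OF unit_seq_l1[of i]] by (intro exI[of _ a]) (simp add: l1_norm_unit_seq)
  qed
  then obtain a where a: "\<And>i. (\<Sum>\<omega><2 ^ d. norm (p (unit_seq i) \<omega> + rad_sum d (a i) \<omega>)) \<le> C + 1"
    by metis
  \<comment> \<open>Truncation keeps the coordinates beyond \<open>2 ^ d\<close>, which the estimates do not see, bounded.\<close>
  define f where "f i \<omega> = (if \<omega> < 2 ^ d then p (unit_seq i) \<omega> + rad_sum d (a i) \<omega> else 0)" for i \<omega>
  have f_sum: "(\<Sum>\<omega><2 ^ d. norm (f i \<omega>)) \<le> C + 1" for i
    using a[of i] by (simp add: f_def)
  have f_le: "norm (f i \<omega>) \<le> C + 1" for i \<omega>
  proof (cases "\<omega> < 2 ^ d")
    case True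
    then have "norm (f i \<omega>) \<le> (\<Sum>\<omega><2 ^ d. norm (f i \<omega>))"
      by (intro member_le_sum) auto
    then show ?thesis using f_sum[of i] by simp
  next
    case False
    then show ?thesis
      using order_trans[OF sum_nonneg f_sum[of i]] by (simp add: f_def)
  qed
  define \<psi> where "\<psi> x \<omega> = (\<Sum>i. x i * f i \<omega>)" for x \<omega>
  have abs_summable: "summable (\<lambda>i. norm (x i * f i \<omega>))" if "x \<in> l1" for x \<omega>
  proof (rule summable_comparison_test')
    show "summable (\<lambda>i. norm (x i) * (C + 1))"
      using that by (intro summable_mult2) (simp add: l1_iff)
    show "norm (norm (x i * f i \<omega>)) \<le> norm (x i) * (C + 1)" for i
      by (simp add: norm_mult mult_left_mono f_le)
  qed
  note summable = summable_norm_cancel[OF abs_summable]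
  have lin: "linear_map_on scale_fun scale_fun l1 \<psi>"
    unfolding linear_map_on_def
  proof (intro conjI ballI allI ext)
    fix x y c \<omega> assume x: "x \<in> (l1 :: (nat \<Rightarrow> 'k) set)"
    show "\<psi> (x + y) \<omega> = (\<psi> x + \<psi> y) \<omega>" if "y \<in> l1"
      by (simp add: \<psi>_def distrib_right suminf_add[OF summable[OF x] summable[OF that]])
    show "\<psi> (scale_fun c x) \<omega> = scale_fun c (\<psi> x) \<omega>"
      using suminf_mult[OF summable[OF x], of c \<omega>] by (simp add: \<psi>_def pointwise_scale_def mult.assoc)
  qed
  have \<psi>_le: "(\<Sum>\<omega><2 ^ d. norm (\<psi> x \<omega>)) \<le> (C + 1) * l1_norm x" if x: "x \<in> l1" for x
  proof -
    have "(\<Sum>\<omega><2 ^ d. norm (\<psi> x \<omega>)) \<le> (\<Sum>\<omega><2 ^ d. \<Sum>i. norm (x i * f i \<omega>))"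
      unfolding \<psi>_def by (intro sum_mono summable_norm abs_summable x)
    also have "\<dots> = (\<Sum>i. \<Sum>\<omega><2 ^ d. norm (x i * f i \<omega>))"
      by (rule suminf_sum[symmetric]) (rule abs_summable[OF x])
    also have "\<dots> \<le> (\<Sum>i. (C + 1) * norm (x i))"
    proof (rule suminf_le)
      show "(\<Sum>\<omega><2 ^ d. norm (x i * f i \<omega>)) \<le> (C + 1) * norm (x i)" for i
        using mult_left_mono[OF f_sum[of i], of "norm (x i)"]
        by (simp add: norm_mult sum_distrib_left[symmetric] mult.commute)
      show "summable (\<lambda>i. \<Sum>\<omega><2 ^ d. norm (x i * f i \<omega>))"
        by (intro summable_sum abs_summable x)
      show "summable (\<lambda>i. (C + 1) * norm (x i))"
        using x by (intro summable_mult) (simp add: l1_iff)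
    qed
    also have "\<dots> = (C + 1) * l1_norm x"
      using x unfolding l1_norm_eq l1_iff by (rule suminf_mult)
    finally show ?thesis .
  qed
  have \<psi>_unit: "\<psi> (unit_seq i) = f i" for i
  proof
    fix \<omega>
    have "(\<lambda>j. unit_seq i j * f j \<omega>) sums (\<Sum>j\<in>{i}. unit_seq i j * f j \<omega>)"
      by (rule sums_finite) (auto simp: unit_seq_def)
    then show "\<psi> (unit_seq i) \<omega> = f i \<omega>"
      by (simp add: \<psi>_def sums_iff unit_seq_def)
  qed
  have proj: "rad_proj d (\<psi> x) \<omega> = p x \<omega>" if x: "x \<in> l1" and w: "\<omega> < 2 ^ d" for x \<omega>
  proof (rule sums_unique2)
    show "(\<lambda>i. x i * rad_proj d (\<psi> (unit_seq i)) \<omega>) sums rad_proj d (\<psi> x) \<omega>"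
    proof (rule l1_functional_expansion[OF _ _ x, where F = "\<lambda>x. rad_proj d (\<psi> x) \<omega>"])
      show "linear_map_on scale_fun (*) l1 (\<lambda>x. rad_proj d (\<psi> x) \<omega>)"
        using lin by (auto simp: linear_map_on_def pointwise_scale_def plus_fun_def rad_proj_add rad_proj_mult)
      fix x :: "nat \<Rightarrow> 'k" assume x: "x \<in> l1"
      have "norm (rad_proj d (\<psi> x) \<omega>) \<le> (1 + real d) * (\<Sum>\<omega><2 ^ d. norm (\<psi> x \<omega>))"
        by (rule norm_rad_proj_le[OF w])
      also have "\<dots> \<le> (1 + real d) * ((C + 1) * l1_norm x)"
        by (intro mult_left_mono \<psi>_le x) simp
      finally show "norm (rad_proj d (\<psi> x) \<omega>) \<le> ((1 + real d) * (C + 1)) * l1_norm x"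
        by (simp add: mult.assoc)
    qed
    have "rad_proj d (\<psi> (unit_seq i)) \<omega> = p (unit_seq i) \<omega>" for i
    proof -
      have "rad_proj d (\<psi> (unit_seq i)) \<omega> = rad_proj d (\<lambda>\<omega>. p (unit_seq i) \<omega> + rad_sum d (a i) \<omega>) \<omega>"
        unfolding \<psi>_unit using w by (simp add: rad_proj_def f_def rad_sum_def rad_coeff_def)
      then show ?thesis
        using p_in[OF unit_seq_l1] by (simp add: rad_proj_add rad_proj_rad_sum rad_proj_rad_quot)
    qed
    moreover have "(\<lambda>i. x i * p (unit_seq i) \<omega>) sums p x \<omega>"
    proof (rule l1_functional_expansion[OF _ _ x, where F = "\<lambda>x. p x \<omega>"])
      show "linear_map_on scale_fun (*) l1 (\<lambda>x. p x \<omega>)"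
        using p by (auto simp: linear_map_on_def pointwise_scale_def plus_fun_def)
      fix x :: "nat \<Rightarrow> 'k" assume x: "x \<in> l1"
      have "norm (p x \<omega>) \<le> (1 + real d) * rad_quot_norm d (p x)"
        by (rule norm_le_rad_quot_norm[OF p_in[OF x]])
      also have "\<dots> \<le> (1 + real d) * (C * l1_norm x)"
        by (intro mult_left_mono p_le x) simp
      finally show "norm (p x \<omega>) \<le> ((1 + real d) * C) * l1_norm x"
        by (simp add: mult.assoc)
    qed
    ultimately show "(\<lambda>i. x i * rad_proj d (\<psi> (unit_seq i)) \<omega>) sums p x \<omega>"
      by simp
  qed
  show ?thesis
    using lin \<psi>_le proj by (rule that)
qed

section \<open>A bilinear form that does not extend\<close>

lemma norm_suminf_diff_term_le:
  fixes t :: "nat \<Rightarrow> 'k::{real_normed_field, banach}"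
  assumes t: "summable (\<lambda>j. (1 / 2 ^ j) *\<^sub>R t j)" and Q: "\<And>j. j \<noteq> m \<Longrightarrow> norm (t j) \<le> Q" "0 \<le> Q"
  shows "norm ((\<Sum>j. (1 / 2 ^ j) *\<^sub>R t j) - (1 / 2 ^ m) *\<^sub>R t m) \<le> 2 * Q"
proof -
  define g where "g j = (1 / 2 ^ j) *\<^sub>R t j - (if j = m then (1 / 2 ^ j) *\<^sub>R t j else 0)" for j
  have single: "(\<lambda>j. if j = m then (1 / 2 ^ j) *\<^sub>R t j else 0) sums ((1 / 2 ^ m) *\<^sub>R t m)"
    using sums_If_finite_set[of "{m}" "\<lambda>j. (1 / 2 ^ j) *\<^sub>R t j"] by simp
  have g: "g sums ((\<Sum>j. (1 / 2 ^ j) *\<^sub>R t j) - (1 / 2 ^ m) *\<^sub>R t m)"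
    unfolding g_def by (intro sums_diff summable_sums t single)
  have geo: "(\<lambda>j. (1 / 2) ^ j * Q) sums (2 * Q)"
    using sums_mult2[OF geometric_sums[of "1 / 2 :: real"], of Q] by simp
  have le: "norm (g j) \<le> (1 / 2) ^ j * Q" for j
    using Q by (cases "j = m") (auto simp: g_def power_one_over divide_right_mono)
  have "norm (suminf g) \<le> suminf (\<lambda>j. (1 / 2) ^ j * Q)"
    by (rule norm_suminf_le[OF le]) (use geo in \<open>simp add: sums_iff\<close>)
  then show ?thesis
    using g geo by (simp add: sums_iff)
qed

text \<open>The maps \<open>p m\<close> are the components of the quotient map, identified with the concrete quotients for
\<open>d = 16 ^ m\<close>, and \<open>Y m\<close> lists the images of the unit vectors under a lifting of the \<open>m\<close>-th quotient
map that vanishes in all other components.  The weights \<open>2^-m\<close> make the form converge, while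
\<open>\<surd>d = 4 ^ m\<close> outgrows their inverses.\<close>

lemma nonextendable_bilinear_form_on_l1_subset:
  fixes A :: "(nat \<Rightarrow> 'k::real_or_complex) set" and p :: "nat \<Rightarrow> (nat \<Rightarrow> 'k) \<Rightarrow> nat \<Rightarrow> 'k"
  assumes A: "A \<subseteq> l1" and C: "0 \<le> C"
    and p_lin: "\<And>m. linear_map_on scale_fun scale_fun l1 (p m)"
    and p_in: "\<And>m x. x \<in> l1 \<Longrightarrow> p m x \<in> rad_quot (16 ^ m)"
    and p_le: "\<And>m x. x \<in> l1 \<Longrightarrow> rad_quot_norm (16 ^ m) (p m x) \<le> C * l1_norm x"
    and p_A: "\<And>m x. x \<in> A \<Longrightarrow> p m x = 0"
    and Y_l1: "\<And>m \<omega>. Y m \<omega> \<in> l1" and Y_le: "\<And>m \<omega>. l1_norm (Y m \<omega>) \<le> C"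
    and p_Y: "\<And>m \<omega>. p m (Y m \<omega>) = rad_quot_map (16 ^ m) (unit_seq \<omega>)"
    and p_Y_off: "\<And>m j \<omega>. j \<noteq> m \<Longrightarrow> p j (Y m \<omega>) = 0"
    and Y_A: "\<And>m k. k < 16 ^ m \<Longrightarrow>
        (\<Sum>\<omega><2 ^ (16 ^ m). scale_fun (of_real (rademacher k \<omega>)) (Y m \<omega>)) \<in> A"
  shows "\<exists>B. continuous_bilinear_form_on scale_fun A l1_norm B \<and>
           \<not> (\<exists>B'. continuous_bilinear_form_on scale_fun l1 l1_norm B' \<and> (\<forall>x\<in>A. \<forall>y\<in>A. B' x y = B x y))"
proof -
  define d :: "nat \<Rightarrow> nat" where "d m = 16 ^ m" for m
  have "\<exists>\<psi>. linear_map_on scale_fun scale_fun l1 \<psi> \<and>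
      (\<forall>x\<in>l1. (\<Sum>\<omega><2 ^ d m. norm (\<psi> x \<omega>)) \<le> (C + 1) * l1_norm x) \<and>
      (\<forall>x\<in>l1. \<forall>\<omega><2 ^ d m. rad_proj (d m) (\<psi> x) \<omega> = p m x \<omega>)" for m
    unfolding d_def by (rule l1_lifting[OF p_lin[of m] p_in p_le]) blast+
  then obtain \<psi> where \<psi>_lin: "\<And>m. linear_map_on scale_fun scale_fun l1 (\<psi> m)"
    and \<psi>_le: "\<And>m x. x \<in> l1 \<Longrightarrow> (\<Sum>\<omega><2 ^ d m. norm (\<psi> m x \<omega>)) \<le> (C + 1) * l1_norm x"
    and \<psi>_proj: "\<And>m x \<omega>. x \<in> l1 \<Longrightarrow> \<omega> < 2 ^ d m \<Longrightarrow> rad_proj (d m) (\<psi> m x) \<omega> = p m x \<omega>"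
    by metis
  define b where "b m x y = rad_form (d m) (\<psi> m x) (\<psi> m y)" for m x y
  have b_le: "norm (b m x y) \<le> 4 * (C + 1)\<^sup>2 * l1_norm x * l1_norm y" if x: "x \<in> A" and y: "y \<in> A" for m x y
  proof -
    have l1: "x \<in> l1" "y \<in> l1" using A x y by auto
    have "norm (b m x y) \<le> 4 * (\<Sum>\<omega><2 ^ d m. norm (\<psi> m x \<omega>)) * (\<Sum>\<omega><2 ^ d m. norm (\<psi> m y \<omega>))"
      unfolding b_def using \<psi>_proj l1 p_A x y by (intro norm_rad_form_le) auto
    also have "\<dots> \<le> 4 * ((C + 1) * l1_norm x) * ((C + 1) * l1_norm y)"
      using \<psi>_le l1 C l1_norm_nonneg[OF l1(1)] l1_norm_nonneg[OF l1(2)]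
      by (intro mult_mono) (auto simp: sum_nonneg)
    finally show ?thesis by (simp add: power2_eq_square mult_ac)
  qed
  define B where "B x y = (\<Sum>m. (1 / 2 ^ m) *\<^sub>R b m x y)" for x y
  have geo: "summable (\<lambda>m. (1 / 2) ^ m * K)" "(\<Sum>m. (1 / 2) ^ m * K) = 2 * K" for K :: real
    using sums_mult2[OF geometric_sums[of "1 / 2 :: real"], of K] by (simp_all add: sums_iff)
  have term_le: "norm ((1 / 2 ^ m) *\<^sub>R b m x y) \<le> (1 / 2) ^ m * (4 * (C + 1)\<^sup>2 * l1_norm x * l1_norm y)"
    if "x \<in> A" "y \<in> A" for m x y
    using b_le[OF that, of m] by (simp add: power_one_over divide_right_mono)
  have B_summable: "summable (\<lambda>m. (1 / 2 ^ m) *\<^sub>R b m x y)" if "x \<in> A" "y \<in> A" for x y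
    by (rule summable_comparison_test'[OF geo(1) term_le[OF that]])
  have B_le: "norm (B x y) \<le> 8 * (C + 1)\<^sup>2 * l1_norm x * l1_norm y" if "x \<in> A" "y \<in> A" for x y
    using norm_suminf_le[OF term_le[OF that] geo(1)] unfolding geo(2) B_def by simp
  have b_add1: "b m (x + x') y = b m x y + b m x' y" if "x \<in> l1" "x' \<in> l1" for m x x' y
    using \<psi>_lin[of m] that
    by (simp add: b_def rad_form_def linear_map_on_def plus_fun_def rad_coeff_add distrib_right sum.distrib)
  have b_add2: "b m y (x + x') = b m y x + b m y x'" if "x \<in> l1" "x' \<in> l1" for m x x' y
    using \<psi>_lin[of m] that
    by (simp add: b_def rad_form_def linear_map_on_def plus_fun_def rad_coeff_add distrib_left sum.distrib)
  have b_scale1: "b m (scale_fun c x) y = c * b m x y" if "x \<in> l1" for m x y c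
    using \<psi>_lin[of m] that
    by (simp add: b_def rad_form_def linear_map_on_def pointwise_scale_def rad_coeff_mult mult.assoc sum_distrib_left)
  have b_scale2: "b m y (scale_fun c x) = c * b m y x" if "x \<in> l1" for m x y c
    using \<psi>_lin[of m] that
    by (simp add: b_def rad_form_def linear_map_on_def pointwise_scale_def rad_coeff_mult mult.left_commute sum_distrib_left)
  have B_cont: "continuous_bilinear_form_on scale_fun A l1_norm B"
    unfolding continuous_bilinear_form_on_def linear_map_on_def
  proof (intro conjI ballI allI)
    fix x y assume xy: "x \<in> A" "y \<in> A"
    then have l1: "x \<in> l1" "y \<in> l1" using A by auto
    fix z assume z: "z \<in> A"
    show "B (x + y) z = B x z + B y z"
      using suminf_add[OF B_summable[OF xy(1) z] B_summable[OF xy(2) z]]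
      by (simp add: B_def b_add1[OF l1] scaleR_add_right)
    show "B z (x + y) = B z x + B z y"
      using suminf_add[OF B_summable[OF z xy(1)] B_summable[OF z xy(2)]]
      by (simp add: B_def b_add2[OF l1] scaleR_add_right)
  next
    fix x z c assume xz: "x \<in> A" "z \<in> A"
    then have l1: "x \<in> l1" using A by auto
    show "B (scale_fun c x) z = c * B x z"
      using suminf_mult[OF B_summable[OF xz], of c] by (simp add: B_def b_scale1[OF l1])
    show "B z (scale_fun c x) = c * B z x"
      using suminf_mult[OF B_summable[OF xz(2,1)], of c] by (simp add: B_def b_scale2[OF l1])
  next
    show "\<exists>C. \<forall>x\<in>A. \<forall>y\<in>A. norm (B x y) \<le> C * l1_norm x * l1_norm y"
      using B_le by blast
  qed
  have False
    if B': "continuous_bilinear_form_on scale_fun l1 l1_norm B'" "\<forall>x\<in>A. \<forall>y\<in>A. B' x y = B x y" for B'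
  proof -
    interpret S: vector_space "scale_fun :: 'k \<Rightarrow> (nat \<Rightarrow> 'k) \<Rightarrow> nat \<Rightarrow> 'k"
      by (rule vector_space_scale_fun)
    obtain D' where D': "\<And>x y. x \<in> l1 \<Longrightarrow> y \<in> l1 \<Longrightarrow> norm (B' x y) \<le> D' * l1_norm x * l1_norm y"
      using B'(1) unfolding continuous_bilinear_form_on_def by blast
    define D where "D = \<bar>D'\<bar> * C * C"
    define L where "L = (C + 1) * C"
    define G where "G = D + 8 * L\<^sup>2 + 4 * (L + 1) + 4 * (L + 1)\<^sup>2"
    have L: "0 \<le> L" using C by (simp add: L_def)
    have bounded: "2 ^ m \<le> G" for m
    proof -
      define N :: nat where "N = 2 ^ d m"
      define Z where "Z k = (\<Sum>\<omega><N. scale_fun (of_real (rademacher k \<omega>)) (Y m \<omega>))" for k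
      have Z_A: "Z k \<in> A" if "k < d m" for k
        using Y_A[of k m] that by (simp add: Z_def N_def d_def)
      have Z_l1: "Z k \<in> l1" for k
        unfolding Z_def by (intro S.subspace_sum S.subspace_scale subspace_l1 Y_l1)
      have \<psi>_Z: "\<psi> j (Z k) = (\<lambda>\<nu>. \<Sum>\<omega><2 ^ d m. rademacher k \<omega> *\<^sub>R \<psi> j (Y m \<omega>) \<nu>)" for j k
      proof
        fix \<nu>
        have "\<psi> j (Z k) = (\<Sum>\<omega><N. scale_fun (of_real (rademacher k \<omega>)) (\<psi> j (Y m \<omega>)))"
          unfolding Z_def
          by (rule linear_map_on_sum[OF vector_space_scale_fun vector_space_scale_fun subspace_l1 \<psi>_lin Y_l1])
        then show "\<psi> j (Z k) \<nu> = (\<Sum>\<omega><2 ^ d m. rademacher k \<omega> *\<^sub>R \<psi> j (Y m \<omega>) \<nu>)"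
          by (simp add: sum_function_apply pointwise_scale_def scaleR_conv_of_real N_def)
      qed
      have \<psi>_Y: "(\<Sum>\<nu><2 ^ d j. norm (\<psi> j (Y m \<omega>) \<nu>)) \<le> L" for j \<omega>
      proof -
        have "(\<Sum>\<nu><2 ^ d j. norm (\<psi> j (Y m \<omega>) \<nu>)) \<le> (C + 1) * l1_norm (Y m \<omega>)"
          by (rule \<psi>_le[OF Y_l1])
        also have "\<dots> \<le> L"
          unfolding L_def using C Y_le by (intro mult_left_mono) auto
        finally show ?thesis .
      qed
      \<comment> \<open>The trace of the \<open>j\<close>-th summand along the lifted Rademacher functions \<open>Z k\<close>.\<close>
      define T where "T j = (\<Sum>k<d m. b j (Z k) (Z k))" for j
      have T_off: "norm (T j) \<le> 4 * L\<^sup>2 * 4 ^ d m * sqrt (d m)" if j: "j \<noteq> m" for j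
        unfolding T_def b_def \<psi>_Z
        by (rule rademacher_trace_kernel_le) (simp_all add: \<psi>_Y \<psi>_proj[OF Y_l1] p_Y_off[OF j])
      have T_main: "norm (T m - of_real (d m * 4 ^ d m)) \<le> (4 * (L + 1) + 4 * (L + 1)\<^sup>2) * 4 ^ d m * sqrt (d m)"
        unfolding T_def b_def \<psi>_Z
        by (rule rademacher_trace_main)
          (simp_all add: \<psi>_Y \<psi>_proj[OF Y_l1] p_Y d_def[symmetric] rad_quot_map_def)
      have B'_Z: "B' (Z k) (Z k) = (\<Sum>\<omega><2 ^ d m. \<Sum>\<omega>'<2 ^ d m. (rademacher k \<omega> * rademacher k \<omega>') *\<^sub>R B' (Y m \<omega>) (Y m \<omega>'))" for k
      proof -
        have "B' (Z k) (Z k) = (\<Sum>\<omega><N. of_real (rademacher k \<omega>) * B' (Y m \<omega>) (Z k))"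
          using B'(1) Z_l1[of k] unfolding continuous_bilinear_form_on_def Z_def
          by (intro linear_map_on_sum[OF vector_space_scale_fun vector_space_mult subspace_l1, where T = "\<lambda>x. B' x z" for z] Y_l1) blast
        also have "\<dots> = (\<Sum>\<omega><N. of_real (rademacher k \<omega>) * (\<Sum>\<omega>'<N. of_real (rademacher k \<omega>') * B' (Y m \<omega>) (Y m \<omega>')))"
        proof (intro sum.cong refl arg_cong2[where f = "(*)"])
          fix \<omega>
          show "B' (Y m \<omega>) (Z k) = (\<Sum>\<omega>'<N. of_real (rademacher k \<omega>') * B' (Y m \<omega>) (Y m \<omega>'))"
            unfolding Z_def using B'(1) Y_l1[of m \<omega>] unfolding continuous_bilinear_form_on_def
            by (intro linear_map_on_sum[OF vector_space_scale_fun vector_space_mult subspace_l1] Y_l1) blast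
        qed
        finally show ?thesis
          by (simp add: N_def sum_distrib_left scaleR_conv_of_real mult.assoc)
      qed
      have B'_le: "norm (\<Sum>k<d m. B' (Z k) (Z k)) \<le> D * 4 ^ d m * sqrt (d m)"
        unfolding B'_Z
      proof (rule rademacher_average_le)
        fix \<omega> \<omega>'
        have "norm (B' (Y m \<omega>) (Y m \<omega>')) \<le> D' * l1_norm (Y m \<omega>) * l1_norm (Y m \<omega>')"
          by (intro D' Y_l1)
        also have "\<dots> \<le> \<bar>D'\<bar> * C * C"
          using Y_le l1_norm_nonneg[OF Y_l1] C by (intro mult_mono) auto
        finally show "norm (B' (Y m \<omega>) (Y m \<omega>')) \<le> D"
          by (simp add: D_def)
      qed (simp add: D_def C)
      have "(\<Sum>k<d m. B' (Z k) (Z k)) = (\<Sum>k<d m. \<Sum>j. (1 / 2 ^ j) *\<^sub>R b j (Z k) (Z k))"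
        using B'(2) Z_A by (simp add: B_def)
      also have "\<dots> = (\<Sum>j. \<Sum>k<d m. (1 / 2 ^ j) *\<^sub>R b j (Z k) (Z k))"
        by (rule suminf_sum[symmetric]) (use B_summable Z_A in auto)
      finally have B'_T: "(\<Sum>k<d m. B' (Z k) (Z k)) = (\<Sum>j. (1 / 2 ^ j) *\<^sub>R T j)"
        by (simp add: T_def scaleR_sum_right)
      have T_summable: "summable (\<lambda>j. (1 / 2 ^ j) *\<^sub>R T j)"
        unfolding T_def scaleR_sum_right by (rule summable_sum) (use B_summable Z_A in auto)
      \<comment> \<open>The common order of magnitude of all contributions except the leading term of \<open>T m\<close>.\<close>
      define W where "W = 4 ^ d m * sqrt (d m)"
      have W: "0 < W" by (simp add: W_def d_def)
      have diff: "norm ((\<Sum>j. (1 / 2 ^ j) *\<^sub>R T j) - (1 / 2 ^ m) *\<^sub>R T m) \<le> 2 * (4 * L\<^sup>2 * W)"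
        using norm_suminf_diff_term_le[OF T_summable, of m "4 * L\<^sup>2 * W"] T_off W
        by (simp add: W_def mult.assoc)
      have "norm ((1 / 2 ^ m) *\<^sub>R T m) \<le> norm (\<Sum>j. (1 / 2 ^ j) *\<^sub>R T j)
          + norm ((\<Sum>j. (1 / 2 ^ j) *\<^sub>R T j) - (1 / 2 ^ m) *\<^sub>R T m)"
        by (subst norm_minus_commute) (rule norm_triangle_sub)
      also have "\<dots> \<le> D * W + 2 * (4 * L\<^sup>2 * W)"
        using B'_le B'_T diff by (simp add: W_def mult.assoc)
      finally have up: "norm (T m) / 2 ^ m \<le> (D + 8 * L\<^sup>2) * W"
        by (simp add: algebra_simps)
      have "real (d m * 4 ^ d m) \<le> norm (T m) + (4 * (L + 1) + 4 * (L + 1)\<^sup>2) * W"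
        using norm_triangle_ineq2[of "of_real (d m * 4 ^ d m)" "T m"] T_main
        by (simp add: norm_minus_commute norm_mult norm_power W_def mult.assoc)
      then have "real (d m * 4 ^ d m) / 2 ^ m \<le> norm (T m) / 2 ^ m + (4 * (L + 1) + 4 * (L + 1)\<^sup>2) * W / 2 ^ m"
        by (simp add: divide_right_mono add_divide_distrib[symmetric])
      also have "(4 * (L + 1) + 4 * (L + 1)\<^sup>2) * W / 2 ^ m \<le> (4 * (L + 1) + 4 * (L + 1)\<^sup>2) * W"
        using W L mult_left_mono[of 1 "2 ^ m" "(4 * (L + 1) + 4 * (L + 1)\<^sup>2) * W"]
        by (simp add: divide_le_eq)
      finally have "real (d m * 4 ^ d m) / 2 ^ m \<le> G * W"
        using up by (simp add: G_def algebra_simps)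
      moreover have "real (d m * 4 ^ d m) / 2 ^ m = 2 ^ m * W"
      proof -
        have s: "sqrt (real (d m)) = 4 ^ m"
          by (rule real_sqrt_unique) (simp_all add: d_def power_mult_distrib[symmetric] power2_eq_square)
        have "real (d m) = 4 ^ m * 4 ^ m"
          by (simp add: d_def flip: power_mult_distrib)
        moreover have "(4::real) ^ m = 2 ^ m * 2 ^ m"
          by (simp flip: power_mult_distrib)
        ultimately show ?thesis
          unfolding W_def s by simp
      qed
      ultimately show ?thesis
        using W by simp
    qed
    obtain m where "G < 2 ^ m"
      using real_arch_pow[of 2 G] by auto
    then show False
      using bounded[of m] by simp
  qed
  with B_cont show ?thesis by blast
qed

section \<open>The quotient map onto the dual\<close>

lemma normed_space_on_subspace_c0:
  assumes "module.subspace scale_fun (H :: (nat \<Rightarrow> 'k::real_normed_field) set)" "H \<subseteq> c0"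
  shows "normed_space_on scale_fun H c0_norm"
proof -
  interpret vector_space "scale_fun :: 'k \<Rightarrow> (nat \<Rightarrow> 'k) \<Rightarrow> nat \<Rightarrow> 'k"
    by (rule vector_space_scale_fun)
  show ?thesis
  proof
    fix x :: "nat \<Rightarrow> 'k" assume x: "x \<in> H"
    then have x0: "x \<in> c0" using assms(2) by blast
    show "0 \<le> c0_norm x" by (rule c0_norm_nonneg[OF x0])
    show "x = 0" if "c0_norm x = 0"
      using norm_le_c0_norm[OF x0] that by (simp add: fun_eq_iff)
    show "c0_norm (x + y) \<le> c0_norm x + c0_norm y" if "y \<in> H" for y
      using that x0 assms(2) by (intro c0_norm_triangle) auto
    show "c0_norm (scale_fun c x) = norm c * c0_norm x" for c
      by (rule c0_norm_scale[OF x0])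
  qed (rule assms(1))
qed

text \<open>Restricting the pairing with \<open>x\<close> to \<open>H\<close> is a bounded map of \<open>l1\<close> onto the dual of \<open>H\<close>, by the
representation of functionals; its kernel is the annihilator.\<close>

lemma annihilator_quotient_map:
  fixes H :: "(nat \<Rightarrow> 'k::real_or_complex) set" and t :: "'k \<Rightarrow> 'w::ab_group_add \<Rightarrow> 'w"
  assumes H: "module.subspace scale_fun H" "H \<subseteq> c0"
    and t: "vector_space t" and M: "\<And>w. w \<in> W \<Longrightarrow> 0 \<le> M w"
    and iso: "banach_iso scale_fun (dual_space scale_fun H c0_norm) (dual_norm H c0_norm) t W M T"
  obtains q C where "0 \<le> C" "linear_map_on scale_fun t l1 q"
    "\<And>x. x \<in> l1 \<Longrightarrow> q x \<in> W" "\<And>x. x \<in> l1 \<Longrightarrow> M (q x) \<le> C * l1_norm x"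
    "\<And>w. w \<in> W \<Longrightarrow> \<exists>x\<in>l1. q x = w \<and> l1_norm x \<le> C * M w"
    "\<And>x. x \<in> l1 \<Longrightarrow> q x = 0 \<longleftrightarrow> x \<in> annihilator H"
proof -
  interpret U: vector_space t by fact
  interpret H: normed_space_on scale_fun H c0_norm
    by (rule normed_space_on_subspace_c0[OF H])
  interpret vs: vector_space "(*) :: 'k \<Rightarrow> 'k \<Rightarrow> 'k" by (rule vector_space_mult)
  have field: "normed_space_on ((*) :: 'k \<Rightarrow> 'k \<Rightarrow> 'k) UNIV norm"
    by unfold_locales (simp_all add: norm_triangle_ineq norm_mult)
  define \<Phi> where "\<Phi> = dual_space scale_fun H (c0_norm :: (nat \<Rightarrow> 'k) \<Rightarrow> real)"
  define R where "R x = (\<lambda>h. if h \<in> H then \<Sum>n. x n * h n else 0)" for x :: "nat \<Rightarrow> 'k"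
  have abs: "summable (\<lambda>n. norm (x n * h n))" "(\<Sum>n. norm (x n * h n)) \<le> l1_norm x * c0_norm h"
    if x: "x \<in> l1" and h: "h \<in> H" for x h
  proof -
    have le: "norm (x n * h n) \<le> norm (x n) * c0_norm h" for n
      using norm_le_c0_norm[of h n] h H(2) by (auto simp: norm_mult intro!: mult_left_mono)
    have s: "(\<lambda>n. norm (x n) * c0_norm h) sums (l1_norm x * c0_norm h)"
      using x unfolding l1_iff l1_norm_eq by (intro sums_mult2 summable_sums)
    show sm: "summable (\<lambda>n. norm (x n * h n))"
      by (rule summable_comparison_test'[OF sums_summable[OF s]]) (simp add: le)
    show "(\<Sum>n. norm (x n * h n)) \<le> l1_norm x * c0_norm h"
      using suminf_le[OF le sm sums_summable[OF s]] sums_unique[OF s] by simp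
  qed
  note summable = summable_norm_cancel[OF abs(1)]
  have R_le: "norm (R x h) \<le> l1_norm x * c0_norm h" if "x \<in> l1" "h \<in> H" for x h
    using order_trans[OF summable_norm[OF abs(1)[OF that]] abs(2)[OF that]] that by (simp add: R_def)
  have R_dual: "R x \<in> \<Phi>" if x: "x \<in> l1" for x
  proof -
    have "linear_map_on scale_fun (*) H (R x)"
      unfolding linear_map_on_def
    proof (intro conjI ballI allI)
      fix h c assume h: "h \<in> H"
      show "R x (h + h') = R x h + R x h'" if "h' \<in> H" for h'
        using suminf_add[OF summable[OF x h] summable[OF x that]] h that H.subspace_add[OF H(1)]
        by (simp add: R_def distrib_left)
      show "R x (scale_fun c h) = c * R x h"
        using suminf_mult[OF summable[OF x h], of c] h H.subspace_scale[OF H(1) h]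
        by (simp add: R_def pointwise_scale_def mult.left_commute)
    qed
    moreover have "bounded_map_on H c0_norm norm (R x)"
      using R_le[OF x] unfolding bounded_map_on_def by blast
    ultimately show ?thesis
      by (simp add: \<Phi>_def dual_space_def R_def)
  qed
  have R_add: "R (x + y) = R x + R y" if "x \<in> l1" "y \<in> l1" for x y
    using suminf_add[OF summable[OF that(1)] summable[OF that(2)]]
    by (auto simp: R_def fun_eq_iff distrib_right)
  have R_scale: "R (scale_fun c x) = scale_fun c (R x)" if "x \<in> l1" for c x
    using suminf_mult[OF summable[OF that], of _ c]
    by (auto simp: R_def fun_eq_iff pointwise_scale_def mult.assoc)
  have le_dual_norm: "norm (\<phi> h) \<le> dual_norm H c0_norm \<phi> * c0_norm h" and dual_nonneg: "0 \<le> dual_norm H c0_norm \<phi>"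
    if "\<phi> \<in> \<Phi>" "h \<in> H" for \<phi> h
    using that le_op_norm[OF H.normed_space_on_axioms field, of \<phi> h]
      op_norm_nonneg[OF H.normed_space_on_axioms field, of \<phi>]
    unfolding \<Phi>_def dual_space_def dual_norm_def by blast+
  have H0: "0 \<in> H" by (rule H.subspace_0[OF H(1)])
  have R_dual_norm: "dual_norm H c0_norm (R x) \<le> l1_norm x" if x: "x \<in> l1" for x
    unfolding dual_norm_def op_norm_def
  proof (rule cSUP_least)
    show "{h \<in> H. c0_norm h \<le> 1} \<noteq> {}"
      using H0 H.norm_on_0 by auto
    fix h assume h: "h \<in> {h \<in> H. c0_norm h \<le> 1}"
    then have "norm (R x h) \<le> l1_norm x * c0_norm h"
      using R_le[OF x] by blast
    also have "\<dots> \<le> l1_norm x * 1"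
      using h l1_norm_nonneg[OF x] by (intro mult_left_mono) auto
    finally show "norm (R x h) \<le> l1_norm x" by simp
  qed
  have T: "linear_map_on scale_fun t \<Phi> T" "bij_betw T \<Phi> W"
    using iso by (simp_all add: banach_iso_def \<Phi>_def)
  obtain C1 where C1: "\<And>\<phi>. \<phi> \<in> \<Phi> \<Longrightarrow> M (T \<phi>) \<le> C1 * dual_norm H c0_norm \<phi>"
    using iso by (auto simp: banach_iso_def bounded_map_on_def \<Phi>_def)
  obtain C2 where C2: "\<And>w. w \<in> W \<Longrightarrow> dual_norm H c0_norm (inv_into \<Phi> T w) \<le> C2 * M w"
    using iso by (auto simp: banach_iso_def bounded_map_on_def \<Phi>_def)
  define C where "C = \<bar>C1\<bar> + 2 * \<bar>C2\<bar>"
  show ?thesis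
  proof (rule that)
    show "0 \<le> C" by (simp add: C_def)
    show "linear_map_on scale_fun t l1 (T \<circ> R)"
      using T(1) R_dual by (simp add: linear_map_on_def R_add R_scale)
    show "(T \<circ> R) x \<in> W" if "x \<in> l1" for x
      using T(2) R_dual[OF that] by (auto simp: bij_betw_def)
    show "M ((T \<circ> R) x) \<le> C * l1_norm x" if x: "x \<in> l1" for x
    proof -
      have "M ((T \<circ> R) x) \<le> C1 * dual_norm H c0_norm (R x)"
        using C1[OF R_dual[OF x]] by simp
      also have "\<dots> \<le> C * l1_norm x"
        using R_dual_norm[OF x] dual_nonneg[OF R_dual[OF x] H0] by (intro mult_mono) (auto simp: C_def)
      finally show ?thesis .
    qed
    show "\<exists>x\<in>l1. (T \<circ> R) x = w \<and> l1_norm x \<le> C * M w" if w: "w \<in> W" for w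
    proof -
      define \<phi> where "\<phi> = inv_into \<Phi> T w"
      have \<phi>: "\<phi> \<in> \<Phi>" "T \<phi> = w"
        using T(2) w by (auto simp: \<phi>_def bij_betw_inv_into_right bij_betw_def inv_into_into)
      obtain x where x: "x \<in> l1" "l1_norm x \<le> 2 * dual_norm H c0_norm \<phi>"
        "\<And>h. h \<in> H \<Longrightarrow> (\<lambda>n. x n * h n) sums \<phi> h"
      proof (rule c0_functional_represented_in_l1[OF H])
        show "linear_map_on scale_fun (*) H \<phi>"
          using \<phi>(1) by (simp add: \<Phi>_def dual_space_def)
      qed (use le_dual_norm[OF \<phi>(1)] dual_nonneg[OF \<phi>(1) H0] in auto)
      have "R x = \<phi>"
        using x(3) \<phi>(1) by (auto simp: R_def \<Phi>_def dual_space_def fun_eq_iff sums_iff)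
      moreover have "l1_norm x \<le> C * M w"
      proof -
        have "2 * dual_norm H c0_norm \<phi> \<le> 2 * (C2 * M w)"
          using C2[OF w] by (simp add: \<phi>_def)
        also have "\<dots> \<le> C * M w"
          using M[OF w] unfolding C_def mult.assoc[symmetric] by (intro mult_right_mono) auto
        finally show ?thesis using x(2) by simp
      qed
      ultimately show ?thesis
        using x(1) \<phi>(2) by auto
    qed
    show "(T \<circ> R) x = 0 \<longleftrightarrow> x \<in> annihilator H" if x: "x \<in> l1" for x
    proof -
      have zero: "R 0 = 0" by (simp add: R_def fun_eq_iff)
      have l10: "0 \<in> l1" by (simp add: l1_iff)
      have "T (scale_fun 0 (R 0)) = t 0 (T (R 0))"
        using T(1) R_dual[OF l10] by (simp add: linear_map_on_def)
      moreover have "scale_fun 0 (R 0) = R 0"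
        by (simp add: zero pointwise_scale_def fun_eq_iff)
      ultimately have T0: "T (R 0) = 0" by simp
      have "(T \<circ> R) x = 0 \<longleftrightarrow> R x = R 0"
        using T(2) R_dual[OF x] R_dual[OF l10] T0 unfolding bij_betw_def comp_def
        by (metis inj_onD)
      also have "\<dots> \<longleftrightarrow> x \<in> annihilator H"
        using x by (auto simp: zero annihilator_def R_def fun_eq_iff)
      finally show ?thesis .
    qed
  qed
qed

text \<open>The Rademacher functions vanish in the quotient.\<close>

lemma rad_quot_map_rademacher:
  "(\<Sum>\<omega><2 ^ d. scale_fun (of_real (rademacher k \<omega>)) (rad_quot_map d (unit_seq \<omega> :: nat \<Rightarrow> 'k::real_normed_field))) = 0"
  if "k < d"
proof
  fix \<nu>
  have eq: "(\<Sum>\<omega><2 ^ d. scale_fun (of_real (rademacher k \<omega>)) (rad_quot_map d (unit_seq \<omega> :: nat \<Rightarrow> 'k)))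
      = rad_quot_map d (\<Sum>\<omega><2 ^ d. scale_fun (of_real (rademacher k \<omega>)) (unit_seq \<omega>))"
  proof (rule linear_map_on_sum[OF vector_space_scale_fun vector_space_scale_fun, symmetric])
    show "linear_map_on scale_fun scale_fun UNIV (rad_quot_map d :: (nat \<Rightarrow> 'k) \<Rightarrow> _)"
      by (auto simp: linear_map_on_def fun_eq_iff rad_quot_map_def pointwise_scale_def plus_fun_def
          rad_proj_add rad_proj_mult)
    show "module.subspace scale_fun (UNIV :: (nat \<Rightarrow> 'k) set)"
      by (intro module.subspace_UNIV) (simp add: module_iff_vector_space vector_space_scale_fun)
  qed simp
  have val: "(\<Sum>\<omega><2 ^ d. scale_fun (of_real (rademacher k \<omega>)) (unit_seq \<omega> :: nat \<Rightarrow> 'k)) \<omega>' = rad_sum d (unit_seq k) \<omega>'"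
    if "\<omega>' < 2 ^ d" for \<omega>'
  proof -
    have "(\<Sum>\<omega><2 ^ d. scale_fun (of_real (rademacher k \<omega>)) (unit_seq \<omega> :: nat \<Rightarrow> 'k)) \<omega>'
        = (\<Sum>\<omega><2 ^ d. if \<omega> = \<omega>' then of_real (rademacher k \<omega>) else 0)"
      unfolding sum_function_apply by (intro sum.cong) (auto simp: pointwise_scale_def unit_seq_def)
    moreover have "rad_sum d (unit_seq k :: nat \<Rightarrow> 'k) \<omega>' = (\<Sum>l<d. if l = k then of_real (rademacher l \<omega>') else 0)"
      unfolding rad_sum_def by (intro sum.cong) (auto simp: unit_seq_def scaleR_conv_of_real)
    ultimately show ?thesis
      using that \<open>k < d\<close> by simp
  qed
  have "rad_proj d (\<Sum>\<omega><2 ^ d. scale_fun (of_real (rademacher k \<omega>)) (unit_seq \<omega> :: nat \<Rightarrow> 'k)) \<nu>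
      = rad_proj d (rad_sum d (unit_seq k)) \<nu>" if "\<nu> < 2 ^ d"
    using that val by (simp add: rad_proj_def rad_sum_def rad_coeff_def)
  then show "(\<Sum>\<omega><2 ^ d. scale_fun (of_real (rademacher k \<omega>)) (rad_quot_map d (unit_seq \<omega> :: nat \<Rightarrow> 'k))) \<nu> = 0 \<nu>"
    unfolding eq rad_quot_map_def by (simp add: rad_proj_rad_sum)
qed

theorem proposition2:
  fixes s :: "'k::real_or_complex \<Rightarrow> 'v::ab_group_add \<Rightarrow> 'v"
    and F :: "nat \<Rightarrow> 'v set" and NF :: "nat \<Rightarrow> 'v \<Rightarrow> real"
    and H :: "(nat \<Rightarrow> 'k) set"
  assumes fin_dim: "\<And>n. finite_dim_banach_on s (F n) (NF n)"
    and dense: "banach_mazur_dense s F NF"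
    and closed_subspace: "closed_subspace_c0 H"
    and dual: "\<exists>T. banach_iso scale_fun (dual_space scale_fun H c0_norm) (dual_norm H c0_norm)
                     (pointwise_scale s) (l1_sum F NF) (l1_sum_norm NF) T"
  shows "\<exists>B. continuous_bilinear_form_on scale_fun (annihilator H) l1_norm B \<and>
           \<not> (\<exists>B'. continuous_bilinear_form_on scale_fun l1 l1_norm B' \<and>
                  (\<forall>x\<in>annihilator H. \<forall>y\<in>annihilator H. B' x y = B x y))"
proof -
  interpret F: finite_dim_banach_on s "F n" "NF n" for n
    by (rule fin_dim)
  have vsF: "vector_space (pointwise_scale s :: 'k \<Rightarrow> (nat \<Rightarrow> 'v) \<Rightarrow> nat \<Rightarrow> 'v)"
    by (rule vector_space_pointwise_scale[OF F.vector_space_axioms])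
  interpret PF: vector_space "pointwise_scale s :: 'k \<Rightarrow> (nat \<Rightarrow> 'v) \<Rightarrow> nat \<Rightarrow> 'v"
    by (rule vsF)
  interpret S: vector_space "scale_fun :: 'k \<Rightarrow> (nat \<Rightarrow> 'k) \<Rightarrow> nat \<Rightarrow> 'k"
    by (rule vector_space_scale_fun)
  have F0: "0 \<in> F n" for n by (rule F.subspace_0[OF F.subspace_carrier])
  have H: "module.subspace scale_fun H" "H \<subseteq> c0"
  proof -
    interpret N: normed_space_on scale_fun "c0 :: (nat \<Rightarrow> 'k) set" c0_norm
      by (rule normed_space_on_subspace_c0[OF subspace_c0 order_refl])
    interpret Metric_space "c0 :: (nat \<Rightarrow> 'k) set" "norm_dist c0 c0_norm"
      by (rule N.Metric_space_norm_dist)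
    show "module.subspace scale_fun H" "H \<subseteq> c0"
      using closed_subspace closedin_subset[of mtopology H] by (auto simp: closed_subspace_c0_def)
  qed
  have coord: "\<xi> n \<in> F n" "NF n (\<xi> n) \<le> l1_sum_norm NF \<xi>" if "\<xi> \<in> l1_sum F NF" for \<xi> n
  proof -
    show "\<xi> n \<in> F n" using that by (simp add: l1_sum_def)
    have "sum (\<lambda>n. NF n (\<xi> n)) {n} \<le> l1_sum_norm NF \<xi>"
      unfolding l1_sum_norm_def using that F.norm_on_nonneg
      by (intro sum_le_suminf) (auto simp: l1_sum_def)
    then show "NF n (\<xi> n) \<le> l1_sum_norm NF \<xi>" by simp
  qed
  have l1_sum_nonneg: "0 \<le> l1_sum_norm NF \<xi>" if "\<xi> \<in> l1_sum F NF" for \<xi>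
    using coord[OF that, of 0] F.norm_on_nonneg by force
  obtain T0 where T0: "banach_iso scale_fun (dual_space scale_fun H c0_norm) (dual_norm H c0_norm)
                     (pointwise_scale s) (l1_sum F NF) (l1_sum_norm NF) T0"
    using dual by blast
  obtain q C where C: "0 \<le> C" and q_lin: "linear_map_on scale_fun (pointwise_scale s) l1 q"
    and q_in: "\<And>x. x \<in> l1 \<Longrightarrow> q x \<in> l1_sum F NF"
    and q_le: "\<And>x. x \<in> l1 \<Longrightarrow> l1_sum_norm NF (q x) \<le> C * l1_norm x"
    and q_onto: "\<And>\<xi>. \<xi> \<in> l1_sum F NF \<Longrightarrow> \<exists>x\<in>l1. q x = \<xi> \<and> l1_norm x \<le> C * l1_sum_norm NF \<xi>"
    and q_ker: "\<And>x. x \<in> l1 \<Longrightarrow> q x = 0 \<longleftrightarrow> x \<in> annihilator H"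
    by (rule annihilator_quotient_map[OF H vsF l1_sum_nonneg T0]) (assumption, rule that, assumption, assumption, blast+)
  define \<iota> where "\<iota> n v = (\<lambda>i. if i = n then v else 0)" for n :: nat and v :: 'v
  have \<iota>: "\<iota> n v \<in> l1_sum F NF" "l1_sum_norm NF (\<iota> n v) = NF n v" if "v \<in> F n" for n v
  proof -
    have "(\<lambda>i. NF i (\<iota> n v i)) sums (\<Sum>i\<in>{n}. NF i (\<iota> n v i))"
      by (rule sums_finite) (auto simp: \<iota>_def F.norm_on_0)
    then show "\<iota> n v \<in> l1_sum F NF" "l1_sum_norm NF (\<iota> n v) = NF n v"
      using that F0 by (auto simp: l1_sum_def l1_sum_norm_def \<iota>_def sums_iff)
  qed
  define V where "V m = (rad_quot (16 ^ m) :: (nat \<Rightarrow> 'k) set)" for m :: nat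
  define NV where "NV m = (rad_quot_norm (16 ^ m) :: (nat \<Rightarrow> 'k) \<Rightarrow> real)" for m :: nat
  have V: "finite_dim_banach_on scale_fun (V m) (NV m)" for m
    unfolding V_def NV_def by (rule finite_dim_banach_on_rad_quot)
  interpret V: finite_dim_banach_on scale_fun "V m" "NV m" for m
    by (rule V)
  have "\<exists>n. vector_space.dim s (F n) = vector_space.dim scale_fun (V m) \<and>
      banach_mazur_dist scale_fun (V m) (NV m) s (F n) (NF n) \<le> 1 + 1" for m
    using dense V[of m] unfolding banach_mazur_dense_def by (meson zero_less_one)
  then obtain n where n_dim: "\<And>m. vector_space.dim s (F (n m)) = vector_space.dim scale_fun (V m)"
    and n_dist: "\<And>m. banach_mazur_dist scale_fun (V m) (NV m) s (F (n m)) (NF (n m)) \<le> 1 + 1"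
    by metis
  have n_less: "n i \<noteq> n m" if "i < m" for i m
  proof -
    have "(16::nat) ^ i * 16 \<le> 16 ^ m"
      using power_increasing[of "Suc i" m "16::nat"] that by simp
    moreover have "(1::nat) \<le> 16 ^ i" by simp
    ultimately have "(16::nat) ^ i + 2 \<le> 16 ^ m" by linarith
    then show ?thesis
      using rad_quot_dim_strict_mono[where 'k = 'k] n_dim unfolding V_def by (metis less_irrefl)
  qed
  then have n_inj: "n i \<noteq> n m" if "i \<noteq> m" for i m
    using that by (metis linorder_neqE_nat)
  have "\<exists>T. linear_map_on scale_fun s (V m) T \<and> bij_betw T (V m) (F (n m)) \<and>
      (\<forall>x\<in>V m. NF (n m) (T x) \<le> 3 * NV m x) \<and> (\<forall>x\<in>V m. NV m x \<le> NF (n m) (T x))" for m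
    by (rule banach_mazur_dist_isomorphism[OF V fin_dim n_dim[symmetric], of m 3])
      (use n_dist[of m] in auto)
  then obtain T where T_lin: "\<And>m. linear_map_on scale_fun s (V m) (T m)"
    and T_bij: "\<And>m. bij_betw (T m) (V m) (F (n m))"
    and T_le: "\<And>m x. x \<in> V m \<Longrightarrow> NF (n m) (T m x) \<le> 3 * NV m x"
    and le_T: "\<And>m x. x \<in> V m \<Longrightarrow> NV m x \<le> NF (n m) (T m x)"
    by metis
  \<comment> \<open>\<open>J m\<close> identifies \<open>F (n m)\<close> with the \<open>m\<close>-th concrete quotient, and \<open>\<iota>\<close> embeds the summands.\<close>
  define J where "J m = inv_into (V m) (T m)" for m
  have J_lin: "linear_map_on s scale_fun (F (n m)) (J m)" for m
    unfolding J_def by (rule linear_map_on_inv_into[OF vector_space_scale_fun V.subspace_carrier T_lin T_bij])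
  have J_in: "J m v \<in> V m" and T_J: "T m (J m v) = v" if "v \<in> F (n m)" for m v
    using that T_bij[of m] unfolding J_def by (auto simp: bij_betw_inv_into_right bij_betw_def inv_into_into)
  have J_T: "J m (T m x) = x" if "x \<in> V m" for m x
    using that T_bij[of m] unfolding J_def by (simp add: bij_betw_inv_into_left)
  have J_le: "NV m (J m v) \<le> NF (n m) v" if "v \<in> F (n m)" for m v
    using le_T[OF J_in[OF that]] T_J[OF that] by simp
  have J0: "J m 0 = 0" for m
    using J_lin[of m] F0[of "n m"] unfolding linear_map_on_def by (metis F.scale_zero_left S.scale_zero_left)
  have T_in: "T m x \<in> F (n m)" if "x \<in> V m" for m x
    using that T_bij[of m] by (auto simp: bij_betw_def)
  have T_0: "T m 0 = 0" for m
    using T_J[OF F0, of m] J0[of m] by simp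
  define p where "p m x = J m (q x (n m))" for m x
  define g where "g m \<omega> = (rad_quot_map (16 ^ m) (unit_seq \<omega>) :: nat \<Rightarrow> 'k)" for m \<omega> :: nat
  have g_in: "g m \<omega> \<in> V m" for m \<omega>
    unfolding g_def V_def by (rule rad_quot_map_in)
  have g_le: "NV m (g m \<omega>) \<le> 1" for m \<omega>
  proof -
    have "(\<Sum>\<nu><2 ^ 16 ^ m. norm (unit_seq \<omega> \<nu> :: 'k)) = (\<Sum>\<nu><2 ^ 16 ^ m. if \<nu> = \<omega> then 1 else 0)"
      by (intro sum.cong) (auto simp: unit_seq_def)
    also have "\<dots> \<le> 1" by simp
    finally show ?thesis
      using rad_quot_norm_map_le[of "16 ^ m" "unit_seq \<omega> :: nat \<Rightarrow> 'k"] by (simp add: NV_def g_def)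
  qed
  have "\<exists>y\<in>l1. q y = \<iota> (n m) (T m (g m \<omega>)) \<and> l1_norm y \<le> 3 * C" for m \<omega>
  proof -
    obtain y where y: "y \<in> l1" "q y = \<iota> (n m) (T m (g m \<omega>))" "l1_norm y \<le> C * NF (n m) (T m (g m \<omega>))"
      using q_onto[OF \<iota>(1)[OF T_in[OF g_in]]] \<iota>(2)[OF T_in[OF g_in]] by metis
    have "NF (n m) (T m (g m \<omega>)) \<le> 3"
      using T_le[OF g_in, of m \<omega>] g_le[of m \<omega>] by linarith
    then have "l1_norm y \<le> C * 3"
      using y(3) mult_left_mono[OF _ C] by fastforce
    with y show ?thesis by (auto simp: mult.commute)
  qed
  then obtain Y where Y: "\<And>m \<omega>. Y m \<omega> \<in> l1" "\<And>m \<omega>. q (Y m \<omega>) = \<iota> (n m) (T m (g m \<omega>))"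
    "\<And>m \<omega>. l1_norm (Y m \<omega>) \<le> 3 * C"
    by metis
  show ?thesis
  proof (rule nonextendable_bilinear_form_on_l1_subset[of "annihilator H" "3 * C" p Y])
    show "annihilator H \<subseteq> l1" by (auto simp: annihilator_def)
    show "0 \<le> 3 * C" using C by simp
    show "linear_map_on scale_fun scale_fun l1 (p m)" for m
      using q_lin J_lin[of m] q_in coord(1) by (simp add: p_def linear_map_on_def pointwise_scale_def)
    show "p m x \<in> rad_quot (16 ^ m)" if "x \<in> l1" for m x
      unfolding p_def V_def[symmetric] by (intro J_in coord(1) q_in that)
    show "rad_quot_norm (16 ^ m) (p m x) \<le> 3 * C * l1_norm x" if x: "x \<in> l1" for m x
    proof -
      have "NV m (p m x) \<le> NF (n m) (q x (n m))"
        unfolding p_def by (intro J_le coord(1) q_in x)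
      also have "\<dots> \<le> l1_sum_norm NF (q x)"
        by (intro coord(2) q_in x)
      also have "\<dots> \<le> C * l1_norm x" by (rule q_le[OF x])
      also have "\<dots> \<le> 3 * C * l1_norm x"
        using C l1_norm_nonneg[OF x] by (intro mult_right_mono) auto
      finally show ?thesis by (simp add: NV_def)
    qed
    show "p m x = 0" if "x \<in> annihilator H" for m x
    proof -
      have "x \<in> l1" using that by (auto simp: annihilator_def)
      then have "q x = 0" using q_ker that by simp
      then show ?thesis by (simp add: p_def J0)
    qed
    show "Y m \<omega> \<in> l1" "l1_norm (Y m \<omega>) \<le> 3 * C" for m \<omega>
      by (rule Y)+
    show "p m (Y m \<omega>) = rad_quot_map (16 ^ m) (unit_seq \<omega>)" for m \<omega>
      by (simp add: p_def Y(2) \<iota>_def J_T[OF g_in]) (simp add: g_def)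
    show "p j (Y m \<omega>) = 0" if "j \<noteq> m" for m j \<omega>
      using n_inj[OF that] by (simp add: p_def Y(2) \<iota>_def J0)
    show "(\<Sum>\<omega><2 ^ 16 ^ m. scale_fun (of_real (rademacher k \<omega>)) (Y m \<omega>)) \<in> annihilator H"
      if k: "k < 16 ^ m" for m k
    proof -
      define z where "z = (\<Sum>\<omega><2 ^ 16 ^ m. scale_fun (of_real (rademacher k \<omega>)) (Y m \<omega>))"
      have z: "z \<in> l1"
        unfolding z_def by (intro S.subspace_sum S.subspace_scale subspace_l1 Y(1))
      have "q z = (\<Sum>\<omega><2 ^ 16 ^ m. pointwise_scale s (of_real (rademacher k \<omega>)) (\<iota> (n m) (T m (g m \<omega>))))"
        unfolding z_def Y(2)[symmetric]
        by (rule linear_map_on_sum[OF vector_space_scale_fun vsF subspace_l1 q_lin Y(1)])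
      also have "\<dots> = \<iota> (n m) (\<Sum>\<omega><2 ^ 16 ^ m. s (of_real (rademacher k \<omega>)) (T m (g m \<omega>)))"
        by (auto simp: fun_eq_iff sum_function_apply pointwise_scale_def \<iota>_def)
      also have "(\<Sum>\<omega><2 ^ 16 ^ m. s (of_real (rademacher k \<omega>)) (T m (g m \<omega>)))
          = T m (\<Sum>\<omega><2 ^ 16 ^ m. scale_fun (of_real (rademacher k \<omega>)) (g m \<omega>))"
        by (rule linear_map_on_sum[OF vector_space_scale_fun F.vector_space_axioms V.subspace_carrier T_lin g_in, symmetric])
      also have "\<dots> = 0"
        unfolding g_def rad_quot_map_rademacher[OF k] by (rule T_0)
      finally have "q z = 0"
        by (simp add: \<iota>_def fun_eq_iff)
      then show ?thesis
        using q_ker[OF z] by (simp add: z_def)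
    qed
  qed
qed

end
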